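(* Any nonsemisimple quasi-Hopf algebra over $\mathbb{C}$ of dimension $4$ is twist equivalent to the Sweedler Hopf algebra $H_4$.
   Context: Quasi-Hopf algebras are in Drinfeld's sense, $(H,\Delta,\varepsilon,\Phi,S,\alpha,\beta)$, with $(\mathrm{id}\otimes\Delta)\Delta(a)=\Phi(\Delta\otimes\mathrm{id})\Delta(a)\Phi^{-1}$, the pentagon equation, and the usual antipode axioms (antipode data considered up to $(S,\alpha,\beta)\mapsto(uSu^{-1},u\alpha,\beta u^{-1})$, $u$ invertible). Nonsemisimple means nonsemisimple as an algebra. Two quasi-Hopf algebras $H,H'$ are twist equivalent if $H'\cong H^J$ for an invertible $J\in H\otimes H$ with $(\varepsilon\otimes\mathrm{id})(J)=(\mathrm{id}\otimes\varepsilon)(J)=1$, where $H^J$ is the algebra $H$ with coproduct $J\Delta(\cdot)J^{-1}$ and associator $(1\otimes J)(\mathrm{id}\otimes\Delta)(J)\Phi(\Delta\otimes\mathrm{id})(J^{-1})(J^{-1}\otimes1)$. $H_4$ is the $4$-dimensional Hopf algebra generated by $g,x$ with $g^2=1$, $x^2=0$, $gx=-xg$, $g$ grouplike, $\Delta(x)=x\otimes 1+g\otimes x$. *)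

theory Defs
  imports Complex_Main "HOL-Library.Poly_Mapping" "HOL-Library.FuncSet"
begin

section \<open>Complex vector spaces and complex algebras\<close>

class complex_vector = ab_group_add +
  fixes scaleC :: "complex \<Rightarrow> 'a \<Rightarrow> 'a" (infixr \<open>*\<^sub>C\<close> 75)
  assumes scaleC_add_right: "c *\<^sub>C (x + y) = c *\<^sub>C x + c *\<^sub>C y"
    and scaleC_add_left: "(c + d) *\<^sub>C x = c *\<^sub>C x + d *\<^sub>C x"
    and scaleC_scaleC: "c *\<^sub>C d *\<^sub>C x = (c * d) *\<^sub>C x"
    and scaleC_one: "1 *\<^sub>C x = x"

class complex_algebra_1 = complex_vector + ring_1 +
  assumes mult_scaleC_left: "(c *\<^sub>C x) * y = c *\<^sub>C (x * y)"
    and mult_scaleC_right: "x * (c *\<^sub>C y) = c *\<^sub>C (x * y)"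

global_interpretation complex_vector:
  vector_space "scaleC :: complex \<Rightarrow> 'a \<Rightarrow> 'a::complex_vector"
  by unfold_locales (simp_all add: scaleC_add_right scaleC_add_left scaleC_scaleC scaleC_one)

global_interpretation complex_vector:
  vector_space_pair "scaleC :: complex \<Rightarrow> 'a \<Rightarrow> 'a::complex_vector"
    "scaleC :: complex \<Rightarrow> 'b \<Rightarrow> 'b::complex_vector"
  by unfold_locales

instantiation complex :: complex_algebra_1
begin
definition scaleC_complex :: "complex \<Rightarrow> complex \<Rightarrow> complex"
  where "scaleC_complex c x = c * x"
instance
  by standard (simp_all add: scaleC_complex_def algebra_simps)
end

instantiation poly_mapping :: (type, complex_vector) complex_vector
begin
lift_definition scaleC_poly_mapping :: "complex \<Rightarrow> ('a \<Rightarrow>\<^sub>0 'b) \<Rightarrow> ('a \<Rightarrow>\<^sub>0 'b)"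
  is "\<lambda>c f x. c *\<^sub>C f x"
  by (erule finite_subset[rotated]) auto
instance
  by standard
    (transfer; simp add: scaleC_add_right scaleC_add_left scaleC_scaleC scaleC_one fun_eq_iff)+
end

lemma lookup_scaleC [simp]: "Poly_Mapping.lookup (c *\<^sub>C f) x = c *\<^sub>C Poly_Mapping.lookup f x"
  by transfer simp

abbreviation clinear :: "('a::complex_vector \<Rightarrow> 'b::complex_vector) \<Rightarrow> bool"
  where "clinear \<equiv> Vector_Spaces.linear scaleC scaleC"

definition cbilinear :: "('a::complex_vector \<Rightarrow> 'b::complex_vector \<Rightarrow> 'c::complex_vector) \<Rightarrow> bool"
  where "cbilinear f \<longleftrightarrow> (\<forall>a. clinear (f a)) \<and> (\<forall>b. clinear (\<lambda>a. f a b))"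

lemma clinear_iff:
  fixes f :: "'a::complex_vector \<Rightarrow> 'b::complex_vector"
  shows "clinear f \<longleftrightarrow> (\<forall>x y. f (x + y) = f x + f y) \<and> (\<forall>c x. f (c *\<^sub>C x) = c *\<^sub>C f x)"
  using complex_vector.vector_space_axioms complex_vector.vector_space_axioms
  by (auto simp: Vector_Spaces.linear_iff)

lemma clinear_zero: "clinear f \<Longrightarrow> f 0 = 0"
  by (rule complex_vector.linear_0)

lemma clinear_diff: "clinear f \<Longrightarrow> f (x - y) = f x - f y"
  by (rule complex_vector.linear_diff)


section \<open>Tensor products\<close>

text \<open>The tensor product is the free vector space on \<open>'a \<times> 'b\<close> modulo the subspace spanned by
  the bilinearity relations.\<close>

definition tensor_relators :: "('a::complex_vector \<times> 'b::complex_vector \<Rightarrow>\<^sub>0 complex) set"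
  where "tensor_relators =
    {Poly_Mapping.single (a + a', b) 1 - Poly_Mapping.single (a, b) 1 - Poly_Mapping.single (a', b) 1 | a a' b. True}
    \<union> {Poly_Mapping.single (a, b + b') 1 - Poly_Mapping.single (a, b) 1 - Poly_Mapping.single (a, b') 1 | a b b'. True}
    \<union> {Poly_Mapping.single (c *\<^sub>C a, b) 1 - c *\<^sub>C Poly_Mapping.single (a, b) 1 | c a b. True}
    \<union> {Poly_Mapping.single (a, c *\<^sub>C b) 1 - c *\<^sub>C Poly_Mapping.single (a, b) 1 | c a b. True}"

definition tensor_eq ::
    "('a::complex_vector \<times> 'b::complex_vector \<Rightarrow>\<^sub>0 complex) \<Rightarrow> ('a \<times> 'b \<Rightarrow>\<^sub>0 complex) \<Rightarrow> bool"
  where "tensor_eq x y \<longleftrightarrow> x - y \<in> complex_vector.span tensor_relators"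

lemma equivp_tensor_eq: "equivp tensor_eq"
proof (rule equivpI)
  show "reflp tensor_eq"
    by (simp add: reflp_def tensor_eq_def complex_vector.span_zero)
  show "symp tensor_eq"
    unfolding symp_def tensor_eq_def using complex_vector.span_neg by fastforce
  show "transp tensor_eq"
    unfolding transp_def tensor_eq_def using complex_vector.span_add by fastforce
qed

quotient_type (overloaded) ('a, 'b) tensor (infixr \<open>\<otimes>\<close> 20) =
  "'a::complex_vector \<times> 'b::complex_vector \<Rightarrow>\<^sub>0 complex" / tensor_eq
  by (rule equivp_tensor_eq)

instantiation tensor :: (complex_vector, complex_vector) complex_vector
begin

lift_definition zero_tensor :: "'a \<otimes> 'b" is 0 .

lift_definition plus_tensor :: "'a \<otimes> 'b \<Rightarrow> 'a \<otimes> 'b \<Rightarrow> 'a \<otimes> 'b" is "(+)"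
proof -
  fix x x' y y' :: "'a \<times> 'b \<Rightarrow>\<^sub>0 complex"
  assume "tensor_eq x x'" "tensor_eq y y'"
  then have "(x - x') + (y - y') \<in> complex_vector.span tensor_relators"
    unfolding tensor_eq_def by (rule complex_vector.span_add)
  then show "tensor_eq (x + y) (x' + y')" by (simp add: tensor_eq_def algebra_simps)
qed

lift_definition uminus_tensor :: "'a \<otimes> 'b \<Rightarrow> 'a \<otimes> 'b" is uminus
  unfolding tensor_eq_def using complex_vector.span_neg by fastforce

definition minus_tensor :: "'a \<otimes> 'b \<Rightarrow> 'a \<otimes> 'b \<Rightarrow> 'a \<otimes> 'b"
  where "minus_tensor x y = x + - y"

lift_definition scaleC_tensor :: "complex \<Rightarrow> 'a \<otimes> 'b \<Rightarrow> 'a \<otimes> 'b" is scaleC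
  unfolding tensor_eq_def
  by (metis complex_vector.span_scale complex_vector.scale_right_diff_distrib)

instance
proof
  fix x y z :: "'a \<otimes> 'b" and c d :: complex
  have tensor_eqI: "u = v \<Longrightarrow> tensor_eq u v" for u v :: "'a \<times> 'b \<Rightarrow>\<^sub>0 complex"
    by (simp add: equivp_tensor_eq equivp_reflp)
  show "x + y + z = x + (y + z)" by transfer (simp add: tensor_eqI add.assoc)
  show "x + y = y + x" by transfer (simp add: tensor_eqI add.commute)
  show "0 + x = x" by transfer (simp add: tensor_eqI)
  show "- x + x = 0" by transfer (simp add: tensor_eqI)
  show "x - y = x + - y" by (simp add: minus_tensor_def)
  show "c *\<^sub>C (x + y) = c *\<^sub>C x + c *\<^sub>C y" by transfer (simp add: tensor_eqI scaleC_add_right)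
  show "(c + d) *\<^sub>C x = c *\<^sub>C x + d *\<^sub>C x" by transfer (simp add: tensor_eqI scaleC_add_left)
  show "c *\<^sub>C d *\<^sub>C x = (c * d) *\<^sub>C x" by transfer (simp add: tensor_eqI scaleC_scaleC)
  show "1 *\<^sub>C x = x" by transfer (simp add: tensor_eqI scaleC_one)
qed

end

lift_definition tens :: "'a::complex_vector \<Rightarrow> 'b::complex_vector \<Rightarrow> 'a \<otimes> 'b" (infixr \<open>\<otimes>\<^sub>t\<close> 72)
  is "\<lambda>a b. Poly_Mapping.single (a, b) 1" .

lemma cbilinear_tens: "cbilinear ((\<otimes>\<^sub>t) :: 'a::complex_vector \<Rightarrow> 'b::complex_vector \<Rightarrow> 'a \<otimes> 'b)"
proof -
  have B: "x \<in> tensor_relators \<Longrightarrow> x \<in> complex_vector.span tensor_relators"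
    for x :: "'a \<times> 'b \<Rightarrow>\<^sub>0 complex" by (rule complex_vector.span_base)
  have "(a + a') \<otimes>\<^sub>t b = a \<otimes>\<^sub>t b + a' \<otimes>\<^sub>t b" for a a' :: 'a and b :: 'b
    by transfer (unfold tensor_eq_def diff_diff_eq[symmetric], rule B, unfold tensor_relators_def, blast)
  moreover have "a \<otimes>\<^sub>t (b + b') = a \<otimes>\<^sub>t b + a \<otimes>\<^sub>t b'" for a :: 'a and b b' :: 'b
    by transfer (unfold tensor_eq_def diff_diff_eq[symmetric], rule B, unfold tensor_relators_def, blast)
  moreover have "(c *\<^sub>C a) \<otimes>\<^sub>t b = c *\<^sub>C (a \<otimes>\<^sub>t b)" for a :: 'a and b :: 'b and c
    by transfer (unfold tensor_eq_def, rule B, unfold tensor_relators_def, blast)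
  moreover have "a \<otimes>\<^sub>t (c *\<^sub>C b) = c *\<^sub>C (a \<otimes>\<^sub>t b)" for a :: 'a and b :: 'b and c
    by transfer (unfold tensor_eq_def, rule B, unfold tensor_relators_def, blast)
  ultimately show ?thesis by (simp add: cbilinear_def clinear_iff)
qed

lemmas tens_linear =
  cbilinear_tens[unfolded cbilinear_def clinear_iff, THEN conjunct1, rule_format, THEN conjunct1, rule_format]
  cbilinear_tens[unfolded cbilinear_def clinear_iff, THEN conjunct1, rule_format, THEN conjunct2, rule_format]
  cbilinear_tens[unfolded cbilinear_def clinear_iff, THEN conjunct2, rule_format, THEN conjunct1, rule_format]
  cbilinear_tens[unfolded cbilinear_def clinear_iff, THEN conjunct2, rule_format, THEN conjunct2, rule_format]

text \<open>The linear map out of the tensor product induced by a bilinear map \<open>f\<close>; for \<open>f\<close> that is not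
  bilinear the value depends on the chosen representative (see \<open>tensor_lift_tens\<close> and
  \<open>clinear_tensor_lift\<close> for the universal property).\<close>

definition free_lift :: "('a \<Rightarrow> 'b \<Rightarrow> 'c::complex_vector) \<Rightarrow> ('a \<times> 'b \<Rightarrow>\<^sub>0 complex) \<Rightarrow> 'c"
  where "free_lift f x = (\<Sum>(a, b) \<in> Poly_Mapping.keys x. Poly_Mapping.lookup x (a, b) *\<^sub>C f a b)"

definition tensor_lift ::
    "('a::complex_vector \<Rightarrow> 'b::complex_vector \<Rightarrow> 'c::complex_vector) \<Rightarrow> 'a \<otimes> 'b \<Rightarrow> 'c"
  where "tensor_lift f t = free_lift f (rep_tensor t)"

lemma free_lift_superset:
  assumes "finite A" "Poly_Mapping.keys x \<subseteq> A"
  shows "free_lift f x = (\<Sum>p\<in>A. Poly_Mapping.lookup x p *\<^sub>C f (fst p) (snd p))"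
  unfolding free_lift_def case_prod_beta
  by (rule sum.mono_neutral_cong_left[OF assms]) (auto simp: in_keys_iff)

lemma clinear_free_lift: "clinear (free_lift f)"
proof (unfold clinear_iff, intro conjI allI)
  fix x y :: "'a \<times> 'b \<Rightarrow>\<^sub>0 complex"
  let ?A = "Poly_Mapping.keys x \<union> Poly_Mapping.keys y"
  have "Poly_Mapping.keys (x + y) \<subseteq> ?A" by (auto simp: in_keys_iff lookup_add)
  then show "free_lift f (x + y) = free_lift f x + free_lift f y"
    by (simp add: free_lift_superset[of ?A] lookup_add scaleC_add_left sum.distrib)
next
  fix c and x :: "'a \<times> 'b \<Rightarrow>\<^sub>0 complex"
  have "Poly_Mapping.keys (c *\<^sub>C x) \<subseteq> Poly_Mapping.keys x"
    by (auto simp: in_keys_iff)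
  then show "free_lift f (c *\<^sub>C x) = c *\<^sub>C free_lift f x"
    by (simp add: free_lift_superset[of "Poly_Mapping.keys x"] complex_vector.scale_sum_right
        scaleC_scaleC scaleC_complex_def)
qed

lemma free_lift_single: "free_lift f (Poly_Mapping.single (a, b) 1) = f a b"
  by (simp add: free_lift_def scaleC_one)

lemma free_lift_eq:
  assumes f: "cbilinear f" and "tensor_eq x y"
  shows "free_lift f x = free_lift f y"
proof -
  note lin = clinear_free_lift[of f, unfolded clinear_iff, THEN conjunct2, rule_format]
    clinear_diff[OF clinear_free_lift[of f]]
  have "free_lift f z = 0" if "z \<in> complex_vector.span tensor_relators" for z
    using that
  proof (induction rule: complex_vector.span_induct_alt)
    case base
    show ?case using clinear_free_lift by (rule clinear_zero)
  next
    case (step c x y)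
    have "free_lift f x = 0" using f step.hyps
      by (auto simp: tensor_relators_def lin free_lift_single cbilinear_def clinear_iff)
    with step show ?case using clinear_free_lift[of f] by (simp add: clinear_iff)
  qed
  with assms(2) have "free_lift f (x - y) = 0" by (simp add: tensor_eq_def)
  then show ?thesis by (simp add: lin)
qed

lemma tensor_lift_abs: "cbilinear f \<Longrightarrow> tensor_lift f (abs_tensor x) = free_lift f x"
  unfolding tensor_lift_def
  using Quotient3_rep_abs[OF Quotient3_tensor] equivp_tensor_eq
  by (metis equivp_reflp free_lift_eq)

lemma tensor_lift_tens: "cbilinear f \<Longrightarrow> tensor_lift f (a \<otimes>\<^sub>t b) = f a b"
  by (simp add: tens.abs_eq tensor_lift_abs free_lift_single)

lemma clinear_tensor_lift:
  assumes "cbilinear f" shows "clinear (tensor_lift f)"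
proof (unfold clinear_iff, intro conjI allI)
  note lin = clinear_free_lift[of f, unfolded clinear_iff]
  fix s t c
  show "tensor_lift f (s + t) = tensor_lift f s + tensor_lift f t"
    by (induct s rule: tensor.abs_induct, induct t rule: tensor.abs_induct)
      (simp add: plus_tensor.abs_eq tensor_lift_abs[OF assms] lin)
  show "tensor_lift f (c *\<^sub>C s) = c *\<^sub>C tensor_lift f s"
    by (induct s rule: tensor.abs_induct)
      (simp add: scaleC_tensor.abs_eq tensor_lift_abs[OF assms] lin)
qed

lemma tens_zero: "(0::'a::complex_vector) \<otimes>\<^sub>t (b::'b::complex_vector) = 0"
  using tens_linear(4)[of 0 "0::'a" b] by simp

lemma tensor_induct [case_names tens add]:
  fixes t :: "'a::complex_vector \<otimes> 'b::complex_vector"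
  assumes tens: "\<And>a b. P (a \<otimes>\<^sub>t b)" and add: "\<And>s t. P s \<Longrightarrow> P t \<Longrightarrow> P (s + t)"
  shows "P t"
proof (induct t rule: tensor.abs_induct)
  fix x :: "'a \<times> 'b \<Rightarrow>\<^sub>0 complex"
  show "P (abs_tensor x)"
  proof (induct x rule: update_induct)
    case const
    have "abs_tensor 0 = (0 :: 'a \<otimes> 'b)" by (simp add: zero_tensor.abs_eq)
    with tens[of 0 0] show ?case by (simp add: tens_zero)
  next
    case (update x p c)
    obtain a b where p: "p = (a, b)" by (cases p)
    have "Poly_Mapping.update p c x = x + c *\<^sub>C Poly_Mapping.single p 1"
      using update.hyps(1)
      by (intro poly_mapping_eqI)
        (auto simp: lookup_update lookup_add lookup_single in_keys_iff when_def scaleC_complex_def)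
    moreover have "(c *\<^sub>C a) \<otimes>\<^sub>t b = abs_tensor (c *\<^sub>C Poly_Mapping.single p 1)"
      unfolding tens_linear(4) by (simp add: p tens.abs_eq scaleC_tensor.abs_eq)
    ultimately have "abs_tensor (Poly_Mapping.update p c x) = abs_tensor x + (c *\<^sub>C a) \<otimes>\<^sub>t b"
      by (simp add: plus_tensor.abs_eq)
    with add[OF update.hyps(3) tens] show ?case by simp
  qed
qed

lemma clinear_tensor_eqI:
  assumes "clinear f" "clinear g" "\<And>a b. f (a \<otimes>\<^sub>t b) = g (a \<otimes>\<^sub>t b)"
  shows "f t = g t"
  by (induct t rule: tensor_induct) (use assms in \<open>simp_all add: clinear_iff\<close>)

lemma tensor_lift_add: "cbilinear f \<Longrightarrow> tensor_lift f (s + t) = tensor_lift f s + tensor_lift f t"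
  and tensor_lift_scaleC: "cbilinear f \<Longrightarrow> tensor_lift f (c *\<^sub>C t) = c *\<^sub>C tensor_lift f t"
  using clinear_tensor_lift[of f] by (simp_all add: clinear_iff)

definition tensor_map ::
    "('a::complex_vector \<Rightarrow> 'c::complex_vector) \<Rightarrow> ('b::complex_vector \<Rightarrow> 'd::complex_vector)
      \<Rightarrow> 'a \<otimes> 'b \<Rightarrow> 'c \<otimes> 'd"
  where "tensor_map f g = tensor_lift (\<lambda>a b. f a \<otimes>\<^sub>t g b)"

definition tensor_assoc ::
    "('a::complex_vector \<otimes> 'b::complex_vector) \<otimes> 'c::complex_vector \<Rightarrow> 'a \<otimes> 'b \<otimes> 'c"
  where "tensor_assoc = tensor_lift (\<lambda>u c. tensor_lift (\<lambda>a b. a \<otimes>\<^sub>t b \<otimes>\<^sub>t c) u)"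

text \<open>For a linear form \<open>\<phi>\<close>, the maps \<open>\<phi> \<otimes> id\<close> and \<open>id \<otimes> \<phi>\<close>, with the target
  identified with the remaining factor.\<close>

definition slice_left :: "('a::complex_vector \<Rightarrow> complex) \<Rightarrow> 'a \<otimes> 'b::complex_vector \<Rightarrow> 'b"
  where "slice_left \<phi> = tensor_lift (\<lambda>a b. \<phi> a *\<^sub>C b)"

definition slice_right :: "('b::complex_vector \<Rightarrow> complex) \<Rightarrow> 'a::complex_vector \<otimes> 'b \<Rightarrow> 'a"
  where "slice_right \<phi> = tensor_lift (\<lambda>a b. \<phi> b *\<^sub>C a)"

lemma
  shows tensor_map_tens: "clinear f \<Longrightarrow> clinear g \<Longrightarrow> tensor_map f g (a \<otimes>\<^sub>t b) = f a \<otimes>\<^sub>t g b"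
    and clinear_tensor_map: "clinear f \<Longrightarrow> clinear g \<Longrightarrow> clinear (tensor_map f g)"
proof -
  assume "clinear f" "clinear g"
  then have B: "cbilinear (\<lambda>a b. f a \<otimes>\<^sub>t g b)"
    by (simp add: cbilinear_def clinear_iff tens_linear)
  show "tensor_map f g (a \<otimes>\<^sub>t b) = f a \<otimes>\<^sub>t g b" "clinear (tensor_map f g)"
    using tensor_lift_tens[OF B] clinear_tensor_lift[OF B] by (simp_all add: tensor_map_def)
qed

lemma
  shows slice_left_tens: "clinear \<phi> \<Longrightarrow> slice_left \<phi> (a \<otimes>\<^sub>t b) = \<phi> a *\<^sub>C b"
    and clinear_slice_left: "clinear \<phi> \<Longrightarrow> clinear (slice_left \<phi>)"
proof -
  assume "clinear \<phi>"
  then have B: "cbilinear (\<lambda>a b. \<phi> a *\<^sub>C b)"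
    by (simp add: cbilinear_def clinear_iff scaleC_add_left scaleC_add_right scaleC_scaleC
        scaleC_complex_def mult.commute)
  show "slice_left \<phi> (a \<otimes>\<^sub>t b) = \<phi> a *\<^sub>C b" "clinear (slice_left \<phi>)"
    using tensor_lift_tens[OF B] clinear_tensor_lift[OF B] by (simp_all add: slice_left_def)
qed

lemma
  shows slice_right_tens: "clinear \<phi> \<Longrightarrow> slice_right \<phi> (a \<otimes>\<^sub>t b) = \<phi> b *\<^sub>C a"
    and clinear_slice_right: "clinear \<phi> \<Longrightarrow> clinear (slice_right \<phi>)"
proof -
  assume "clinear \<phi>"
  then have B: "cbilinear (\<lambda>a b. \<phi> b *\<^sub>C a)"
    by (simp add: cbilinear_def clinear_iff scaleC_add_left scaleC_add_right scaleC_scaleC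
        scaleC_complex_def mult.commute)
  show "slice_right \<phi> (a \<otimes>\<^sub>t b) = \<phi> b *\<^sub>C a" "clinear (slice_right \<phi>)"
    using tensor_lift_tens[OF B] clinear_tensor_lift[OF B] by (simp_all add: slice_right_def)
qed

lemma
  fixes a :: "'a::complex_vector" and b :: "'b::complex_vector" and c :: "'c::complex_vector"
  shows tensor_assoc_tens: "tensor_assoc ((a \<otimes>\<^sub>t b) \<otimes>\<^sub>t c) = a \<otimes>\<^sub>t b \<otimes>\<^sub>t c"
    and clinear_tensor_assoc:
      "clinear (tensor_assoc :: ('a \<otimes> 'b) \<otimes> 'c \<Rightarrow> 'a \<otimes> 'b \<otimes> 'c)"
proof -
  have B: "cbilinear (\<lambda>(a::'a) (b::'b). a \<otimes>\<^sub>t b \<otimes>\<^sub>t c)" for c :: 'c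
    by (simp add: cbilinear_def clinear_iff tens_linear)
  have "clinear (\<lambda>c::'c. tensor_lift (\<lambda>(a::'a) (b::'b). a \<otimes>\<^sub>t b \<otimes>\<^sub>t c) u)" for u
  proof (induct u rule: tensor_induct)
    case (tens a b)
    then show ?case by (simp add: tensor_lift_tens[OF B] clinear_iff tens_linear)
  next
    case (add s t)
    then show ?case by (simp add: tensor_lift_add[OF B] clinear_iff scaleC_add_right)
  qed
  then have C: "cbilinear (\<lambda>u (c::'c). tensor_lift (\<lambda>(a::'a) (b::'b). a \<otimes>\<^sub>t b \<otimes>\<^sub>t c) u)"
    by (simp add: cbilinear_def clinear_tensor_lift[OF B])
  show "tensor_assoc ((a \<otimes>\<^sub>t b) \<otimes>\<^sub>t c) = a \<otimes>\<^sub>t b \<otimes>\<^sub>t c"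
    by (simp add: tensor_assoc_def tensor_lift_tens[OF C] tensor_lift_tens[OF B])
  show "clinear (tensor_assoc :: ('a \<otimes> 'b) \<otimes> 'c \<Rightarrow> 'a \<otimes> 'b \<otimes> 'c)"
    unfolding tensor_assoc_def by (rule clinear_tensor_lift[OF C])
qed

text \<open>The product is the bilinear extension of \<open>(a \<otimes>\<^sub>t b) * (c \<otimes>\<^sub>t d) = (a * c) \<otimes>\<^sub>t (b * d)\<close>,
  see \<open>tens_mult\<close>.\<close>

instantiation tensor :: (complex_algebra_1, complex_algebra_1) complex_algebra_1
begin

definition one_tensor :: "'a \<otimes> 'b"
  where "1 = 1 \<otimes>\<^sub>t 1"

definition times_tensor :: "'a \<otimes> 'b \<Rightarrow> 'a \<otimes> 'b \<Rightarrow> 'a \<otimes> 'b"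
  where "s * t = tensor_lift (\<lambda>a b. tensor_lift (\<lambda>c d. (a * c) \<otimes>\<^sub>t (b * d)) t) s"

context
begin

private lemma inner: "cbilinear (\<lambda>(c::'a) (d::'b). (a * c) \<otimes>\<^sub>t (b * d))"
  by (simp add: cbilinear_def clinear_iff tens_linear distrib_left mult_scaleC_right)

private lemma outer: "cbilinear (\<lambda>(a::'a) (b::'b). tensor_lift (\<lambda>c d. (a * c) \<otimes>\<^sub>t (b * d)) t)"
proof (induct t rule: tensor_induct)
  case (tens c d)
  then show ?case
    by (simp add: tensor_lift_tens[OF inner] cbilinear_def clinear_iff tens_linear
        distrib_right mult_scaleC_left)
next
  case (add s t)
  then show ?case
    by (simp add: tensor_lift_add[OF inner] cbilinear_def clinear_iff scaleC_add_right)
qed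

private lemma tens_times:
  "((a::'a) \<otimes>\<^sub>t (b::'b)) * t = tensor_lift (\<lambda>c d. (a * c) \<otimes>\<^sub>t (b * d)) t"
  unfolding times_tensor_def by (rule tensor_lift_tens[OF outer])

lemma tens_mult: "((a::'a) \<otimes>\<^sub>t (b::'b)) * (c \<otimes>\<^sub>t d) = (a * c) \<otimes>\<^sub>t (b * d)"
  by (simp add: tens_times tensor_lift_tens[OF inner])

private lemma left_add: "((s::'a \<otimes> 'b) + t) * u = s * u + t * u"
  and left_scaleC: "(k *\<^sub>C (s::'a \<otimes> 'b)) * u = k *\<^sub>C (s * u)"
  by (simp_all add: times_tensor_def tensor_lift_add[OF outer] tensor_lift_scaleC[OF outer])

private lemma right_add: "(u::'a \<otimes> 'b) * (s + t) = u * s + u * t"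
proof (induct u rule: tensor_induct)
  case (tens a b)
  then show ?case
    by (simp add: tens_times tensor_lift_add[OF inner])
qed (simp add: left_add)

private lemma right_scaleC: "(u::'a \<otimes> 'b) * (k *\<^sub>C s) = k *\<^sub>C (u * s)"
proof (induct u rule: tensor_induct)
  case (tens a b)
  then show ?case
    by (simp add: tens_times tensor_lift_scaleC[OF inner])
qed (simp add: left_add scaleC_add_right)

private lemma assoc: "(s::'a \<otimes> 'b) * t * u = s * (t * u)"
proof (induct s rule: tensor_induct)
  case s: (tens a b)
  show ?case
  proof (induct t rule: tensor_induct)
    case t: (tens c d)
    show ?case
      by (induct u rule: tensor_induct) (simp_all add: tens_mult mult.assoc right_add)
  qed (simp add: left_add right_add)
qed (simp add: left_add)

private lemma ex_linear_form: "\<exists>\<phi> :: 'c::complex_algebra_1 \<Rightarrow> complex. clinear \<phi> \<and> \<phi> 1 = 1"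
  using complex_vector.linear_independent_extend[of "{1 :: 'c}" "\<lambda>_. 1 :: complex"] by simp

private lemma nontrivial: "(1 :: 'a) \<otimes>\<^sub>t (1 :: 'b) \<noteq> 0"
proof
  assume 0: "(1 :: 'a) \<otimes>\<^sub>t (1 :: 'b) = 0"
  obtain \<phi> :: "'a \<Rightarrow> complex" and \<psi> :: "'b \<Rightarrow> complex"
    where *: "clinear \<phi>" "\<phi> 1 = 1" "clinear \<psi>" "\<psi> 1 = 1"
    using ex_linear_form by metis
  have B: "cbilinear (\<lambda>a b. \<phi> a * \<psi> b)"
    using * by (simp add: cbilinear_def clinear_iff scaleC_complex_def algebra_simps)
  have "tensor_lift (\<lambda>a b. \<phi> a * \<psi> b) (1 \<otimes>\<^sub>t 1) = 0"
    unfolding 0 by (rule clinear_zero[OF clinear_tensor_lift[OF B]])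
  then show False by (simp add: tensor_lift_tens[OF B] *)
qed

instance
proof
  fix x y z :: "'a \<otimes> 'b" and c
  show "x * y * z = x * (y * z)" by (rule assoc)
  show "1 * x = x"
    by (induct x rule: tensor_induct) (simp_all add: one_tensor_def tens_mult right_add)
  show "x * 1 = x"
    by (induct x rule: tensor_induct) (simp_all add: one_tensor_def tens_mult left_add)
  show "(x + y) * z = x * z + y * z" by (rule left_add)
  show "x * (y + z) = x * y + x * z" by (rule right_add)
  show "(0 :: 'a \<otimes> 'b) \<noteq> 1" using nontrivial by (simp add: one_tensor_def)
  show "(c *\<^sub>C x) * y = c *\<^sub>C (x * y)" by (rule left_scaleC)
  show "x * (c *\<^sub>C y) = c *\<^sub>C (x * y)" by (rule right_scaleC)
qed

end

end


section \<open>Algebra homomorphisms, invertible elements, semisimplicity\<close>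

definition algebra_hom :: "('a::complex_algebra_1 \<Rightarrow> 'b::complex_algebra_1) \<Rightarrow> bool"
  where "algebra_hom f \<longleftrightarrow> clinear f \<and> f 1 = 1 \<and> (\<forall>x y. f (x * y) = f x * f y)"

definition algebra_antihom :: "('a::complex_algebra_1 \<Rightarrow> 'b::complex_algebra_1) \<Rightarrow> bool"
  where "algebra_antihom f \<longleftrightarrow> clinear f \<and> f 1 = 1 \<and> (\<forall>x y. f (x * y) = f y * f x)"

definition invertible_element :: "'a::ring_1 \<Rightarrow> bool"
  where "invertible_element x \<longleftrightarrow> (\<exists>y. x * y = 1 \<and> y * x = 1)"

definition inverse_element :: "'a::ring_1 \<Rightarrow> 'a"
  where "inverse_element x = (THE y. x * y = 1 \<and> y * x = 1)"

lemma inverse_element_unique: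
  assumes "x * y = 1" "y * x = 1" shows "inverse_element x = y"
  unfolding inverse_element_def
proof (rule the_equality)
  fix z assume z: "x * z = 1 \<and> z * x = 1"
  have "z = (y * x) * z" by (simp add: assms)
  also have "\<dots> = y" using z by (simp add: mult.assoc)
  finally show "z = y" .
qed (use assms in blast)

definition left_ideal :: "'a::ring_1 set \<Rightarrow> bool"
  where "left_ideal I \<longleftrightarrow> 0 \<in> I \<and> (\<forall>x\<in>I. \<forall>y\<in>I. x + y \<in> I) \<and> (\<forall>a. \<forall>x\<in>I. a * x \<in> I)"

definition simple_left_ideal :: "'a::ring_1 set \<Rightarrow> bool"
  where "simple_left_ideal I \<longleftrightarrow> left_ideal I \<and> I \<noteq> {0} \<and>
    (\<forall>K. left_ideal K \<and> K \<subseteq> I \<longrightarrow> K = {0} \<or> K = I)"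

text \<open>The left regular module is an (internal) direct sum of simple submodules. Such a
  decomposition of a unital ring is automatically finite.\<close>

definition semisimple_ring :: "'a::ring_1 itself \<Rightarrow> bool"
  where "semisimple_ring _ \<longleftrightarrow> (\<exists>M :: 'a set set. finite M \<and> (\<forall>I\<in>M. simple_left_ideal I) \<and>
    (\<forall>a. \<exists>!f. f \<in> (\<Pi>\<^sub>E I\<in>M. I) \<and> (\<Sum>I\<in>M. f I) = a))"


section \<open>Quasi-Hopf algebras\<close>

record (overloaded) ('a::complex_algebra_1) quasi_hopf =
  comult :: "'a \<Rightarrow> 'a \<otimes> 'a"
  counit :: "'a \<Rightarrow> complex"
  associator :: "'a \<otimes> 'a \<otimes> 'a"
  antipode :: "'a \<Rightarrow> 'a"
  alpha :: 'a
  beta :: 'a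

text \<open>Iterated tensor powers are bracketed to the right, so expressions such as
  \<open>(\<Delta> \<otimes> id)(\<Delta> a)\<close>, whose natural bracketing is different, are reassociated explicitly.
  As in Drinfeld's definition, the antipode is an algebra anti-automorphism.\<close>

locale quasi_hopf_algebra =
  fixes H :: "'a::complex_algebra_1 quasi_hopf"
  assumes comult_hom: "algebra_hom (comult H)"
    and counit_hom: "algebra_hom (counit H)"
    and counit_left: "slice_left (counit H) (comult H a) = a"
    and counit_right: "slice_right (counit H) (comult H a) = a"
    and associator_invertible: "invertible_element (associator H)"
    and quasi_coassoc:
      "tensor_map id (comult H) (comult H a) =
        associator H * tensor_assoc (tensor_map (comult H) id (comult H a)) *
        inverse_element (associator H)"
    and pentagon:
      "tensor_map id (tensor_map id (comult H)) (associator H) *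
        tensor_assoc (tensor_map (comult H) id (associator H)) =
       (1 \<otimes>\<^sub>t associator H) *
        tensor_map id tensor_assoc (tensor_map id (tensor_map (comult H) id) (associator H)) *
        tensor_map id tensor_assoc (tensor_assoc (associator H \<otimes>\<^sub>t 1))"
    and associator_counit: "tensor_map id (slice_left (counit H)) (associator H) = 1"
    and antipode_antihom: "algebra_antihom (antipode H)"
    and antipode_bij: "bij (antipode H)"
    and antipode_left:
      "tensor_lift (\<lambda>x y. antipode H x * alpha H * y) (comult H a) = counit H a *\<^sub>C alpha H"
    and antipode_right:
      "tensor_lift (\<lambda>x y. x * beta H * antipode H y) (comult H a) = counit H a *\<^sub>C beta H"
    and antipode_associator:
      "tensor_lift (\<lambda>x. tensor_lift (\<lambda>y z. x * beta H * antipode H y * alpha H * z))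
        (associator H) = 1"
    and antipode_associator_inverse:
      "tensor_lift (\<lambda>x. tensor_lift (\<lambda>y z. antipode H x * alpha H * y * beta H * antipode H z))
        (inverse_element (associator H)) = 1"

text \<open>The twist \<open>H\<^sup>J\<close>. Its antipode data are, with \<open>J\<^sup>-\<^sup>1 = \<Sum> P \<otimes> Q\<close> and
  \<open>J = \<Sum> J\<^sub>1 \<otimes> J\<^sub>2\<close>, the standard choice \<open>S\<close>, \<open>\<Sum> S(P) \<alpha> Q\<close>, \<open>\<Sum> J\<^sub>1 \<beta> S(J\<^sub>2)\<close>.\<close>

definition twist :: "'a::complex_algebra_1 \<otimes> 'a \<Rightarrow> 'a quasi_hopf \<Rightarrow> 'a quasi_hopf"
  where "twist J H =
    \<lparr> comult = (\<lambda>a. J * comult H a * inverse_element J),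
      counit = counit H,
      associator =
        (1 \<otimes>\<^sub>t J) * tensor_map id (comult H) J * associator H *
        tensor_assoc (tensor_map (comult H) id (inverse_element J)) *
        tensor_assoc (inverse_element J \<otimes>\<^sub>t 1),
      antipode = antipode H,
      alpha = tensor_lift (\<lambda>x y. antipode H x * alpha H * y) (inverse_element J),
      beta = tensor_lift (\<lambda>x y. x * beta H * antipode H y) J \<rparr>"

text \<open>The antipode data only have to be preserved up to
  \<open>(S, \<alpha>, \<beta>) \<mapsto> (u S u\<^sup>-\<^sup>1, u \<alpha>, \<beta> u\<^sup>-\<^sup>1)\<close> with \<open>u\<close> invertible.\<close>

definition quasi_hopf_iso ::
    "('a::complex_algebra_1 \<Rightarrow> 'b::complex_algebra_1) \<Rightarrow> 'a quasi_hopf \<Rightarrow> 'b quasi_hopf \<Rightarrow> bool"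
  where "quasi_hopf_iso f H K \<longleftrightarrow>
    algebra_hom f \<and> bij f \<and>
    (\<forall>a. comult K (f a) = tensor_map f f (comult H a)) \<and>
    (\<forall>a. counit K (f a) = counit H a) \<and>
    associator K = tensor_map f (tensor_map f f) (associator H) \<and>
    (\<exists>u. invertible_element u \<and>
      (\<forall>a. antipode K (f a) = u * f (antipode H a) * inverse_element u) \<and>
      alpha K = u * f (alpha H) \<and>
      beta K = f (beta H) * inverse_element u)"

definition twist_equivalent ::
    "'a::complex_algebra_1 quasi_hopf \<Rightarrow> 'b::complex_algebra_1 quasi_hopf \<Rightarrow> bool"
  where "twist_equivalent H K \<longleftrightarrow>
    (\<exists>J f. invertible_element J \<and> slice_left (counit H) J = 1 \<and> slice_right (counit H) J = 1 \<and>
      quasi_hopf_iso f (twist J H) K)"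


section \<open>The Sweedler Hopf algebra\<close>

text \<open>\<open>Sweedler a b c d\<close> stands for \<open>a + b g + c x + d gx\<close>.\<close>

datatype sweedler = Sweedler (coeff_1: complex) (coeff_g: complex) (coeff_x: complex) (coeff_gx: complex)

instantiation sweedler :: complex_algebra_1
begin

definition zero_sweedler :: sweedler where "0 = Sweedler 0 0 0 0"

definition one_sweedler :: sweedler where "1 = Sweedler 1 0 0 0"

definition plus_sweedler :: "sweedler \<Rightarrow> sweedler \<Rightarrow> sweedler"
  where "p + q = Sweedler (coeff_1 p + coeff_1 q) (coeff_g p + coeff_g q)
    (coeff_x p + coeff_x q) (coeff_gx p + coeff_gx q)"

definition uminus_sweedler :: "sweedler \<Rightarrow> sweedler"
  where "- p = Sweedler (- coeff_1 p) (- coeff_g p) (- coeff_x p) (- coeff_gx p)"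

definition minus_sweedler :: "sweedler \<Rightarrow> sweedler \<Rightarrow> sweedler"
  where "p - q = Sweedler (coeff_1 p - coeff_1 q) (coeff_g p - coeff_g q)
    (coeff_x p - coeff_x q) (coeff_gx p - coeff_gx q)"

definition scaleC_sweedler :: "complex \<Rightarrow> sweedler \<Rightarrow> sweedler"
  where "k *\<^sub>C p = Sweedler (k * coeff_1 p) (k * coeff_g p) (k * coeff_x p) (k * coeff_gx p)"

definition times_sweedler :: "sweedler \<Rightarrow> sweedler \<Rightarrow> sweedler"
  where "p * q = Sweedler
    (coeff_1 p * coeff_1 q + coeff_g p * coeff_g q)
    (coeff_1 p * coeff_g q + coeff_g p * coeff_1 q)
    (coeff_1 p * coeff_x q + coeff_x p * coeff_1 q + coeff_g p * coeff_gx q - coeff_gx p * coeff_g q)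
    (coeff_1 p * coeff_gx q + coeff_gx p * coeff_1 q + coeff_g p * coeff_x q - coeff_x p * coeff_g q)"

lemmas sweedler_simps = zero_sweedler_def one_sweedler_def plus_sweedler_def uminus_sweedler_def
  minus_sweedler_def scaleC_sweedler_def times_sweedler_def

instance
  by standard (simp_all add: sweedler_simps algebra_simps)

end

definition sw_g :: sweedler where "sw_g = Sweedler 0 1 0 0"

definition sw_x :: sweedler where "sw_x = Sweedler 0 0 1 0"

lemma sweedler_relations:
  "sw_g * sw_g = 1" "sw_x * sw_x = 0" "sw_g * sw_x = - (sw_x * sw_g)"
  by (simp_all add: sw_g_def sw_x_def sweedler_simps)

lemma sweedler_expand:
  "p = coeff_1 p *\<^sub>C 1 + coeff_g p *\<^sub>C sw_g + coeff_x p *\<^sub>C sw_x + coeff_gx p *\<^sub>C (sw_g * sw_x)"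
  by (simp add: sw_g_def sw_x_def sweedler_simps)

text \<open>The coproduct extends multiplicatively from \<open>\<Delta> g = g \<otimes> g\<close> and
  \<open>\<Delta> x = x \<otimes> 1 + g \<otimes> x\<close>, which forces \<open>\<Delta> (gx) = gx \<otimes> g + 1 \<otimes> gx\<close>.\<close>

definition H4 :: "sweedler quasi_hopf"
  where "H4 =
    \<lparr> comult = (\<lambda>p. coeff_1 p *\<^sub>C (1 \<otimes>\<^sub>t 1) + coeff_g p *\<^sub>C (sw_g \<otimes>\<^sub>t sw_g)
        + coeff_x p *\<^sub>C (sw_x \<otimes>\<^sub>t 1 + sw_g \<otimes>\<^sub>t sw_x)
        + coeff_gx p *\<^sub>C ((sw_g * sw_x) \<otimes>\<^sub>t sw_g + 1 \<otimes>\<^sub>t (sw_g * sw_x))),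
      counit = (\<lambda>p. coeff_1 p + coeff_g p),
      associator = 1,
      antipode = (\<lambda>p. coeff_1 p *\<^sub>C 1 + coeff_g p *\<^sub>C sw_g
        - coeff_x p *\<^sub>C (sw_g * sw_x) + coeff_gx p *\<^sub>C sw_x),
      alpha = 1,
      beta = 1 \<rparr>"

lemma H4_comult_g: "comult H4 sw_g = sw_g \<otimes>\<^sub>t sw_g"
  and H4_comult_x: "comult H4 sw_x = sw_x \<otimes>\<^sub>t 1 + sw_g \<otimes>\<^sub>t sw_x"
  by (simp_all add: H4_def sw_g_def sw_x_def)

context
begin

private abbreviation (input) S where "S \<equiv> antipode H4"

private lemma mult_simps:
  "sw_g * sw_g = 1" "sw_x * sw_x = 0" "sw_x * sw_g = - (sw_g * sw_x)"
  "sw_g * (sw_g * sw_x) = sw_x" "sw_x * (sw_g * sw_x) = 0"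
  "(sw_g * sw_x) * sw_g = - sw_x" "(sw_g * sw_x) * sw_x = 0" "(sw_g * sw_x) * (sw_g * sw_x) = 0"
  by (simp_all add: sw_g_def sw_x_def sweedler_simps)

private lemma comult_linear: "clinear (comult H4)"
  by (simp add: clinear_iff H4_def plus_sweedler_def scaleC_sweedler_def scaleC_add_left
      scaleC_add_right scaleC_scaleC algebra_simps)

private lemma counit_linear: "clinear (counit H4)"
  by (simp add: clinear_iff H4_def plus_sweedler_def scaleC_sweedler_def scaleC_complex_def
      algebra_simps)

private lemma antipode_linear: "clinear S"
  by (simp add: clinear_iff H4_def sw_g_def sw_x_def sweedler_simps algebra_simps)

private lemma id_linear: "clinear (id :: 'z::complex_vector \<Rightarrow> 'z)"
  by (simp add: clinear_iff)

private lemma basis_ext: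
  fixes f :: "sweedler \<Rightarrow> 'z::complex_vector"
  assumes "clinear f" "clinear h" "f 1 = h 1" "f sw_g = h sw_g" "f sw_x = h sw_x"
    "f (sw_g * sw_x) = h (sw_g * sw_x)"
  shows "f p = h p"
  using assms by (subst (1 2) sweedler_expand[of p]) (simp add: clinear_iff)

private lemma comult_basis:
  "comult H4 1 = 1 \<otimes>\<^sub>t 1" "comult H4 sw_g = sw_g \<otimes>\<^sub>t sw_g"
  "comult H4 sw_x = sw_x \<otimes>\<^sub>t 1 + sw_g \<otimes>\<^sub>t sw_x"
  "comult H4 (sw_g * sw_x) = (sw_g * sw_x) \<otimes>\<^sub>t sw_g + 1 \<otimes>\<^sub>t (sw_g * sw_x)"
  by (simp_all add: H4_def sw_g_def sw_x_def sweedler_simps)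

private lemma counit_basis:
  "counit H4 1 = 1" "counit H4 sw_g = 1" "counit H4 sw_x = 0" "counit H4 (sw_g * sw_x) = 0"
  by (simp_all add: H4_def sw_g_def sw_x_def sweedler_simps)

private lemma antipode_basis:
  "S 1 = 1" "S sw_g = sw_g" "S sw_x = - (sw_g * sw_x)" "S (sw_g * sw_x) = sw_x"
  by (simp_all add: H4_def sw_g_def sw_x_def sweedler_simps)

private lemma H4_const: "associator H4 = 1" "alpha H4 = 1" "beta H4 = 1"
  by (simp_all add: H4_def)

private lemma tens_minus:
  "(- a) \<otimes>\<^sub>t b = - (a \<otimes>\<^sub>t b)" "a \<otimes>\<^sub>t (- b) = - (a \<otimes>\<^sub>t b)" "(0 :: 'u) \<otimes>\<^sub>t b = 0" "a \<otimes>\<^sub>t (0 :: 'v) = 0"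
  for a :: "'u::complex_vector" and b :: "'v::complex_vector"
proof -
  have l: "clinear (\<lambda>a :: 'u. a \<otimes>\<^sub>t b)" and r: "clinear (\<lambda>b :: 'v. a \<otimes>\<^sub>t b)"
    using cbilinear_tens by (auto simp: cbilinear_def)
  show "(- a) \<otimes>\<^sub>t b = - (a \<otimes>\<^sub>t b)" "(0 :: 'u) \<otimes>\<^sub>t b = 0"
    using complex_vector.linear_neg[OF l] clinear_zero[OF l] by simp_all
  show "a \<otimes>\<^sub>t (- b) = - (a \<otimes>\<^sub>t b)" "a \<otimes>\<^sub>t (0 :: 'v) = 0"
    using complex_vector.linear_neg[OF r] clinear_zero[OF r] by simp_all
qed

private lemma comp_linear: "clinear f \<Longrightarrow> clinear g \<Longrightarrow> clinear (\<lambda>x. g (f x))"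
  by (simp add: clinear_iff)

private lemma map_comult_linear: "clinear (\<lambda>p. tensor_map f h (comult H4 p))"
  if "clinear f" "clinear h"
  by (rule comp_linear[OF comult_linear clinear_tensor_map[OF that]])

private lemma tensor_map_add: "tensor_map f h (s + t) = tensor_map f h s + tensor_map f h t"
  if "clinear f" "clinear h"
  using clinear_tensor_map[OF that] by (simp add: clinear_iff)

private lemmas map_simps = tensor_map_tens comult_linear id_linear comult_basis tens_linear
  tensor_map_add
  tensor_assoc_tens clinear_tensor_assoc[unfolded clinear_iff, THEN conjunct1, rule_format]

private lemma lift_left: "cbilinear (\<lambda>x y. S x * y)"
  and lift_right: "cbilinear (\<lambda>x y. x * S y)"
  using antipode_linear
  by (simp_all add: cbilinear_def clinear_iff distrib_left distrib_right mult_scaleC_left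
      mult_scaleC_right)

private lemma clinear_scale: "clinear (\<lambda>p. counit H4 p *\<^sub>C (1::sweedler))"
  using counit_linear by (simp add: clinear_iff scaleC_add_left scaleC_scaleC scaleC_complex_def)

private lemma inverse_1: "inverse_element (1::'z::ring_1) = 1"
  by (rule inverse_element_unique) simp_all

private lemma tensor_map_1: "tensor_map f h 1 = 1"
  if "clinear f" "clinear h" "f 1 = 1" "h 1 = 1"
  by (simp add: one_tensor_def tensor_map_tens that)

private lemma tensor_assoc_1: "tensor_assoc 1 = 1"
  by (simp add: one_tensor_def tensor_assoc_tens)

private lemma comult_mult: "comult H4 (p * q) = comult H4 p * comult H4 q"
proof -
  have r: "clinear (\<lambda>q. comult H4 (p * q))" "clinear (\<lambda>q. comult H4 p * comult H4 q)"
    and l: "clinear (\<lambda>p. comult H4 (p * q))" "clinear (\<lambda>p. comult H4 p * comult H4 q)" for p q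
    using comult_linear by (simp_all add: clinear_iff distrib_left distrib_right mult_scaleC_left
      mult_scaleC_right)
  note simps = comult_basis mult_simps tens_mult tens_minus distrib_left distrib_right
    complex_vector.linear_neg[OF comult_linear] clinear_zero[OF comult_linear]
  show ?thesis
    by (rule basis_ext[where f="\<lambda>q. comult H4 (p * q)", OF r];
        rule basis_ext[where f="\<lambda>p. comult H4 (p * _)", OF l];
        simp add: simps)
qed

theorem quasi_hopf_algebra_H4: "quasi_hopf_algebra H4"
proof
  show "algebra_hom (comult H4)"
    by (simp add: algebra_hom_def comult_linear comult_mult comult_basis one_tensor_def)
  show "algebra_hom (counit H4)"
    by (simp add: algebra_hom_def counit_linear counit_basis)
       (simp add: H4_def sweedler_simps algebra_simps)
  show "slice_left (counit H4) (comult H4 a) = a" for a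
    by (rule basis_ext[where h="\<lambda>a. a"], rule comp_linear[OF comult_linear clinear_slice_left[OF counit_linear]])
      (simp_all add: clinear_iff clinear_slice_left[OF counit_linear, unfolded clinear_iff] comult_basis slice_left_tens[OF counit_linear] counit_basis scaleC_one)
  show "slice_right (counit H4) (comult H4 a) = a" for a
    by (rule basis_ext[where h="\<lambda>a. a"], rule comp_linear[OF comult_linear clinear_slice_right[OF counit_linear]])
      (simp_all add: clinear_iff clinear_slice_right[OF counit_linear, unfolded clinear_iff] comult_basis slice_right_tens[OF counit_linear] counit_basis scaleC_one)
  show "invertible_element (associator H4)"
    by (auto simp: H4_const invertible_element_def)
  show "tensor_map id (comult H4) (comult H4 a) =
      associator H4 * tensor_assoc (tensor_map (comult H4) id (comult H4 a)) *
      inverse_element (associator H4)" for a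
    unfolding H4_const inverse_1 mult_1_left mult_1_right
    by (rule basis_ext[OF map_comult_linear[OF id_linear comult_linear]
          comp_linear[OF map_comult_linear[OF comult_linear id_linear] clinear_tensor_assoc]])
       (simp_all add: map_simps)
  have c1: "comult H4 1 = 1" by (simp add: comult_basis one_tensor_def)
  show "tensor_map id (tensor_map id (comult H4)) (associator H4) *
        tensor_assoc (tensor_map (comult H4) id (associator H4)) =
       (1 \<otimes>\<^sub>t associator H4) *
        tensor_map id tensor_assoc (tensor_map id (tensor_map (comult H4) id) (associator H4)) *
        tensor_map id tensor_assoc (tensor_assoc (associator H4 \<otimes>\<^sub>t 1))"
    by (simp add: H4_const tensor_map_1 clinear_tensor_map comult_linear id_linear c1
        tensor_assoc_1 clinear_tensor_assoc one_tensor_def[symmetric])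
  show "tensor_map id (slice_left (counit H4)) (associator H4) = 1"
    by (simp add: H4_const tensor_map_1 id_linear clinear_slice_left counit_linear)
       (simp add: one_tensor_def slice_left_tens counit_linear counit_basis scaleC_one tensor_map_tens id_linear clinear_slice_left)
  show "algebra_antihom S"
    by (simp add: algebra_antihom_def antipode_linear antipode_basis)
       (simp add: H4_def sw_g_def sw_x_def sweedler_simps algebra_simps)
  have SS: "S (S (S (S p))) = p" for p
    by (cases p) (simp add: H4_def sw_g_def sw_x_def sweedler_simps)
  show "bij S"
    by (rule o_bij[where g="\<lambda>p. S (S (S p))"]) (simp_all add: fun_eq_iff SS)
  show "tensor_lift (\<lambda>x y. S x * alpha H4 * y) (comult H4 a) = counit H4 a *\<^sub>C alpha H4" for a
    unfolding H4_const mult_1_right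
    by (rule basis_ext[OF comp_linear[OF comult_linear clinear_tensor_lift[OF lift_left]] clinear_scale])
       (simp_all add: comult_basis tensor_lift_add[OF lift_left] tensor_lift_tens[OF lift_left]
          antipode_basis counit_basis mult_simps scaleC_one)
  show "tensor_lift (\<lambda>x y. x * beta H4 * S y) (comult H4 a) = counit H4 a *\<^sub>C beta H4" for a
    unfolding H4_const mult_1_right
    by (rule basis_ext[OF comp_linear[OF comult_linear clinear_tensor_lift[OF lift_right]] clinear_scale])
       (simp_all add: comult_basis tensor_lift_add[OF lift_right] tensor_lift_tens[OF lift_right]
          antipode_basis counit_basis mult_simps scaleC_one)
  have B: "cbilinear (\<lambda>y z. x * S y * z)" "cbilinear (\<lambda>y z. S x * y * S z)" for x
    using antipode_linear
    by (simp_all add: cbilinear_def clinear_iff distrib_left distrib_right mult_scaleC_left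
      mult_scaleC_right)
  have "clinear (\<lambda>x. tensor_lift (\<lambda>y z. x * S y * z) t)" for t
    by (induct t rule: tensor_induct)
      (simp_all add: tensor_lift_tens[OF B(1)] tensor_lift_add[OF B(1)] clinear_iff distrib_right
        mult_scaleC_left scaleC_add_right)
  then have C1: "cbilinear (\<lambda>x. tensor_lift (\<lambda>y z. x * S y * z))"
    by (simp add: cbilinear_def clinear_tensor_lift[OF B(1)])
  have "clinear (\<lambda>x. tensor_lift (\<lambda>y z. S x * y * S z) t)" for t
    using antipode_linear by (induct t rule: tensor_induct)
      (simp_all add: tensor_lift_tens[OF B(2)] tensor_lift_add[OF B(2)] clinear_iff distrib_right
        mult_scaleC_left scaleC_add_right)
  then have C2: "cbilinear (\<lambda>x. tensor_lift (\<lambda>y z. S x * y * S z))"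
    by (simp add: cbilinear_def clinear_tensor_lift[OF B(2)])
  show "tensor_lift (\<lambda>x. tensor_lift (\<lambda>y z. x * beta H4 * S y * alpha H4 * z)) (associator H4) = 1"
    unfolding H4_const mult_1_right one_tensor_def tensor_lift_tens[OF C1]
      tensor_lift_tens[OF B(1)]
    by (simp add: antipode_basis)
  show "tensor_lift (\<lambda>x. tensor_lift (\<lambda>y z. S x * alpha H4 * y * beta H4 * S z))
      (inverse_element (associator H4)) = 1"
    unfolding H4_const mult_1_right inverse_1 unfolding one_tensor_def tensor_lift_tens[OF C2]
      tensor_lift_tens[OF B(2)]
    by (simp add: antipode_basis)
qed

end

end

theory Submission
  imports Defs "HOL-Computational_Algebra.Fundamental_Theorem_Algebra"
    "HOL-Computational_Algebra.Formal_Power_Series"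
begin

text \<open>
  Write \<open>\<epsilon>\<close> for the counit and convolve linear forms along the coproduct. If every derivation of the
  algebra with values in a one-dimensional bimodule were inner, the left regular module would be
  spanned by eigenvectors, hence semisimple; so some outer derivation \<open>D\<close> between characters
  \<open>\<kappa>\<close>, \<open>\<mu>\<close> exists. Derivations at \<open>\<epsilon>\<close> itself vanish in characteristic \<open>0\<close>, and convolution with
  characters preserves outer derivations. Translating \<open>D\<close> thus gives outer derivations
  \<open>\<epsilon> \<rightarrow> \<chi> \<rightarrow> \<chi>\<^sup>2\<close> with \<open>\<chi> \<noteq> \<epsilon>\<close>, and dimension \<open>4\<close> forces \<open>\<chi>\<^sup>2 = \<epsilon>\<close>: the two characters
  and the two derivations form a basis of the dual space, which identifies the algebra with that
  of \<open>H\<^sub>4\<close>.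

  Let \<open>g\<close>, \<open>x\<close> be the generators. A first twist makes \<open>g\<close> grouplike, a second one, supported on a
  single pair of idempotents, brings \<open>\<Delta> x\<close> into the form \<open>x \<otimes> 1 + g \<otimes> x\<close>. The associator commutes
  with the iterated coproducts of \<open>g\<close> and \<open>x\<close>, so its semisimple part is \<open>1\<close> and the rest has even
  degree in \<open>x\<close>; the degree \<open>2\<close> part of the pentagon says that it is a cocycle, every such
  cocycle is a coboundary, and a third twist removes it. What remains is a Hopf algebra, whose
  antipode is determined.
\<close>

section \<open>Linear maps, tensor products and algebra homomorphisms\<close>

text \<open>All equations are tested on linear forms. The characters \<open>e i\<close> and the
  derivations \<open>D i\<close> determine an element, their iterated slices determine a tensor, and
  product and coproduct have short tables in these coordinates, so that an identity in a tensor
  power becomes a finite list of scalar equations. Simple modules of dimension 2 are excluded by the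
  counit, whose kernel has dimension 3, one less than a matrix block needs. The recurring obstacle
  is that convolution of forms is not associative: translation by a character is undone only up to
  conjugation by the associator, which suffices because only outerness has to survive. A twist never
  changes the algebra, so the four forms are fixed once and for all. The order of the twists is
  dictated by what each must preserve: the second commutes with
  \<open>g \<otimes>\<^sub>t g\<close>, the third with every coproduct. The two characters alone
  would admit a nontrivial 3-cocycle of the group of order 2; the presence of \<open>x\<close> rules
  it out.\<close>

lemma clinear_add: "clinear f \<Longrightarrow> f (x + y) = f x + f y"
  and clinear_scale: "clinear f \<Longrightarrow> f (c *\<^sub>C x) = c *\<^sub>C f x"
  by (simp_all add: clinear_iff)

lemma clinear_sum: "clinear f \<Longrightarrow> f (sum g I) = (\<Sum>i\<in>I. f (g i))"
  by (rule complex_vector.linear_sum)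

lemma clinear_neg: "clinear f \<Longrightarrow> f (- x) = - f x"
  by (rule complex_vector.linear_neg)

lemma clinear_id: "clinear id" "clinear (\<lambda>x. x)"
  by (simp_all add: clinear_iff)

lemma clinear_compose: "clinear f \<Longrightarrow> clinear g \<Longrightarrow> clinear (\<lambda>x. g (f x))"
  by (simp add: clinear_iff)

lemma clinear_tens_left: "clinear (\<lambda>a. a \<otimes>\<^sub>t b)"
  and clinear_tens_right: "clinear (\<lambda>b. a \<otimes>\<^sub>t b)"
  by (simp_all add: clinear_iff tens_linear)

lemma clinear_mult_left: "clinear (\<lambda>x. a * x)" and clinear_mult_right: "clinear (\<lambda>x. x * a)"
  for a :: "'a::complex_algebra_1"
  by (simp_all add: clinear_iff distrib_left distrib_right mult_scaleC_left mult_scaleC_right)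

lemma algebra_homD:
  assumes "algebra_hom f"
  shows "clinear f" "f 1 = 1" "f (x * y) = f x * f y" "f (x + y) = f x + f y"
    "f (c *\<^sub>C x) = c *\<^sub>C f x"
  using assms by (simp_all add: algebra_hom_def clinear_iff)

lemma algebra_hom_multI:
  assumes "clinear f" "f 1 = 1"
    "\<And>a b c d. f ((a \<otimes>\<^sub>t b) * (c \<otimes>\<^sub>t d)) = f (a \<otimes>\<^sub>t b) * f (c \<otimes>\<^sub>t d)"
  shows "algebra_hom f"
proof -
  have "f (x * y) = f x * f y" for x y
  proof (induct x rule: tensor_induct)
    case (tens a b)
    then show ?case
      by (induct y rule: tensor_induct) (simp_all add: assms distrib_left clinear_add[OF assms(1)])
  qed (simp add: distrib_right clinear_add[OF assms(1)])
  then show ?thesis using assms by (simp add: algebra_hom_def)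
qed

lemma algebra_hom_id: "algebra_hom id"
  by (simp add: algebra_hom_def clinear_id)

lemma algebra_hom_compose: "algebra_hom f \<Longrightarrow> algebra_hom g \<Longrightarrow> algebra_hom (\<lambda>x. g (f x))"
  by (simp add: algebra_hom_def clinear_iff)

lemma algebra_hom_tensor_map:
  assumes "algebra_hom f" "algebra_hom g"
  shows "algebra_hom (tensor_map f g)"
proof (rule algebra_hom_multI)
  note l = algebra_homD(1)[OF assms(1)] algebra_homD(1)[OF assms(2)]
  show "clinear (tensor_map f g)" by (rule clinear_tensor_map[OF l])
  show "tensor_map f g 1 = 1"
    by (simp add: one_tensor_def tensor_map_tens[OF l] algebra_homD(2)[OF assms(1)]
        algebra_homD(2)[OF assms(2)])
  show "tensor_map f g ((a \<otimes>\<^sub>t b) * (c \<otimes>\<^sub>t d)) = tensor_map f g (a \<otimes>\<^sub>t b) * tensor_map f g (c \<otimes>\<^sub>t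
      d)" for a b c d
    by (simp add: tens_mult tensor_map_tens[OF l] algebra_homD(3)[OF assms(1)] algebra_homD(3)[OF assms(2)])
qed

lemma algebra_hom_tens_1: "algebra_hom (\<lambda>x. x \<otimes>\<^sub>t 1)" and algebra_hom_1_tens: "algebra_hom (\<lambda>x. 1 \<otimes>\<^sub>t x)"
  by (simp_all add: algebra_hom_def clinear_tens_left clinear_tens_right one_tensor_def tens_mult)

lemma algebra_hom_tensor_assoc: "algebra_hom tensor_assoc"
proof (rule algebra_hom_multI)
  fix a c :: "'a \<otimes> 'b" and b d :: 'c
  show "tensor_assoc ((a \<otimes>\<^sub>t b) * (c \<otimes>\<^sub>t d)) = tensor_assoc (a \<otimes>\<^sub>t b) * tensor_assoc (c \<otimes>\<^sub>t d)"
  proof (induct a rule: tensor_induct)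
    case a: (tens p q)
    then show ?case
      by (induct c rule: tensor_induct)
        (simp_all add: tens_mult tensor_assoc_tens distrib_left tens_linear clinear_add[OF
            clinear_tensor_assoc])
  qed (simp add: distrib_right tens_linear clinear_add[OF clinear_tensor_assoc])
qed (simp_all add: clinear_tensor_assoc one_tensor_def tensor_assoc_tens)

lemma tensor_assoc_mult: "tensor_assoc (x * y) = tensor_assoc x * tensor_assoc y"
  by (rule algebra_homD(3)[OF algebra_hom_tensor_assoc])

lemma invertible_elementD:
  assumes "invertible_element x"
  shows "x * inverse_element x = 1" "inverse_element x * x = 1"
  using assms inverse_element_unique[of x] by (auto simp: invertible_element_def)

lemma invertible_elementI: "x * y = 1 \<Longrightarrow> y * x = 1 \<Longrightarrow> invertible_element x"
  by (auto simp: invertible_element_def)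

lemma invertible_element_mult:
  assumes "invertible_element x" "invertible_element y"
  shows "invertible_element (x * y)"
    "inverse_element (x * y) = inverse_element y * inverse_element x"
proof -
  note D = invertible_elementD[OF assms(1)] invertible_elementD[OF assms(2)]
  have a: "x * y * (inverse_element y * inverse_element x) = 1"
    by (metis D(1) D(3) mult.assoc mult_1_right)
  have b: "inverse_element y * inverse_element x * (x * y) = 1"
    by (metis D(2) D(4) mult.assoc mult_1_right)
  show "invertible_element (x * y)" by (rule invertible_elementI[OF a b])
  show "inverse_element (x * y) = inverse_element y * inverse_element x"
    by (rule inverse_element_unique[OF a b])
qed

lemma slice_left_add: "clinear f \<Longrightarrow> slice_left f (s + t) = slice_left f s + slice_left f t"
  and slice_left_scale: "clinear f \<Longrightarrow> slice_left f (c *\<^sub>C t) = c *\<^sub>C slice_left f t"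
  by (rule clinear_add[OF clinear_slice_left] clinear_scale[OF clinear_slice_left], assumption)+

text \<open>Pure tensors multiply factor by factor, so a slice inherits the Leibniz rule of its
  form. With \<open>slice_left_hom\<close> this reduces coefficients of products in any tensor power
  to coefficients of the factors.\<close>

lemma slice_left_derivation:
  fixes f d d' :: "'a::complex_algebra_1 \<Rightarrow> complex" and u v :: "'a \<otimes> 'b::complex_algebra_1"
  assumes l: "clinear f" "clinear d" "clinear d'"
    and "\<And>a b. f (a * b) = d a * f b + f a * d' b"
  shows "slice_left f (u * v) = slice_left d u * slice_left f v + slice_left f u * slice_left d' v"
proof (induct u rule: tensor_induct)
  case (tens a b)
  show ?case
  proof (induct v rule: tensor_induct)
    case (tens a' b')
    then show ?case
      by (simp add: tens_mult slice_left_tens l assms(4) scaleC_add_left mult_scaleC_left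
          mult_scaleC_right scaleC_scaleC mult.commute)
  qed (simp add: distrib_left slice_left_add l)
qed (simp add: distrib_right slice_left_add l)

lemma slice_left_hom:
  fixes f :: "'a::complex_algebra_1 \<Rightarrow> complex" and u v :: "'a \<otimes> 'b::complex_algebra_1"
  assumes "algebra_hom f"
  shows "slice_left f (u * v) = slice_left f u * slice_left f v"
proof (induct u rule: tensor_induct)
  note l = algebra_homD[OF assms]
  case (tens a b)
  show ?case
  proof (induct v rule: tensor_induct)
    case (tens a' b')
    then show ?case
      by (simp add: tens_mult slice_left_tens l mult_scaleC_left mult_scaleC_right scaleC_scaleC)
  qed (simp add: distrib_left slice_left_add l)
qed (simp add: distrib_right slice_left_add algebra_homD[OF assms])

lemma slice_right_add: "clinear f \<Longrightarrow> slice_right f (s + t) = slice_right f s + slice_right f t"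
  by (rule clinear_add[OF clinear_slice_right])

lemma slice_right_hom:
  fixes f :: "'a::complex_algebra_1 \<Rightarrow> complex" and u v :: "'b::complex_algebra_1 \<otimes> 'a"
  assumes "algebra_hom f"
  shows "slice_right f (u * v) = slice_right f u * slice_right f v"
proof (induct u rule: tensor_induct)
  note l = algebra_homD[OF assms]
  case (tens a b)
  show ?case
  proof (induct v rule: tensor_induct)
    case (tens a' b')
    then show ?case
      by (simp add: tens_mult slice_right_tens l mult_scaleC_left mult_scaleC_right scaleC_scaleC)
  qed (simp add: distrib_left slice_right_add l)
qed (simp add: distrib_right slice_right_add algebra_homD[OF assms])

lemma algebra_hom_slice_left: "algebra_hom f \<Longrightarrow> algebra_hom (slice_left f)"
  and algebra_hom_slice_right: "algebra_hom f \<Longrightarrow> algebra_hom (slice_right f)"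
  by (simp_all add: algebra_hom_def clinear_slice_left clinear_slice_right slice_left_hom slice_right_hom
      one_tensor_def slice_left_tens slice_right_tens scaleC_one)

lemma slice_left_tensor_map:
  assumes "clinear f" "clinear g" "clinear h"
  shows "slice_left f (tensor_map g h t) = h (slice_left (\<lambda>a. f (g a)) t)"
proof (rule clinear_tensor_eqI)
  have l: "clinear (\<lambda>a. f (g a))" by (rule clinear_compose[OF assms(2,1)])
  show "clinear (\<lambda>t. slice_left f (tensor_map g h t))"
    by (rule clinear_compose[OF clinear_tensor_map[OF assms(2,3)] clinear_slice_left[OF assms(1)]])
  show "clinear (\<lambda>t. h (slice_left (\<lambda>a. f (g a)) t))"
    by (rule clinear_compose[OF clinear_slice_left[OF l] assms(3)])
  show "slice_left f (tensor_map g h (a \<otimes>\<^sub>t b)) = h (slice_left (\<lambda>a. f (g a)) (a \<otimes>\<^sub>t b))" for a b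
    by (simp add: assms l tensor_map_tens slice_left_tens clinear_scale[OF assms(3)])
qed

text \<open>Two successive slices of a rebracketed tensor are one slice by a form on its left pair;
  composed with the coproduct, that form becomes a convolution.\<close>

lemma slice_left_tensor_assoc:
  assumes "clinear f" "clinear g"
  shows "slice_left g (slice_left f (tensor_assoc t)) = slice_left (\<lambda>w. g (slice_left f w)) t"
proof (rule clinear_tensor_eqI[of "\<lambda>t. slice_left g (slice_left f (tensor_assoc t))" "slice_left
    (\<lambda>w. g (slice_left f w))"])
  have l: "clinear (\<lambda>w. g (slice_left f w))" by (rule clinear_compose[OF clinear_slice_left[OF
      assms(1)] assms(2)])
  show "clinear (\<lambda>t. slice_left g (slice_left f (tensor_assoc t)))"
    by (rule clinear_compose[OF clinear_compose[OF clinear_tensor_assoc clinear_slice_left[OF assms(1)]]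
          clinear_slice_left[OF assms(2)]])
  show "clinear (slice_left (\<lambda>w. g (slice_left f w)))" by (rule clinear_slice_left[OF l])
  show "slice_left g (slice_left f (tensor_assoc (u \<otimes>\<^sub>t c))) = slice_left (\<lambda>w. g (slice_left f w))
      (u \<otimes>\<^sub>t c)" for u c
    by (induct u rule: tensor_induct)
      (simp_all add: tensor_assoc_tens slice_left_tens l assms tens_linear clinear_add[OF
          clinear_tensor_assoc]
        slice_left_add clinear_scale[OF assms(2)] clinear_add[OF assms(2)] slice_left_scale
            scaleC_scaleC scaleC_complex_def scaleC_add_left)
qed

text \<open>Fubini for slices; it turns the right counit axiom into a statement about left slices,
  in which all coefficients are written.\<close>

lemma slice_left_slice_right:
  assumes "clinear f" "clinear g"
  shows "g (slice_left f t) = f (slice_right g t)"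
proof (rule clinear_tensor_eqI)
  show "clinear (\<lambda>t. g (slice_left f t))"
    by (rule clinear_compose[OF clinear_slice_left[OF assms(1)] assms(2)])
  show "clinear (\<lambda>t. f (slice_right g t))"
    by (rule clinear_compose[OF clinear_slice_right[OF assms(2)] assms(1)])
qed (simp add: assms slice_left_tens slice_right_tens clinear_scale[OF assms(1)] clinear_scale[OF
    assms(2)] scaleC_complex_def)

section \<open>Twisting a quasi-Hopf algebra\<close>

lemma algebra_antihomD:
  assumes "algebra_antihom f"
  shows "clinear f" "f 1 = 1" "f (x * y) = f y * f x" "f (x + y) = f x + f y"
    "f (c *\<^sub>C x) = c *\<^sub>C f x"
  using assms by (simp_all add: algebra_antihom_def clinear_iff)

lemma tensor_assoc_nat3:
  assumes "clinear h"
  shows "tensor_map id (tensor_map id h) (tensor_assoc (u \<otimes>\<^sub>t b)) = tensor_assoc (u \<otimes>\<^sub>t h b)"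
proof (induct u rule: tensor_induct)
  case (tens a b)
  then show ?case
    by (simp add: tensor_assoc_tens tensor_map_tens clinear_tensor_map clinear_id assms)
next
  case (add s t)
  have l: "clinear (tensor_map id (tensor_map id h))"
    by (intro clinear_tensor_map clinear_id assms)
  show ?case
    by (simp only: add tens_linear clinear_add[OF clinear_tensor_assoc] clinear_add[OF l])
qed

definition assoc4 :: "('a::complex_vector \<otimes> 'b::complex_vector \<otimes> 'c::complex_vector) \<otimes>
    'd::complex_vector \<Rightarrow> 'a \<otimes> 'b \<otimes> 'c \<otimes> 'd"
  where "assoc4 x = tensor_map id tensor_assoc (tensor_assoc x)"

lemma algebra_hom_assoc4: "algebra_hom assoc4"
  unfolding assoc4_def[abs_def]
  by (rule algebra_hom_compose[OF algebra_hom_tensor_assoc algebra_hom_tensor_map[OF algebra_hom_id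
      algebra_hom_tensor_assoc]])

lemma clinear_assoc4: "clinear assoc4"
  unfolding assoc4_def[abs_def]
  by (rule clinear_compose[OF clinear_tensor_assoc clinear_tensor_map[OF clinear_id(1)
      clinear_tensor_assoc]])

lemma assoc4_tens: "assoc4 ((a \<otimes>\<^sub>t u) \<otimes>\<^sub>t d) = a \<otimes>\<^sub>t tensor_assoc (u \<otimes>\<^sub>t d)"
  by (simp add: assoc4_def tensor_assoc_tens tensor_map_tens clinear_id clinear_tensor_assoc)

text \<open>Coherence of the bracketings of four factors, read off on pure tensors.\<close>

lemma assoc4_assoc: "tensor_assoc (w \<otimes>\<^sub>t (q \<otimes>\<^sub>t b)) = assoc4 (tensor_assoc (w \<otimes>\<^sub>t q) \<otimes>\<^sub>t b)"
  by (induct w rule: tensor_induct)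
    (simp_all add: tensor_assoc_tens assoc4_tens tens_linear clinear_add[OF clinear_tensor_assoc]
        clinear_add[OF clinear_assoc4])

lemma clinear_comp_tensor_eqI:
  assumes "clinear f" "clinear g" "clinear f'" "clinear g'"
    and "\<And>a b. f (g (a \<otimes>\<^sub>t b)) = f' (g' (a \<otimes>\<^sub>t b))"
  shows "f (g x) = f' (g' x)"
  by (rule clinear_tensor_eqI[OF clinear_compose[OF assms(2,1)] clinear_compose[OF assms(4,3)] assms(5)])

section \<open>Coface maps and the identities between them\<close>

context quasi_hopf_algebra begin

abbreviation \<Delta> where "\<Delta> \<equiv> comult H"
abbreviation \<epsilon> where "\<epsilon> \<equiv> counit H"
abbreviation \<Phi> where "\<Phi> \<equiv> associator H"

lemmas \<Delta>_lin = algebra_homD(1)[OF comult_hom] and \<epsilon>_lin = algebra_homD(1)[OF counit_hom]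
  and \<Delta>_simps = algebra_homD(2-)[OF comult_hom] and \<epsilon>_simps = algebra_homD(2-)[OF counit_hom]

text \<open>Coface maps out of \<open>H \<otimes> H\<close> (one digit) and \<open>H \<otimes> H \<otimes> H\<close> (two digits): the last digit is the number
  of the tensor factor that is doubled, and the last map of each family appends a unit instead.\<close>

definition face1 :: "'a \<otimes> 'a \<Rightarrow> 'a \<otimes> 'a \<otimes> 'a"
  where "face1 x = tensor_assoc (tensor_map \<Delta> id x)"
definition face2 :: "'a \<otimes> 'a \<Rightarrow> 'a \<otimes> 'a \<otimes> 'a"
  where "face2 x = tensor_map id \<Delta> x"
definition face3 :: "'a \<otimes> 'a \<Rightarrow> 'a \<otimes> 'a \<otimes> 'a"
  where "face3 x = tensor_assoc (x \<otimes>\<^sub>t 1)"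
definition face31 :: "'a \<otimes> 'a \<otimes> 'a \<Rightarrow> 'a \<otimes> 'a \<otimes> 'a \<otimes> 'a"
  where "face31 x = tensor_assoc (tensor_map \<Delta> id x)"
definition face32 :: "'a \<otimes> 'a \<otimes> 'a \<Rightarrow> 'a \<otimes> 'a \<otimes> 'a \<otimes> 'a"
  where "face32 x = tensor_map id tensor_assoc (tensor_map id (tensor_map \<Delta> id) x)"
definition face33 :: "'a \<otimes> 'a \<otimes> 'a \<Rightarrow> 'a \<otimes> 'a \<otimes> 'a \<otimes> 'a"
  where "face33 x = tensor_map id (tensor_map id \<Delta>) x"
definition face34 :: "'a \<otimes> 'a \<otimes> 'a \<Rightarrow> 'a \<otimes> 'a \<otimes> 'a \<otimes> 'a"
  where "face34 x = assoc4 (x \<otimes>\<^sub>t 1)"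

lemma face_hom:
  "algebra_hom face1" "algebra_hom face2" "algebra_hom face3"
  "algebra_hom face31" "algebra_hom face32" "algebra_hom face33" "algebra_hom face34"
  unfolding face1_def[abs_def] face2_def[abs_def] face3_def[abs_def] face31_def[abs_def]
    face32_def[abs_def] face33_def[abs_def] face34_def[abs_def]
  by (intro algebra_hom_compose[OF _ algebra_hom_tensor_assoc] algebra_hom_compose[OF
      algebra_hom_tens_1 algebra_hom_assoc4]
      algebra_hom_compose[OF algebra_hom_tens_1 algebra_hom_tensor_assoc]
      algebra_hom_compose[OF _ algebra_hom_tensor_map[OF algebra_hom_id algebra_hom_tensor_assoc]]
      algebra_hom_tensor_map algebra_hom_id comult_hom)+

lemmas face_lin = face_hom[THEN algebra_homD(1)]
lemmas face_mult = face_hom[THEN algebra_homD(3)]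
lemmas face_1 = face_hom[THEN algebra_homD(2)]

lemma pentagon': "face33 \<Phi> * face31 \<Phi> = (1 \<otimes>\<^sub>t \<Phi>) * face32 \<Phi> * face34 \<Phi>"
  using pentagon by (simp add: face31_def face32_def face33_def face34_def assoc4_def)

lemma quasi_coassoc': "face2 (\<Delta> a) * \<Phi> = \<Phi> * face1 (\<Delta> a)"
  by (simp add: face1_def face2_def quasi_coassoc mult.assoc invertible_elementD[OF associator_invertible])

lemma face_tens:
  "face1 (a \<otimes>\<^sub>t b) = tensor_assoc (\<Delta> a \<otimes>\<^sub>t b)" "face2 (a \<otimes>\<^sub>t b) = a \<otimes>\<^sub>t \<Delta> b"
  "face3 (a \<otimes>\<^sub>t b) = a \<otimes>\<^sub>t b \<otimes>\<^sub>t 1"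
  "face31 (a \<otimes>\<^sub>t u) = tensor_assoc (\<Delta> a \<otimes>\<^sub>t u)"
  "face32 (a \<otimes>\<^sub>t u) = a \<otimes>\<^sub>t face1 u"
  "face33 (a \<otimes>\<^sub>t u) = a \<otimes>\<^sub>t face2 u"
  "face34 (a \<otimes>\<^sub>t u) = a \<otimes>\<^sub>t face3 u"
  by (simp_all add: face1_def face2_def face3_def face31_def face32_def face33_def face34_def
      tensor_map_tens \<Delta>_lin clinear_id clinear_tensor_map clinear_tensor_assoc tensor_assoc_tens
          assoc4_tens)

lemma face_unit:
  "face33 (1 \<otimes>\<^sub>t x) = 1 \<otimes>\<^sub>t face2 x" "face32 (1 \<otimes>\<^sub>t x) = 1 \<otimes>\<^sub>t face1 x" "face34 (1 \<otimes>\<^sub>t x) = 1 \<otimes>\<^sub>t face3 x"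
  "face31 (1 \<otimes>\<^sub>t x) = 1 \<otimes>\<^sub>t 1 \<otimes>\<^sub>t x"
  by (simp_all add: face_tens \<Delta>_simps one_tensor_def tensor_assoc_tens)

text \<open>Doublings of distinct factors commute, and an appended unit stays a unit. These
  cosimplicial identities hold strictly and involve no associator, unlike
  \<open>face_coassoc\<close>.\<close>

lemma face_cross:
  "face33 (face3 x) = face34 (face3 x)"
  "face33 (face1 x) = face31 (face2 x)"
  "face32 (face3 x) = face34 (face2 x)"
  "face31 (face3 x) = face34 (face1 x)"
proof -
  show "face33 (face3 x) = face34 (face3 x)"
    by (rule clinear_comp_tensor_eqI[OF face_lin(6) face_lin(3) face_lin(7) face_lin(3)])
      (simp add: face_tens \<Delta>_simps one_tensor_def[symmetric])
  show "face33 (face1 x) = face31 (face2 x)"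
    by (rule clinear_comp_tensor_eqI[OF face_lin(6) face_lin(1) face_lin(4) face_lin(2)])
      (simp add: face_tens, simp add: face33_def tensor_assoc_nat3 \<Delta>_lin)
  show "face32 (face3 x) = face34 (face2 x)"
    by (rule clinear_comp_tensor_eqI[OF face_lin(5) face_lin(3) face_lin(7) face_lin(2)])
      (simp add: face_tens tensor_assoc_tens, simp add: face1_def face3_def tensor_assoc_tens
          face_tens tensor_map_tens \<Delta>_lin clinear_id)
  show "face31 (face3 x) = face34 (face1 x)"
    by (rule clinear_comp_tensor_eqI[OF face_lin(4) face_lin(3) face_lin(7) face_lin(1)])
      (simp add: face_tens face34_def assoc4_assoc)
qed

text \<open>Conjugation by \<open>\<Phi>\<close> exchanges those composites of coface maps whose equality would be
  coassociativity.\<close>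

lemma face_coassoc:
  "(1 \<otimes>\<^sub>t \<Phi>) * face32 (face2 x) = face33 (face2 x) * (1 \<otimes>\<^sub>t \<Phi>)"
  "face32 (face1 x) * face34 \<Phi> = face34 \<Phi> * face31 (face1 x)"
proof -
  show "(1 \<otimes>\<^sub>t \<Phi>) * face32 (face2 x) = face33 (face2 x) * (1 \<otimes>\<^sub>t \<Phi>)"
    by (rule clinear_comp_tensor_eqI[OF clinear_compose[OF face_lin(5) clinear_mult_left]
        face_lin(2) clinear_compose[OF face_lin(6) clinear_mult_right] face_lin(2)])
      (simp add: face_tens tens_mult quasi_coassoc')
  \<comment> \<open>The last factor is a spectator here and in \<open>b\<close>, so
    quasi-coassociativity can be applied inside the first three.\<close>
  have a: "face32 (tensor_assoc (u \<otimes>\<^sub>t b)) = assoc4 (face2 u \<otimes>\<^sub>t b)" for u b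
  proof (induct u rule: tensor_induct)
    case (tens p q)
    then show ?case
      by (simp add: face_tens tensor_assoc_tens assoc4_tens)
  next
    case (add s t)
    then show ?case
      by (simp add: tens_linear clinear_add[OF clinear_tensor_assoc]
        clinear_add[OF clinear_assoc4] clinear_add[OF face_lin(5)] clinear_add[OF face_lin(2)])
  qed
  have b: "face31 (tensor_assoc (u \<otimes>\<^sub>t b)) = assoc4 (face1 u \<otimes>\<^sub>t b)" for u b
    by (induct u rule: tensor_induct)
      (simp_all add: face_tens tensor_assoc_tens assoc4_assoc tens_linear clinear_add[OF
          clinear_tensor_assoc]
        clinear_add[OF clinear_assoc4] clinear_add[OF face_lin(4)] clinear_add[OF face_lin(1)])
  show "face32 (face1 x) * face34 \<Phi> = face34 \<Phi> * face31 (face1 x)"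
    by (rule clinear_comp_tensor_eqI[OF clinear_compose[OF face_lin(5) clinear_mult_right]
        face_lin(1) clinear_compose[OF face_lin(4) clinear_mult_left] face_lin(1)])
      (simp add: face_tens a b face34_def algebra_homD(3)[OF algebra_hom_assoc4, symmetric]
          tens_mult quasi_coassoc')
qed

end

lemma tensor_map_id_conj:
  fixes k :: "'a::complex_algebra_1 \<Rightarrow> 'b::complex_algebra_1" and X :: "'c::complex_algebra_1 \<otimes> 'a"
  assumes "clinear k"
  shows "tensor_map id (\<lambda>x. p * k x * q) X = (1 \<otimes>\<^sub>t p) * tensor_map id k X * (1 \<otimes>\<^sub>t q)"
    "tensor_map (\<lambda>x. p * k x * q) id Y = (p \<otimes>\<^sub>t 1) * tensor_map k id Y * (q \<otimes>\<^sub>t 1)"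
proof -
  have l: "clinear (\<lambda>x. p * k x * q)"
    using assms by (simp add: clinear_iff distrib_left distrib_right mult_scaleC_left mult_scaleC_right)
  have l1: "clinear (tensor_map id (\<lambda>x. p * k x * q))" and l2: "clinear (tensor_map id k)"
    and l3: "clinear (tensor_map (\<lambda>x. p * k x * q) id)" and l4: "clinear (tensor_map k id)"
    by (intro clinear_tensor_map clinear_id l assms)+
  show "tensor_map id (\<lambda>x. p * k x * q) X = (1 \<otimes>\<^sub>t p) * tensor_map id k X * (1 \<otimes>\<^sub>t q)"
  proof (induct X rule: tensor_induct)
    case (tens a b)
    then show ?case by (simp add: tensor_map_tens l assms clinear_id tens_mult)
  qed (simp only: clinear_add[OF l1] clinear_add[OF l2] distrib_left distrib_right)
  show "tensor_map (\<lambda>x. p * k x * q) id Y = (p \<otimes>\<^sub>t 1) * tensor_map k id Y * (q \<otimes>\<^sub>t 1)"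
  proof (induct Y rule: tensor_induct)
    case (tens a b)
    then show ?case by (simp add: tensor_map_tens l assms clinear_id tens_mult)
  qed (simp only: clinear_add[OF l3] clinear_add[OF l4] distrib_left distrib_right)
qed

lemma mult_cancel_left_inverse:
  fixes x y z :: "'a::monoid_mult"
  assumes "x * y = 1" shows "x * (y * z) = z"
  by (simp add: mult.assoc[symmetric] assms)

section \<open>Contractions along the antipode\<close>

context quasi_hopf_algebra begin

abbreviation S where "S \<equiv> antipode H"

lemmas S_simps = algebra_antihomD(2-)[OF antipode_antihom]

text \<open>The place of \<open>alpha H\<close> is left variable because the antipode data of a
  twist are themselves such contractions, see \<open>T_alpha_beta\<close>.\<close>

definition act_left :: "'a \<Rightarrow> 'a \<otimes> 'a \<Rightarrow> 'a"
  where "act_left p w = tensor_lift (\<lambda>x y. S x * p * y) w"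
definition act_right :: "'a \<Rightarrow> 'a \<otimes> 'a \<Rightarrow> 'a"
  where "act_right q w = tensor_lift (\<lambda>x y. x * q * S y) w"

lemma act_bilinear: "cbilinear (\<lambda>x y. S x * p * y)" "cbilinear (\<lambda>x y. x * q * S y)"
  by (simp_all add: cbilinear_def clinear_iff S_simps distrib_left distrib_right mult_scaleC_left
      mult_scaleC_right)

lemma act_tens: "act_left p (x \<otimes>\<^sub>t y) = S x * p * y" "act_right q (x \<otimes>\<^sub>t y) = x * q * S y"
  by (simp_all add: act_left_def act_right_def tensor_lift_tens act_bilinear)

lemma act_lin: "clinear (act_left p)" "clinear (act_right q)"
  using clinear_tensor_lift[OF act_bilinear(1)] clinear_tensor_lift[OF act_bilinear(2)]
  by (simp_all add: act_left_def[abs_def] act_right_def[abs_def])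

lemmas act_simps = act_tens clinear_add[OF act_lin(1)] clinear_add[OF act_lin(2)]
  clinear_scale[OF act_lin(1)] clinear_scale[OF act_lin(2)] clinear_zero[OF act_lin(1)]
      clinear_zero[OF act_lin(2)]

lemma act_mult:
  "act_left p (u * (x \<otimes>\<^sub>t y)) = S x * act_left p u * y"
  "act_right q ((x \<otimes>\<^sub>t y) * u) = x * act_right q u * S y"
  by (induct u rule: tensor_induct)
    (simp_all add: act_simps tens_mult S_simps mult.assoc distrib_left distrib_right)

text \<open>\<open>S\<close> reverses products, so the two legs of the coproduct meet around alpha
  (or beta), where the antipode axiom replaces them by the counit.\<close>

lemma act_comult:
  "act_left (alpha H) (\<Delta> a * w) = \<epsilon> a *\<^sub>C act_left (alpha H) w"
  "act_right (beta H) (w * \<Delta> a) = \<epsilon> a *\<^sub>C act_right (beta H) w"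
proof -
  show "act_left (alpha H) (\<Delta> a * w) = \<epsilon> a *\<^sub>C act_left (alpha H) w"
  proof (induct w rule: tensor_induct)
    case (tens x y)
    then show ?case
      unfolding act_mult by (simp add: act_tens) (simp add: act_left_def antipode_left
          mult_scaleC_left mult_scaleC_right)
  qed (simp add: act_simps distrib_left scaleC_add_right)
  show "act_right (beta H) (w * \<Delta> a) = \<epsilon> a *\<^sub>C act_right (beta H) w"
  proof (induct w rule: tensor_induct)
    case (tens x y)
    then show ?case
      unfolding act_mult by (simp add: act_tens) (simp add: act_right_def antipode_right
          mult_scaleC_left mult_scaleC_right)
  qed (simp add: act_simps distrib_right scaleC_add_right)
qed

definition act3 :: "'a \<Rightarrow> 'a \<Rightarrow> 'a \<otimes> 'a \<otimes> 'a \<Rightarrow> 'a"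
  where "act3 p q w = tensor_lift (\<lambda>x. tensor_lift (\<lambda>y z. x * q * S y * p * z)) w"
definition act3' :: "'a \<Rightarrow> 'a \<Rightarrow> 'a \<otimes> 'a \<otimes> 'a \<Rightarrow> 'a"
  where "act3' p q w = tensor_lift (\<lambda>x. tensor_lift (\<lambda>y z. S x * p * y * q * S z)) w"

lemma act3_eq: "tensor_lift (\<lambda>y z. x * q * S y * p * z) u = x * q * act_left p u"
  "tensor_lift (\<lambda>y z. S x * p * y * q * S z) u = S x * p * act_right q u"
proof -
  have b: "cbilinear (\<lambda>y z. x * q * S y * p * z)" "cbilinear (\<lambda>y z. S x * p * y * q * S z)"
    by (simp_all add: cbilinear_def clinear_iff S_simps distrib_left distrib_right mult_scaleC_left
        mult_scaleC_right)
  show "tensor_lift (\<lambda>y z. x * q * S y * p * z) u = x * q * act_left p u"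
    by (induct u rule: tensor_induct)
     (simp_all only: tensor_lift_tens[OF b(1)] tensor_lift_add[OF b(1)] act_simps distrib_left, simp
         only: mult.assoc)
  show "tensor_lift (\<lambda>y z. S x * p * y * q * S z) u = S x * p * act_right q u"
    by (induct u rule: tensor_induct)
     (simp_all only: tensor_lift_tens[OF b(2)] tensor_lift_add[OF b(2)] act_simps distrib_left, simp
         only: mult.assoc)
qed

lemma act3_bilinear: "cbilinear (\<lambda>x u. x * q * act_left p u)" "cbilinear (\<lambda>x u. S x * p * act_right q u)"
  by (simp_all add: cbilinear_def clinear_iff act_simps S_simps distrib_left distrib_right
      mult_scaleC_left mult_scaleC_right)

lemma act3_eq': "act3 p q = tensor_lift (\<lambda>x u. x * q * act_left p u)"
  "act3' p q = tensor_lift (\<lambda>x u. S x * p * act_right q u)"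
  by (rule ext, simp only: act3_def act3'_def act3_eq[abs_def])+

lemma act3_tens: "act3 p q (x \<otimes>\<^sub>t u) = x * q * act_left p u" "act3' p q (x \<otimes>\<^sub>t u) = S x * p * act_right q u"
  by (simp_all add: act3_eq' tensor_lift_tens[OF act3_bilinear(1)] tensor_lift_tens[OF act3_bilinear(2)])

lemma act3_lin: "clinear (act3 p q)" "clinear (act3' p q)"
  using clinear_tensor_lift[OF act3_bilinear(1)] clinear_tensor_lift[OF act3_bilinear(2)]
  by (simp_all only: act3_eq')

lemmas act3_simps = act3_tens clinear_add[OF act3_lin(1)] clinear_add[OF act3_lin(2)]

lemma act3_one: "act3 (alpha H) (beta H) \<Phi> = 1" "act3' (alpha H) (beta H) (inverse_element \<Phi>) = 1"
  using antipode_associator antipode_associator_inverse by (simp_all add: act3_def act3'_def)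

text \<open>Passing to twisted alpha and beta amounts to multiplying the argument by
  \<open>1 \<otimes>\<^sub>t k\<close> and \<open>face3 j\<close>, or by \<open>face3 k\<close> and
  \<open>1 \<otimes>\<^sub>t j\<close>; these cancel the outer factors of the twisted associator and
  of its inverse.\<close>

lemma act3_twist:
  "act3 (act_left p k) (act_right q j) w = act3 p q ((1 \<otimes>\<^sub>t k) * w * face3 j)" (is ?A)
  "act3' (act_left p k) (act_right q j) w = act3' p q (face3 k * w * (1 \<otimes>\<^sub>t j))" (is ?B)
proof -
  have 1: "act_left (act_left p k) u = act_left p (k * u)" "act_right (act_right q j) u = act_right
      q (u * j)" for u
    by (induct u rule: tensor_induct; simp add: act_tens act_mult act_simps distrib_left distrib_right)+
  have 2: "act3 p q ((x \<otimes>\<^sub>t u) * face3 j) = x * act_right q j * act_left p u" for x u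
    by (induct j rule: tensor_induct)
      (simp_all add: face_tens tens_mult act3_simps act_mult act_simps distrib_left distrib_right
          mult.assoc clinear_add[OF face_lin(3)])
  have 3: "act3' p q (face3 k * (x \<otimes>\<^sub>t u)) = S x * act_left p k * act_right q u" for x u
    by (induct k rule: tensor_induct)
      (simp_all add: face_tens tens_mult act3_simps act_mult act_simps S_simps distrib_left
          distrib_right mult.assoc clinear_add[OF face_lin(3)])
  show ?A
  proof (induct w rule: tensor_induct)
    case (tens x u)
    then show ?case using 2[of x "k * u"] by (simp add: act3_tens tens_mult 1)
  qed (simp add: act3_simps distrib_left distrib_right)
  show ?B
  proof (induct w rule: tensor_induct)
    case (tens x u)
    then show ?case using 3[of x "u * j"] by (simp add: act3_tens tens_mult 1 mult.assoc)
  qed (simp add: act3_simps distrib_left distrib_right)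
qed

text \<open>The factors of the twisted associator next to \<Phi> are cofaces of \<open>J\<close> and
  its inverse. Their doubled legs collapse around alpha or beta by \<open>act_comult\<close>,
  leaving counit slices, which are 1 for a normalised twist.\<close>

lemma act3_face:
  "act3 (alpha H) (beta H) (face2 k * w) = slice_right \<epsilon> k * act3 (alpha H) (beta H) w" (is ?A)
  "act3 (alpha H) (beta H) (w * face1 k) = act3 (alpha H) (beta H) w * slice_left \<epsilon> k" (is ?B)
  "act3' (alpha H) (beta H) (face1 k * w) = act3' (alpha H) (beta H) w * S (slice_left \<epsilon> k)" (is ?C)
  "act3' (alpha H) (beta H) (w * face2 k) = S (slice_right \<epsilon> k) * act3' (alpha H) (beta H) w" (is ?D)
proof -
  note sl = slice_right_tens slice_left_tens slice_right_add slice_left_add \<epsilon>_lin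
  have A: "act3 (alpha H) (beta H) (face2 k * (x \<otimes>\<^sub>t u)) = slice_right \<epsilon> k * act3 (alpha H) (beta H)
      (x \<otimes>\<^sub>t u)" for x u
    by (induct k rule: tensor_induct)
      (simp_all add: face_tens tens_mult act3_simps act_comult sl distrib_right mult.assoc
          mult_scaleC_left mult_scaleC_right
          clinear_add[OF face_lin(2)])
  show ?A
    by (induct w rule: tensor_induct) (simp_all add: A act3_simps distrib_left)
  have D: "act3' (alpha H) (beta H) ((x \<otimes>\<^sub>t u) * face2 k) = S (slice_right \<epsilon> k) * act3' (alpha H)
      (beta H) (x \<otimes>\<^sub>t u)" for x u
    by (induct k rule: tensor_induct)
      (simp_all add: face_tens tens_mult act3_simps act_comult sl distrib_left distrib_right
          mult.assoc mult_scaleC_left mult_scaleC_right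
          S_simps clinear_add[OF face_lin(2)])
  show ?D
    by (induct w rule: tensor_induct) (simp_all add: D act3_simps distrib_left distrib_right)
  have B1: "act3 p q ((x \<otimes>\<^sub>t u) * tensor_assoc (v \<otimes>\<^sub>t b)) = x * act_right q v * act_left p u * b"
      for p q x u v b
    by (induct v rule: tensor_induct)
      (simp_all add: tensor_assoc_tens tens_mult act3_simps act_mult act_simps distrib_left
          distrib_right mult.assoc
         tens_linear clinear_add[OF clinear_tensor_assoc])
  have ER: "act_right (beta H) (\<Delta> a) = \<epsilon> a *\<^sub>C beta H" "act_left (alpha H) (\<Delta> a) = \<epsilon> a *\<^sub>C alpha H" for a
    by (simp_all add: act_right_def act_left_def antipode_right antipode_left)
  have B: "act3 (alpha H) (beta H) ((x \<otimes>\<^sub>t u) * face1 k) = act3 (alpha H) (beta H) (x \<otimes>\<^sub>t u) *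
      slice_left \<epsilon> k" for x u
    by (induct k rule: tensor_induct)
      (simp_all add: face_tens B1 ER act3_simps sl distrib_left mult.assoc mult_scaleC_left
          mult_scaleC_right
          clinear_add[OF face_lin(1)])
  show ?B
    by (induct w rule: tensor_induct) (simp_all add: B act3_simps distrib_right)
  have C1: "act3' p q (tensor_assoc (v \<otimes>\<^sub>t b) * (x \<otimes>\<^sub>t u)) = S x * act_left p v * act_right q u * S
      b" for p q x u v b
    by (induct v rule: tensor_induct)
      (simp_all add: tensor_assoc_tens tens_mult act3_simps act_mult act_simps S_simps distrib_left
          distrib_right mult.assoc
         tens_linear clinear_add[OF clinear_tensor_assoc])
  have C: "act3' (alpha H) (beta H) (face1 k * (x \<otimes>\<^sub>t u)) = act3' (alpha H) (beta H) (x \<otimes>\<^sub>t u) * S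
      (slice_left \<epsilon> k)" for x u
    by (induct k rule: tensor_induct)
      (simp_all add: face_tens C1 ER act3_simps sl S_simps distrib_left distrib_right mult.assoc
          mult_scaleC_left mult_scaleC_right
          clinear_add[OF face_lin(1)])
  show ?C
    by (induct w rule: tensor_induct) (simp_all add: C act3_simps distrib_left distrib_right)
qed

end

section \<open>The axioms for a twist\<close>

locale twisted_quasi_hopf = quasi_hopf_algebra +
  fixes J :: "'a \<otimes> 'a"
  assumes J_inv: "invertible_element J"
    and J_left: "slice_left (counit H) J = 1" and J_right: "slice_right (counit H) J = 1"
begin

abbreviation K where "K \<equiv> inverse_element J"

lemmas JK = invertible_elementD[OF J_inv]

lemma K_left: "slice_left \<epsilon> K = 1" and K_right: "slice_right \<epsilon> K = 1"
proof -
  have "slice_left \<epsilon> (J * K) = slice_left \<epsilon> K" "slice_right \<epsilon> (J * K) = slice_right \<epsilon> K"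
    by (simp_all only: slice_left_hom[OF counit_hom] slice_right_hom[OF counit_hom] J_left J_right
        mult_1_left)
  then show "slice_left \<epsilon> K = 1" "slice_right \<epsilon> K = 1"
    by (simp_all add: JK algebra_homD(2)[OF algebra_hom_slice_left[OF counit_hom]]
        algebra_homD(2)[OF algebra_hom_slice_right[OF counit_hom]])
qed

abbreviation T where "T \<equiv> twist J H"

lemma T_simps: "comult T = (\<lambda>a. J * \<Delta> a * K)" "counit T = \<epsilon>" "antipode T = antipode H"
  "associator T = (1 \<otimes>\<^sub>t J) * face2 J * \<Phi> * face1 K * face3 K"
  "alpha T = tensor_lift (\<lambda>x y. antipode H x * alpha H * y) K"
  "beta T = tensor_lift (\<lambda>x y. x * beta H * antipode H y) J"
  by (simp_all add: twist_def face1_def face2_def face3_def)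

lemma inv_hom: "algebra_hom f \<Longrightarrow> f J * f K = 1" "algebra_hom f \<Longrightarrow> f K * f J = 1"
  by (simp_all add: algebra_homD(3)[symmetric] JK algebra_homD(2))

lemma T_comult_hom: "algebra_hom (comult T)"
proof -
  have "J * \<Delta> x * K * (J * \<Delta> y * K) = J * \<Delta> x * (K * J) * \<Delta> y * K" for x y
    by (simp only: mult.assoc)
  then show ?thesis
    using \<Delta>_lin by (simp add: T_simps algebra_hom_def clinear_iff \<Delta>_simps JK distrib_left distrib_right
      mult_scaleC_left mult_scaleC_right mult.assoc)
qed

lemma T_face:
  "tensor_map id (comult T) w = (1 \<otimes>\<^sub>t J) * face2 w * (1 \<otimes>\<^sub>t K)"
  "tensor_assoc (tensor_map (comult T) id w) = face3 J * face1 w * face3 K"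
  "tensor_map id (tensor_map id (comult T)) x = (1 \<otimes>\<^sub>t 1 \<otimes>\<^sub>t J) * face33 x * (1 \<otimes>\<^sub>t 1 \<otimes>\<^sub>t K)"
  "tensor_assoc (tensor_map (comult T) id x) = face34 (face3 J) * face31 x * face34 (face3 K)"
  "tensor_map id tensor_assoc (tensor_map id (tensor_map (comult T) id) x) = (1 \<otimes>\<^sub>t face3 J) *
      face32 x * (1 \<otimes>\<^sub>t face3 K)"
proof -
  have *: "tensor_assoc (w \<otimes>\<^sub>t 1) = face34 (face3 w)" for w :: "'a \<otimes> 'a"
    by (rule clinear_comp_tensor_eqI[OF clinear_tensor_assoc clinear_tens_left face_lin(7) face_lin(3)])
      (simp add: face_tens tensor_assoc_tens, simp add: one_tensor_def tensor_assoc_tens)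
  show "tensor_map id (comult T) w = (1 \<otimes>\<^sub>t J) * face2 w * (1 \<otimes>\<^sub>t K)"
    by (simp only: T_simps tensor_map_id_conj[OF \<Delta>_lin] face2_def)
  show "tensor_assoc (tensor_map (comult T) id w) = face3 J * face1 w * face3 K"
    by (simp only: T_simps tensor_map_id_conj[OF \<Delta>_lin] face1_def face3_def tensor_assoc_mult)
  show "tensor_assoc (tensor_map (comult T) id x) = face34 (face3 J) * face31 x * face34 (face3 K)"
    by (simp only: T_simps tensor_map_id_conj[OF \<Delta>_lin] face31_def tensor_assoc_mult *)
  have "tensor_map id (tensor_map id (comult T)) x = tensor_map id (\<lambda>x. (1 \<otimes>\<^sub>t J) * tensor_map id \<Delta>
      x * (1 \<otimes>\<^sub>t K)) x"
    by (rule arg_cong[where f = "\<lambda>h. tensor_map id h x"])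
      (rule ext, simp only: T_simps tensor_map_id_conj[OF \<Delta>_lin])
  then show "tensor_map id (tensor_map id (comult T)) x = (1 \<otimes>\<^sub>t 1 \<otimes>\<^sub>t J) * face33 x * (1 \<otimes>\<^sub>t 1 \<otimes>\<^sub>t K)"
    by (simp only: tensor_map_id_conj[OF clinear_tensor_map[OF clinear_id(1) \<Delta>_lin]] face33_def)
  have a: "tensor_map id (tensor_map (comult T) id) x = tensor_map id (\<lambda>x. (J \<otimes>\<^sub>t 1) * tensor_map \<Delta>
      id x * (K \<otimes>\<^sub>t 1)) x"
    by (rule arg_cong[where f = "\<lambda>h. tensor_map id h x"])
      (rule ext, simp only: T_simps tensor_map_id_conj[OF \<Delta>_lin])
  show "tensor_map id tensor_assoc (tensor_map id (tensor_map (comult T) id) x) = (1 \<otimes>\<^sub>t face3 J) *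
      face32 x * (1 \<otimes>\<^sub>t face3 K)"
    unfolding a tensor_map_id_conj[OF clinear_tensor_map[OF \<Delta>_lin clinear_id(1)]]
      algebra_homD(3)[OF algebra_hom_tensor_map[OF algebra_hom_id algebra_hom_tensor_assoc]]
      tensor_map_tens[OF clinear_id(1) clinear_tensor_assoc] face32_def face3_def id_apply ..
qed

lemma T_quasi_coassoc:
  "tensor_map id (comult T) (comult T a) * associator T = associator T * tensor_assoc (tensor_map
      (comult T) id (comult T a))"
proof -
  note c = inv_hom[OF face_hom(1)] inv_hom[OF face_hom(2)] inv_hom[OF face_hom(3)] inv_hom[OF
      algebra_hom_1_tens]
  have q: "face2 (\<Delta> a) * (\<Phi> * z) = \<Phi> * (face1 (\<Delta> a) * z)" for z
    by (simp only: mult.assoc[symmetric] quasi_coassoc')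
  show ?thesis
    unfolding T_face
    by (simp only: T_simps face_mult mult.assoc c c[THEN mult_cancel_left_inverse] q mult_1_left
        mult_1_right)
qed

text \<open>After expansion both sides are products of coface images of \<open>J\<close>,
  \<open>K\<close> and \<Phi>. Adjacent images of \<open>J\<close> and \<open>K\<close> cancel,
  \<open>comm'\<close> exchanges factors in disjoint slots, \<open>q1\<close> and \<open>q2\<close>
  carry factors through the associator, and \<open>p\<close> is the pentagon of
  \<open>H\<close>.\<close>

lemma T_pentagon:
  "tensor_map id (tensor_map id (comult T)) (associator T) * tensor_assoc (tensor_map (comult T) id
      (associator T)) =
    (1 \<otimes>\<^sub>t associator T) * tensor_map id tensor_assoc (tensor_map id (tensor_map (comult T) id)
        (associator T)) *
    tensor_map id tensor_assoc (tensor_assoc (associator T \<otimes>\<^sub>t 1))"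
proof -
  have h: "algebra_hom (\<lambda>x. (1::'a) \<otimes>\<^sub>t face1 x)" "algebra_hom (\<lambda>x. (1::'a) \<otimes>\<^sub>t face2 x)"
      "algebra_hom (\<lambda>x. (1::'a) \<otimes>\<^sub>t face3 x)"
    "algebra_hom (\<lambda>x. (1::'a) \<otimes>\<^sub>t (1::'a) \<otimes>\<^sub>t (x::'a\<otimes>'a))"
    "algebra_hom (\<lambda>x. face31 (face2 x))" "algebra_hom (\<lambda>x. face34 (face2 x))" "algebra_hom (\<lambda>x.
        face34 (face3 x))"
    by (rule algebra_hom_compose[OF _ algebra_hom_1_tens] algebra_hom_compose[OF face_hom(2) face_hom(4)]
       algebra_hom_compose[OF face_hom(2) face_hom(7)] algebra_hom_compose[OF face_hom(3)
           face_hom(7)] face_hom algebra_hom_1_tens)+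
  note c = h[THEN inv_hom(1)] h[THEN inv_hom(2)]
  have comm: "(1 \<otimes>\<^sub>t 1 \<otimes>\<^sub>t x) * face34 (face3 y) = face34 (face3 y) * (1 \<otimes>\<^sub>t 1 \<otimes>\<^sub>t x)" for x y
    by (rule clinear_comp_tensor_eqI[OF clinear_compose[OF face_lin(7) clinear_mult_left] face_lin(3)
          clinear_compose[OF face_lin(7) clinear_mult_right] face_lin(3)])
      (simp add: face_tens tens_mult, simp add: one_tensor_def[symmetric])
  have comm': "(1 \<otimes>\<^sub>t 1 \<otimes>\<^sub>t x) * (face34 (face3 y) * z) = face34 (face3 y) * ((1 \<otimes>\<^sub>t 1 \<otimes>\<^sub>t x) * z)"
      for x y z
    by (simp only: mult.assoc[symmetric] comm)
  have t1: "(1::'a) \<otimes>\<^sub>t (x * y) = (1 \<otimes>\<^sub>t x) * (1 \<otimes>\<^sub>t y)" for x y :: "'a \<otimes> 'a \<otimes> 'a"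
    by (simp add: tens_mult)
  have f34: "tensor_map id tensor_assoc (tensor_assoc (x \<otimes>\<^sub>t 1)) = face34 x" for x
    by (simp only: face34_def assoc4_def)
  have q1: "(1 \<otimes>\<^sub>t \<Phi>) * (face32 (face2 x) * z) = face33 (face2 x) * ((1 \<otimes>\<^sub>t \<Phi>) * z)" for x z
    by (simp only: mult.assoc[symmetric] face_coassoc(1))
  have q2: "face32 (face1 x) * (face34 \<Phi> * z) = face34 \<Phi> * (face31 (face1 x) * z)" for x z
    by (simp only: mult.assoc[symmetric] face_coassoc(2))
  have p: "face33 \<Phi> * (face31 \<Phi> * z) = (1 \<otimes>\<^sub>t \<Phi>) * (face32 \<Phi> * (face34 \<Phi> * z))" for z
    by (simp only: mult.assoc[symmetric] pentagon')
  show ?thesis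
    unfolding T_face f34 T_simps(4) face_mult t1 face_unit face_cross mult.assoc
    apply (simp only: c c[THEN mult_cancel_left_inverse] comm' q1 q2 p mult_1_left mult_1_right)
    done
qed

lemma T_associator_inverse:
  "invertible_element (associator T)"
  "inverse_element (associator T) = face3 J * face1 J * inverse_element \<Phi> * face2 K * (1 \<otimes>\<^sub>t K)"
proof -
  note c = inv_hom[OF face_hom(1)] inv_hom[OF face_hom(2)] inv_hom[OF face_hom(3)] inv_hom[OF
      algebra_hom_1_tens]
    invertible_elementD[OF associator_invertible]
  let ?X = "face3 J * face1 J * inverse_element \<Phi> * face2 K * (1 \<otimes>\<^sub>t K)"
  have *: "associator T * ?X = 1" "?X * associator T = 1"
    unfolding T_simps mult.assoc by (simp_all only: c c[THEN mult_cancel_left_inverse] mult_1_left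
        mult_1_right)
  show "invertible_element (associator T)" by (rule invertible_elementI[OF *])
  show "inverse_element (associator T) = ?X" by (rule inverse_element_unique[OF *])
qed

lemma T_associator_counit: "tensor_map id (slice_left \<epsilon>) (associator T) = 1"
proof -
  note h = algebra_hom_tensor_map[OF algebra_hom_id algebra_hom_slice_left[OF counit_hom]]
  note l = algebra_homD(1)[OF algebra_hom_slice_left[OF counit_hom]]
  have c0: "tensor_map id (slice_left \<epsilon>) ((1::'a) \<otimes>\<^sub>t x) = 1 \<otimes>\<^sub>t slice_left \<epsilon> x" for x :: "'a \<otimes> 'a"
    by (simp add: tensor_map_tens clinear_id l)
  have c2: "tensor_map id (slice_left \<epsilon>) (face2 x) = id (id x)" for x
    by (rule clinear_comp_tensor_eqI[OF algebra_homD(1)[OF h] face_lin(2) clinear_id(1) clinear_id(1)])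
      (simp add: face_tens tensor_map_tens clinear_id l counit_left)
  have c1': "tensor_map id (slice_left \<epsilon>) (tensor_assoc (u \<otimes>\<^sub>t b)) = slice_right \<epsilon> u \<otimes>\<^sub>t b" for u ::
      "'a \<otimes> 'a" and b :: 'a
  proof (induct u rule: tensor_induct)
    case (tens x y)
    then show ?case by (simp add: tensor_assoc_tens tensor_map_tens clinear_id l slice_left_tens
        slice_right_tens \<epsilon>_lin tens_linear)
  next
    case (add s t)
    then show ?case
      by (simp only: tens_linear clinear_add[OF clinear_tensor_assoc] algebra_homD(4)[OF h]
          slice_right_add[OF \<epsilon>_lin])
  qed
  have c1: "tensor_map id (slice_left \<epsilon>) (face1 x) = id (id x)" for x
    by (rule clinear_comp_tensor_eqI[OF algebra_homD(1)[OF h] face_lin(1) clinear_id(1) clinear_id(1)])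
      (simp add: face_tens c1' counit_right)
  show ?thesis
    unfolding T_simps algebra_homD(3)[OF h] c0 c1 c2 face3_def c1' J_left K_right associator_counit
    by (simp only: one_tensor_def[symmetric] JK mult_1_left mult_1_right id_apply)
qed

lemma T_alpha_beta: "alpha T = act_left (alpha H) K" "beta T = act_right (beta H) J"
  by (simp_all add: T_simps act_left_def act_right_def)

lemma T_act:
  "act_left (alpha T) w = act_left (alpha H) (K * w)" "act_right (beta T) w = act_right (beta H) (w * J)"
  unfolding T_alpha_beta
  by (induct w rule: tensor_induct; simp add: act_tens act_mult act_simps distrib_left distrib_right)+

theorem quasi_hopf_algebra_twist: "quasi_hopf_algebra T"
proof
  note c = inv_hom[OF face_hom(1)] inv_hom[OF face_hom(2)] inv_hom[OF face_hom(3)] inv_hom[OF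
      algebra_hom_1_tens]
  show "algebra_hom (comult T)" by (rule T_comult_hom)
  show "algebra_hom (counit T)" by (simp add: T_simps counit_hom)
  show "slice_left (counit T) (comult T a) = a" "slice_right (counit T) (comult T a) = a" for a
    by (simp_all add: T_simps slice_left_hom[OF counit_hom] slice_right_hom[OF counit_hom]
      J_left J_right K_left K_right counit_left counit_right)
  show "invertible_element (associator T)" by (rule T_associator_inverse)
  then show "tensor_map id (comult T) (comult T a) =
      associator T * tensor_assoc (tensor_map (comult T) id (comult T a)) * inverse_element
          (associator T)" for a
    unfolding T_quasi_coassoc[symmetric] by (simp only: mult.assoc invertible_elementD mult_1_right)
  show "tensor_map id (slice_left (counit T)) (associator T) = 1"
    using T_associator_counit by (simp only: T_simps(2))
  show "algebra_antihom (antipode T)" "bij (antipode T)"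
    by (simp_all add: T_simps(3) antipode_antihom antipode_bij)
  show "tensor_lift (\<lambda>x y. antipode T x * alpha T * y) (comult T a) = counit T a *\<^sub>C alpha T" for a
  proof -
    have "act_left (alpha T) (comult T a) = \<epsilon> a *\<^sub>C alpha T"
      unfolding T_act unfolding T_alpha_beta T_simps(1) mult.assoc mult_cancel_left_inverse[OF
          JK(2)] act_comult ..
    then show ?thesis by (simp only: act_left_def T_simps(2,3))
  qed
  show "tensor_lift (\<lambda>x y. x * beta T * antipode T y) (comult T a) = counit T a *\<^sub>C beta T" for a
  proof -
    have "act_right (beta T) (comult T a) = \<epsilon> a *\<^sub>C beta T"
      unfolding T_act unfolding T_alpha_beta T_simps(1) mult.assoc JK mult_1_right act_comult ..
    then show ?thesis by (simp only: act_right_def T_simps(2,3))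
  qed
  have "act3 (alpha T) (beta T) (associator T) = 1"
    unfolding T_alpha_beta act3_twist T_simps(4) mult.assoc c[THEN mult_cancel_left_inverse] c
        mult_1_right act3_face
    by (simp only: J_right act3_face K_left act3_one mult_1_left mult_1_right)
  then show "tensor_lift (\<lambda>x. tensor_lift (\<lambda>y z. x * beta T * antipode T y * alpha T * z))
      (associator T) = 1"
    by (simp only: act3_def T_simps(3))
  have "act3' (alpha T) (beta T) (inverse_element (associator T)) = 1"
    unfolding T_alpha_beta act3_twist T_associator_inverse mult.assoc c[THEN
        mult_cancel_left_inverse] c mult_1_right act3_face
    by (simp only: J_left act3_face K_right act3_one mult_1_left mult_1_right S_simps)
  then show "tensor_lift (\<lambda>x. tensor_lift (\<lambda>y z. antipode T x * alpha T * y * beta T * antipode T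
      z)) (inverse_element (associator T)) = 1"
    by (simp only: act3'_def T_simps(3))
qed (rule T_pentagon)

lemma twist_twist:
  assumes "invertible_element L"
  shows "twist L T = twist (L * J) H"
proof -
  note c = inv_hom[OF face_hom(1)] inv_hom[OF face_hom(2)] inv_hom[OF face_hom(3)] inv_hom[OF
      algebra_hom_1_tens]
  note m = invertible_element_mult(2)[OF assms J_inv]
  have t1: "(1::'a) \<otimes>\<^sub>t (x * y) = (1 \<otimes>\<^sub>t x) * (1 \<otimes>\<^sub>t y)" for x y :: "'a \<otimes> 'a"
    by (simp add: tens_mult)
  have "comult (twist L T) = comult (twist (L * J) H)"
    unfolding twist_def[of L] twist_def[of "L * J"] m quasi_hopf.simps T_simps by (simp only: mult.assoc)
  moreover have "associator (twist L T) = associator (twist (L * J) H)"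
    unfolding twist_def[of L] twist_def[of "L * J"] m quasi_hopf.simps T_face T_simps(4)
    unfolding face1_def[symmetric] face2_def[symmetric] face3_def[symmetric] face_mult t1
    by (simp only: mult.assoc c[THEN mult_cancel_left_inverse])
  moreover have "alpha (twist L T) = alpha (twist (L * J) H)"
    unfolding twist_def[of L] twist_def[of "L * J"] m quasi_hopf.simps act_left_def[symmetric]
    using T_act(1)[of "inverse_element L"] by (simp only: act_left_def T_simps(3))
  moreover have "beta (twist L T) = beta (twist (L * J) H)"
    unfolding twist_def[of L] twist_def[of "L * J"] m quasi_hopf.simps
    using T_act(2)[of L] by (simp only: act_right_def T_simps(3))
  moreover have "counit (twist L T) = counit (twist (L * J) H)" "antipode (twist L T) = antipode
      (twist (L * J) H)"
    by (simp_all add: twist_def)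
  ultimately show ?thesis by simp
qed

text \<open>Successive twists compose, so a chain of them can be discharged one at a time from its
  last member.\<close>

lemma twist_equivalent_twist:
  assumes "twist_equivalent T Q"
  shows "twist_equivalent H Q"
proof -
  obtain L f where L: "invertible_element L" "slice_left (counit T) L = 1" "slice_right (counit T) L = 1"
    and f: "quasi_hopf_iso f (twist L T) Q"
    using assms by (auto simp: twist_equivalent_def)
  have "invertible_element (L * J)" by (rule invertible_element_mult(1)[OF L(1) J_inv])
  moreover have "slice_left (counit H) (L * J) = 1" "slice_right (counit H) (L * J) = 1"
    using L(2,3) by (simp_all add: T_simps(2) slice_left_hom[OF counit_hom] slice_right_hom[OF
        counit_hom] J_left J_right)
  ultimately show ?thesis
    using f by (auto simp: twist_equivalent_def twist_twist[OF L(1)])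
qed

end

section \<open>Eigenvectors and outer derivations of a nonsemisimple algebra\<close>

lemma finite_basis_exists:
  assumes "complex_vector.dim (UNIV :: 'a::complex_vector set) \<noteq> 0"
  obtains B :: "'a::complex_vector set" where "finite B" "complex_vector.independent B"
      "complex_vector.span B = UNIV"
    "card B = complex_vector.dim (UNIV :: 'a set)"
proof -
  obtain B :: "'a set" where B: "B \<subseteq> UNIV" "complex_vector.independent B" "UNIV \<subseteq> complex_vector.span B"
    "card B = complex_vector.dim (UNIV :: 'a set)"
    by (rule complex_vector.basis_exists)
  then have "finite B" using assms by (metis card.infinite)
  with B that show thesis by blast
qed

lemma dependent_family:
  fixes v :: "nat \<Rightarrow> 'a::complex_vector"
  assumes "complex_vector.dim (UNIV :: 'a set) \<noteq> 0" "complex_vector.dim (UNIV :: 'a set) < n"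
  obtains c where "\<exists>i<n. c i \<noteq> (0::complex)" "(\<Sum>i<n. c i *\<^sub>C v i) = 0"
proof (cases "inj_on v {..<n}")
  case False
  then obtain i j where ij: "i < n" "j < n" "i \<noteq> j" "v i = v j" by (auto simp: inj_on_def)
  define c where "c k = (if k = i then 1 else if k = j then -1 else (0::complex))" for k
  have "(\<Sum>k<n. c k *\<^sub>C v k) = (\<Sum>k\<in>{i,j}. c k *\<^sub>C v k)"
    by (rule sum.mono_neutral_right) (use ij in \<open>auto simp: c_def\<close>)
  also have "\<dots> = 0" using ij by (simp add: c_def scaleC_one)
  finally have *: "(\<Sum>k<n. c k *\<^sub>C v k) = 0" .
  have "c i \<noteq> 0" by (simp add: c_def)
  with ij(1) that[OF _ *] show thesis by blast
next
  case True
  obtain B :: "'a set" where B: "finite B" "complex_vector.independent B" "complex_vector.span B = UNIV"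
    "card B = complex_vector.dim (UNIV :: 'a set)"
    using finite_basis_exists[OF assms(1)] .
  have "complex_vector.dependent (v ` {..<n})"
  proof (rule ccontr)
    assume "complex_vector.independent (v ` {..<n})"
    from complex_vector.independent_span_bound[OF B(1) this] B(3,4) assms(2) True show False
      by (simp add: card_image)
  qed
  then obtain u x where u: "(\<Sum>w\<in>v ` {..<n}. u w *\<^sub>C w) = 0" "x \<in> v ` {..<n}" "u x \<noteq> 0"
    by (auto simp: complex_vector.dependent_finite)
  then show thesis using that[of "\<lambda>i. u (v i)"] True by (auto simp: sum.reindex)
qed

text \<open>In a vanishing combination, the form with the least index carrying a nonzero coefficient
  sees only the diagonal term; hence the vectors are independent.\<close>

lemma triangular_family_bound:
  fixes v :: "nat \<Rightarrow> 'a::complex_vector" and F :: "nat \<Rightarrow> 'a \<Rightarrow> complex"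
  assumes "complex_vector.dim (UNIV :: 'a set) \<noteq> 0"
    and lin: "\<And>i. i < n \<Longrightarrow> clinear (F i)"
    and diag: "\<And>i. i < n \<Longrightarrow> F i (v i) \<noteq> 0"
    and upper: "\<And>i j. i < j \<Longrightarrow> j < n \<Longrightarrow> F i (v j) = 0"
  shows "n \<le> complex_vector.dim (UNIV :: 'a set)"
proof (rule ccontr)
  assume "\<not> ?thesis"
  then obtain c where c: "\<exists>i<n. c i \<noteq> (0::complex)" "(\<Sum>i<n. c i *\<^sub>C v i) = 0"
    using dependent_family[OF assms(1), of n v] by (metis not_le)
  define i where "i = (LEAST i. i < n \<and> c i \<noteq> 0)"
  have i: "i < n" "c i \<noteq> 0" using LeastI_ex[OF c(1)] by (auto simp: i_def)
  have less: "c j = 0" if "j < i" for j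
    using not_less_Least[of j "\<lambda>i. i < n \<and> c i \<noteq> 0"] that i(1) by (auto simp: i_def)
  have "0 = F i (\<Sum>j<n. c j *\<^sub>C v j)" using c(2) clinear_zero[OF lin[OF i(1)]] by simp
  also have "\<dots> = (\<Sum>j<n. c j * F i (v j))"
    by (simp add: clinear_sum[OF lin[OF i(1)]] clinear_scale[OF lin[OF i(1)]] scaleC_complex_def)
  also have "\<dots> = (\<Sum>j\<in>{i}. c j * F i (v j))"
  proof (rule sum.mono_neutral_right)
    show "\<forall>j\<in>{..<n} - {i}. c j * F i (v j) = 0"
    proof
      fix j assume "j \<in> {..<n} - {i}"
      then show "c j * F i (v j) = 0" using less[of j] upper[of i j] by (cases "j < i") auto
    qed
  qed (use i in auto)
  finally show False using i diag by simp
qed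

definition poly_eval :: "'a::complex_algebra_1 \<Rightarrow> complex poly \<Rightarrow> 'a"
  where "poly_eval m q = fold_coeffs (\<lambda>c x. c *\<^sub>C 1 + m * x) q 0"

lemma poly_eval_0 [simp]: "poly_eval m 0 = 0"
  by (simp add: poly_eval_def)

lemma poly_eval_pCons [simp]: "poly_eval m (pCons c q) = c *\<^sub>C 1 + m * poly_eval m q"
  by (cases "c = 0 \<and> q = 0") (auto simp: poly_eval_def)

lemma poly_eval_add: "poly_eval m (p + q) = poly_eval m p + poly_eval m q"
  by (induct p q rule: poly_induct2) (simp_all add: scaleC_add_left distrib_left)

lemma poly_eval_smult: "poly_eval m (smult c p) = c *\<^sub>C poly_eval m p"
  by (induct p) (simp_all add: scaleC_add_right scaleC_scaleC mult_scaleC_right)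

lemma poly_eval_sum: "poly_eval m (sum f I) = (\<Sum>i\<in>I. poly_eval m (f i))"
  by (induct I rule: infinite_finite_induct) (simp_all add: poly_eval_add)

lemma poly_eval_monom: "poly_eval m (monom c n) = c *\<^sub>C m ^ n"
  by (induct n) (simp_all add: monom_0 monom_Suc mult_scaleC_right)

lemma poly_eval_linear_factor: "poly_eval m ([:- c, 1:] * q) = (m - c *\<^sub>C 1) * poly_eval m q"
proof -
  have "[:- c, 1:] * q = smult (- c) q + pCons 0 q" by simp
  then show ?thesis
    by (simp only: poly_eval_add poly_eval_smult poly_eval_pCons) (simp add: left_diff_distrib
        mult_scaleC_left)
qed

lemma annihilating_poly:
  fixes m :: "'a::complex_algebra_1"
  assumes "complex_vector.dim (UNIV :: 'a set) \<noteq> 0"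
  obtains q where "q \<noteq> 0" "poly_eval m q = 0"
proof -
  let ?n = "Suc (complex_vector.dim (UNIV :: 'a set))"
  obtain c where c: "\<exists>i<?n. c i \<noteq> (0::complex)" "(\<Sum>i<?n. c i *\<^sub>C m ^ i) = 0"
    using dependent_family[OF assms, of ?n "\<lambda>i. m ^ i"] by blast
  define q where "q = (\<Sum>i<?n. monom (c i) i)"
  have "coeff q j = c j" if "j < ?n" for j
  proof -
    have "coeff q j = (\<Sum>i<?n. if j = i then c i else 0)" by (auto simp: q_def coeff_sum intro!: sum.cong)
    then show ?thesis using that by (simp only: sum.delta[OF finite_lessThan]) (simp del: lessThan_Suc)
  qed
  then have "q \<noteq> 0" using c(1) by auto
  moreover have "poly_eval m q = 0" unfolding q_def poly_eval_sum poly_eval_monom by (rule c(2))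
  ultimately show thesis using that by blast
qed

lemma left_idealD:
  fixes J :: "'a::complex_algebra_1 set"
  assumes "left_ideal J"
  shows "0 \<in> J" "x \<in> J \<Longrightarrow> y \<in> J \<Longrightarrow> x + y \<in> J" "x \<in> J \<Longrightarrow> a * x \<in> J" "x \<in> J \<Longrightarrow> c *\<^sub>C x \<in> J"
    "x \<in> J \<Longrightarrow> y \<in> J \<Longrightarrow> x - y \<in> J" "complex_vector.subspace J" "x \<in> J \<Longrightarrow> - x \<in> J"
proof -
  show 1: "0 \<in> J" "\<And>x y. x \<in> J \<Longrightarrow> y \<in> J \<Longrightarrow> x + y \<in> J" "\<And>a x. x \<in> J \<Longrightarrow> a * x \<in> J"
    using assms by (auto simp: left_ideal_def)
  show 2: "c *\<^sub>C x \<in> J" if "x \<in> J" for c x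
    using 1(3)[OF that, of "c *\<^sub>C 1"] by (simp add: mult_scaleC_left)
  show 3: "- x \<in> J" if "x \<in> J" for x using 1(3)[OF that, of "-1"] by simp
  show "x \<in> J \<Longrightarrow> y \<in> J \<Longrightarrow> x - y \<in> J" using 1(2)[of x "-y"] 3[of y] by simp
  show "complex_vector.subspace J" using 1 2 by (auto simp: complex_vector.subspace_def)
qed

text \<open>Split an annihilating polynomial of \<open>m\<close> into linear factors. It sends
  \<open>v\<close> into \<open>J\<close> while a nonzero constant does not, so some linear factor
  pushes a vector from outside \<open>J\<close> into \<open>J\<close>: that vector is an eigenvector
  modulo \<open>J\<close>.\<close>

lemma eigenvalue_mod_exists:
  fixes m :: "'a::complex_algebra_1"
  assumes "complex_vector.dim (UNIV :: 'a set) \<noteq> 0" "left_ideal J" "left_ideal J'" "v \<in> J'" "v \<notin> J"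
  obtains c u where "u \<in> J'" "u \<notin> J" "m * u - c *\<^sub>C u \<in> J"
proof -
  obtain q where q: "q \<noteq> 0" "poly_eval m q = 0" using annihilating_poly[OF assms(1)] .
  have "\<exists>c u. u \<in> J' \<and> u \<notin> J \<and> m * u - c *\<^sub>C u \<in> J" if "q \<noteq> 0" "poly_eval m q * v \<in> J" for q
    using that
  proof (induct "degree q" arbitrary: q)
    case 0
    then obtain k where "q = [:k:]" using degree_eq_zeroE by metis
    with 0 have "k \<noteq> 0" "k *\<^sub>C v \<in> J" by (auto simp: mult_scaleC_left)
    then have "v \<in> J" using left_idealD(4)[OF assms(2), of "k *\<^sub>C v" "inverse k"] by (simp add:
        scaleC_scaleC scaleC_one)
    with assms show ?case by simp
  next
    case (Suc n)
    then have "\<not> constant (poly q)" by (simp add: constant_degree)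
    then obtain c where "poly q c = 0" using fundamental_theorem_of_algebra by blast
    then obtain r where r: "q = [:- c, 1:] * r" by (auto simp: poly_eq_0_iff_dvd elim: dvdE)
    with Suc have r0: "r \<noteq> 0" by auto
    have "degree q = Suc (degree r)" unfolding r by (subst degree_mult_eq) (use r0 in auto)
    with Suc have deg: "n = degree r" by simp
    show ?case
    proof (cases "poly_eval m r * v \<in> J")
      case True
      from Suc(1)[OF deg r0 this] show ?thesis .
    next
      case False
      have "m * (poly_eval m r * v) - c *\<^sub>C (poly_eval m r * v) = poly_eval m q * v"
        unfolding r poly_eval_linear_factor by (simp add: left_diff_distrib mult_scaleC_left mult.assoc)
      with False Suc left_idealD(3)[OF assms(3,4)] show ?thesis by metis
    qed
  qed
  from this[OF q(1)] q(2) left_idealD(1)[OF assms(2)] that show thesis by auto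
qed

lemma minimal_left_ideal_above:
  fixes J :: "'a::complex_algebra_1 set"
  assumes "complex_vector.dim (UNIV :: 'a set) \<noteq> 0" "left_ideal J" "J \<noteq> UNIV"
  obtains J' where "left_ideal J'" "J \<subset> J'" "\<And>L. left_ideal L \<Longrightarrow> J \<subset> L \<Longrightarrow> L \<subseteq> J' \<Longrightarrow> L = J'"
proof -
  obtain B :: "'a set" where B: "finite B" "complex_vector.independent B" "complex_vector.span B = UNIV"
    using finite_basis_exists[OF assms(1)] by metis
  interpret fd: finite_dimensional_vector_space scaleC B
    by unfold_locales (use B in auto)
  define P where "P L \<longleftrightarrow> left_ideal L \<and> J \<subset> L" for L
  have "P UNIV" using assms by (auto simp: P_def left_ideal_def)
  then obtain J' where J': "P J'" "\<And>L. P L \<Longrightarrow> complex_vector.dim J' \<le> complex_vector.dim L"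
    using ex_has_least_nat[of P _ complex_vector.dim] by metis
  show thesis
  proof (rule that)
    fix L assume L: "left_ideal L" "J \<subset> L" "L \<subseteq> J'"
    then have "complex_vector.dim J' \<le> complex_vector.dim L" by (intro J') (simp add: P_def)
    then show "L = J'"
      using L J' by (intro fd.subspace_dim_equal) (auto simp: P_def left_idealD(6))
  qed (use J' in \<open>auto simp: P_def\<close>)
qed

lemma algebra_hom_kernel_split:
  fixes \<epsilon> :: "'a::complex_algebra_1 \<Rightarrow> complex"
  assumes "algebra_hom \<epsilon>"
  shows "\<epsilon> (a - \<epsilon> a *\<^sub>C 1) = 0"
  using algebra_homD[OF assms] by (simp add: clinear_diff[OF algebra_homD(1)[OF assms]] scaleC_complex_def)

text \<open>Take \<open>J'\<close> minimal above \<open>J\<close> and suppose there is no eigenvector. As \<open>ker \<epsilon>\<close> has dimension \<open>3\<close>,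
  an element of it killing one nonzero vector of the simple module \<open>J'/J\<close> kills all of them.
  An \<open>m \<in> ker \<epsilon>\<close> has an eigenvalue \<open>c\<close> on \<open>J'/J\<close>, so \<open>m\<^sup>2 - c m\<close> kills \<open>J'/J\<close> and \<open>m\<close> acts as a scalar.\<close>
lemma eigenvector_mod_exists:
  fixes J :: "'a::complex_algebra_1 set" and \<epsilon> :: "'a \<Rightarrow> complex"
  assumes dim: "complex_vector.dim (UNIV :: 'a set) = 4" and \<epsilon>: "algebra_hom \<epsilon>"
    and J: "left_ideal J" "J \<noteq> UNIV"
  shows "\<exists>f. f \<notin> J \<and> (\<forall>a. \<exists>c. a * f - c *\<^sub>C f \<in> J)"
proof (rule ccontr)
  assume "\<not> ?thesis"
  then have no: "\<exists>a. \<forall>c. a * f - c *\<^sub>C f \<notin> J" if "f \<notin> J" for f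
    using that by metis
  have dim0: "complex_vector.dim (UNIV :: 'a set) \<noteq> 0" using dim by simp
  obtain J' where J': "left_ideal J'" "J \<subset> J'" and min: "\<And>L. left_ideal L \<Longrightarrow> J \<subset> L \<Longrightarrow> L \<subseteq> J' \<Longrightarrow> L = J'"
    using minimal_left_ideal_above[OF dim0 J] by metis
  note D = left_idealD[OF J(1)] and D' = left_idealD[OF J'(1)]
  note e = algebra_homD[OF \<epsilon>] and ed = clinear_diff[OF algebra_homD(1)[OF \<epsilon>]]
  \<comment> \<open>Subtracting \<open>\<epsilon> a\<close> times the unit only shifts eigenvalues,
    so the element for which \<open>f\<close> is no eigenvector may be taken in the kernel of the
    counit.\<close>
  have no_ker: "\<exists>m. \<epsilon> m = 0 \<and> (\<forall>c. m * f - c *\<^sub>C f \<notin> J)" if "f \<notin> J" for f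
  proof -
    obtain a where a: "a * f - c *\<^sub>C f \<notin> J" for c using no[OF \<open>f \<notin> J\<close>] by blast
    have "(a - \<epsilon> a *\<^sub>C 1) * f - c *\<^sub>C f = a * f - (\<epsilon> a + c) *\<^sub>C f" for c
      by (simp add: left_diff_distrib mult_scaleC_left scaleC_add_left)
    with a algebra_hom_kernel_split[OF \<epsilon>] show ?thesis by metis
  qed
  have gen: "\<exists>m. \<epsilon> m = 0 \<and> w - m * v \<in> J" if v: "v \<in> J'" "v \<notin> J" and w: "w \<in> J'" for v w
  proof -
    \<comment> \<open>The kernel of the counit is a left ideal, hence so is \<open>L\<close>; by
      \<open>no_ker\<close> with eigenvalue 0 it is strictly larger than \<open>J\<close>, and
      minimality makes it \<open>J'\<close>.\<close>
    define L where "L = {m * v + j | m j. \<epsilon> m = 0 \<and> j \<in> J}"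
    have "left_ideal L"
      unfolding left_ideal_def
    proof (intro conjI ballI allI)
      show "0 \<in> L" using D(1) clinear_zero[OF e(1)] unfolding L_def by (auto intro!: exI[of _ 0])
    next
      fix x y assume "x \<in> L" "y \<in> L"
      then obtain m j n k where "x = m * v + j" "y = n * v + k" "\<epsilon> m = 0" "\<epsilon> n = 0" "j \<in> J" "k \<in> J"
          by (auto simp: L_def)
      then have "x + y = (m + n) * v + (j + k)" "\<epsilon> (m + n) = 0" "j + k \<in> J"
        using D(2)[of j k] by (simp_all add: e distrib_right)
      then show "x + y \<in> L" unfolding L_def by blast
    next
      fix a x assume "x \<in> L"
      then obtain m j where "x = m * v + j" "\<epsilon> m = 0" "j \<in> J" by (auto simp: L_def)
      then have "a * x = (a * m) * v + a * j" "\<epsilon> (a * m) = 0" "a * j \<in> J"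
        using D(3)[of j a] by (simp_all add: e distrib_left mult.assoc)
      then show "a * x \<in> L" unfolding L_def by blast
    qed
    moreover have "J \<subseteq> L" using clinear_zero[OF e(1)] unfolding L_def by (force intro: exI[of _ 0])
    moreover obtain m where m: "\<epsilon> m = 0" "m * v - 0 *\<^sub>C v \<notin> J" using no_ker[OF v(2)] by blast
    have "m * v = m * v + 0" by simp
    then have "m * v \<in> L" unfolding L_def using m(1) D(1) by blast
    then have "J \<noteq> L" using m by auto
    moreover have "L \<subseteq> J'" unfolding L_def using J'(2) D'(2,3) v(1) by auto
    ultimately have "L = J'" using min by blast
    then have "w \<in> L" using w by simp
    then show ?thesis unfolding L_def by force
  qed
  have kill: "m * w \<in> J" if m: "\<epsilon> m = 0" and v: "v \<in> J'" "v \<notin> J" "m * v \<in> J" and w: "w \<in> J'" for m v w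
  proof (rule ccontr)
    assume mw: "m * w \<notin> J"
    then have m0: "m \<noteq> 0" using D(1) by auto
    show False
    \<comment> \<open>If the annihilator of \<open>v\<close> modulo \<open>J\<close> inside the
      kernel is just the line through \<open>m\<close>, it is stable under left multiplication,
      which makes \<open>m * w\<close> an eigenvector modulo \<open>J\<close>. Otherwise there is a
      further \<open>n\<close> independent of \<open>m\<close>.\<close>
    proof (cases "\<forall>n. \<epsilon> n = 0 \<and> n * v \<in> J \<longrightarrow> (\<exists>c. n = c *\<^sub>C m)")
      case True
      have "\<exists>c. a * (m * w) - c *\<^sub>C (m * w) \<in> J" for a
      proof -
        have "\<epsilon> (a * m) = 0" "a * m * v \<in> J" using m v(3) D(3) by (auto simp: e mult.assoc)
        then obtain c where "a * m = c *\<^sub>C m" using True by blast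
        then have "a * (m * w) - c *\<^sub>C (m * w) = 0" by (simp add: mult.assoc[symmetric] mult_scaleC_left)
        then show ?thesis using D(1) by metis
      qed
      with no[OF mw] show False by blast
    next
      case False
      then obtain n where n: "\<epsilon> n = 0" "n * v \<in> J" "\<And>c. n \<noteq> c *\<^sub>C m" by blast
      obtain p where p: "\<epsilon> p = 0" "v - p * v \<in> J" using gen[OF v(1,2,1)] by blast
      obtain q where q: "\<epsilon> q = 0" "\<And>c. q * v - c *\<^sub>C v \<notin> J" using no_ker[OF v(2)] by blast
      \<comment> \<open>\<open>m\<close> and \<open>n\<close> kill \<open>v\<close> modulo
        \<open>J\<close>, \<open>p\<close> fixes it and \<open>q\<close> moves it off its line, so
        these four are independent in the kernel of the counit; with the unit they are five in
        dimension 4.\<close>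
      define f where "f = (\<lambda>i::nat. [1, m, n, p, q] ! i)"
      obtain c where c: "\<exists>i<5. c i \<noteq> (0::complex)" "(\<Sum>i<5. c i *\<^sub>C f i) = 0"
        using dependent_family[OF dim0, of 5 f] dim by auto
      have "(\<Sum>i<5. g i) = g 0 + g 1 + g 2 + g 3 + g (4::nat)" for g :: "nat \<Rightarrow> 'a"
        by (simp add: eval_nat_numeral)
      note c = c(1) c(2)[unfolded this, simplified f_def, simplified]
      have "c 0 = 0"
        using arg_cong[OF c(2), of \<epsilon>] m n p q by (simp add: e clinear_zero[OF e(1)] scaleC_complex_def)
      have *: "c 1 *\<^sub>C (m * v) + c 2 *\<^sub>C (n * v) + c 3 *\<^sub>C (p * v) + c 4 *\<^sub>C (q * v) = 0"
        using arg_cong[OF c(2), of "\<lambda>x. x * v"] \<open>c 0 = 0\<close> by (simp add: distrib_right mult_scaleC_left)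
      have "c 4 *\<^sub>C (q * v) + c 3 *\<^sub>C v = c 3 *\<^sub>C (v - p * v) - c 1 *\<^sub>C (m * v) - c 2 *\<^sub>C (n * v)"
        using * by (simp add: complex_vector.scale_right_diff_distrib algebra_simps)
      also have "\<dots> \<in> J" by (rule D(5)[OF D(5)[OF D(4)[OF p(2)] D(4)[OF v(3)]] D(4)[OF n(2)]])
      finally have qv: "c 4 *\<^sub>C (q * v) + c 3 *\<^sub>C v \<in> J" .
      have c4: "c 4 = 0"
      proof (rule ccontr)
        assume "c 4 \<noteq> 0"
        then have "inverse (c 4) *\<^sub>C (c 4 *\<^sub>C (q * v) + c 3 *\<^sub>C v) = q * v - (- (c 3 / c 4)) *\<^sub>C v"
          by (simp add: scaleC_add_right scaleC_scaleC scaleC_one field_simps)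
        with q(2) D(4)[OF qv] show False by metis
      qed
      have c3: "c 3 = 0"
      proof (rule ccontr)
        assume "c 3 \<noteq> 0"
        then have "v = inverse (c 3) *\<^sub>C (c 4 *\<^sub>C (q * v) + c 3 *\<^sub>C v)" using c4 by (simp add:
            scaleC_scaleC scaleC_one)
        with v(2) D(4)[OF qv] show False by metis
      qed
      have mn: "c 1 *\<^sub>C m + c 2 *\<^sub>C n = 0" using c(2) c3 c4 \<open>c 0 = 0\<close> by simp
      have c2: "c 2 = 0"
      proof (rule ccontr)
        assume "c 2 \<noteq> 0"
        then have "n = inverse (c 2) *\<^sub>C (c 2 *\<^sub>C n)" by (simp add: scaleC_scaleC scaleC_one)
        also have "c 2 *\<^sub>C n = (- c 1) *\<^sub>C m" using mn by (simp add: eq_neg_iff_add_eq_0 add.commute)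
        finally show False using n(3) by (simp only: scaleC_scaleC)
      qed
      then have "c 1 = 0" using mn m0 by simp
      moreover have "i = 0 \<or> i = 1 \<or> i = 2 \<or> i = 3 \<or> i = 4" if "i < 5" for i :: nat
        using that by linarith
      ultimately show False using c2 c3 c4 \<open>c 0 = 0\<close> c(1) by metis
    qed
  qed
  have scalar: "\<exists>c. \<forall>w\<in>J'. m * w - c *\<^sub>C w \<in> J" if m: "\<epsilon> m = 0" for m
  proof (cases "\<exists>v. v \<in> J' \<and> v \<notin> J \<and> m * v \<in> J")
    case True
    with kill[OF m] show ?thesis by (intro exI[of _ 0]) auto
  next
    case False
    obtain v where v: "v \<in> J'" "v \<notin> J" using J'(2) by blast
    obtain c u where u: "u \<in> J'" "u \<notin> J" "m * u - c *\<^sub>C u \<in> J"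
      using eigenvalue_mod_exists[OF dim0 J(1) J'(1) v] by metis
    have eq: "(m * m - c *\<^sub>C m) * w = m * (m * w - c *\<^sub>C w)" for w
      by (simp add: left_diff_distrib right_diff_distrib mult_scaleC_left mult_scaleC_right mult.assoc)
    have mu: "(m * m - c *\<^sub>C m) * u \<in> J" unfolding eq by (rule D(3)[OF u(3)])
    have "(m * m - c *\<^sub>C m) * w \<in> J" if "w \<in> J'" for w
      by (rule kill[OF _ u(1,2) mu]) (use m that in \<open>simp_all add: ed e scaleC_complex_def\<close>)
    \<comment> \<open>In this case \<open>m\<close> sends no vector of \<open>J'\<close> outside
      \<open>J\<close> into \<open>J\<close>, so it can be cancelled on the left.\<close>
    then have "m * w - c *\<^sub>C w \<in> J" if "w \<in> J'" for w
      using False that D'(3,4,5) unfolding eq by metis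
    then show ?thesis by blast
  qed
  obtain v where v: "v \<in> J'" "v \<notin> J" using J'(2) by blast
  from no_ker[OF v(2)] scalar v show False by metis
qed

section \<open>Eigenvectors, semisimplicity and derivations between characters\<close>

definition left_eigenvector :: "('a::complex_algebra_1 \<Rightarrow> complex) \<Rightarrow> 'a \<Rightarrow> bool"
  where "left_eigenvector \<kappa> v \<longleftrightarrow> v \<noteq> 0 \<and> (\<forall>a. a * v = \<kappa> a *\<^sub>C v)"

lemma scaleC_cancel: "v \<noteq> 0 \<Longrightarrow> c *\<^sub>C v = d *\<^sub>C v \<longleftrightarrow> c = d" for v :: "'a::complex_vector"
  by (rule complex_vector.scale_cancel_right[THEN trans]) simp

text \<open>An eigenvector spans a simple left ideal, and a basis of eigenvectors decomposes the
  regular module into such lines. A decomposition is a set of ideals, hence the check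
  \<open>inj\<close> that distinct basis vectors give distinct lines.\<close>

lemma semisimple_if_eigenvectors_span:
  assumes dim0: "complex_vector.dim (UNIV :: 'a::complex_algebra_1 set) \<noteq> 0"
    and span: "complex_vector.span {v :: 'a. \<exists>\<kappa>. left_eigenvector \<kappa> v} = UNIV"
  shows "semisimple_ring TYPE('a)"
proof -
  let ?E = "{v :: 'a. \<exists>\<kappa>. left_eigenvector \<kappa> v}"
  obtain B where B: "B \<subseteq> ?E" "complex_vector.independent B" "?E \<subseteq> complex_vector.span B"
    using complex_vector.maximal_independent_subset[of ?E] by blast
  have spanB: "complex_vector.span B = UNIV"
    using complex_vector.span_mono[OF B(3)] span by (auto simp: complex_vector.span_span)
  obtain C :: "'a set" where C: "finite C" "complex_vector.span C = UNIV"
    using finite_basis_exists[OF dim0] by metis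
  have fin: "finite B" using complex_vector.independent_span_bound[OF C(1) B(2)] C(2) by simp
  define line where "line b = range (\<lambda>c. c *\<^sub>C b)" for b :: 'a
  have inline: "c *\<^sub>C b \<in> line b" for c b unfolding line_def by (rule rangeI)
  have nz: "b \<noteq> 0" if "b \<in> B" for b using B(1) that by (auto simp: left_eigenvector_def)
  have zero: "u b = 0" if "(\<Sum>b\<in>B. u b *\<^sub>C b) = 0" "b \<in> B" for u b
    using complex_vector.independentD[OF B(2) fin subset_refl that] .
  have inj: "inj_on line B"
  proof (rule inj_onI, rule ccontr)
    fix b b' assume b: "b \<in> B" "b' \<in> B" "line b = line b'" "b \<noteq> b'"
    then obtain c where c: "b = c *\<^sub>C b'" using inline[of 1 b] by (auto simp: scaleC_one line_def)
    then have "b \<in> complex_vector.span (B - {b})"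
      using b by (metis complex_vector.span_base complex_vector.span_scale insertE insert_Diff)
    with B(2) b(1) show False by (auto simp: complex_vector.dependent_def)
  qed
  have simple: "simple_left_ideal (line b)" if bB: "b \<in> B" for b
  proof -
    obtain \<kappa> where l: "left_eigenvector \<kappa> b" using bB B(1) by blast
    have "left_ideal (line b)"
      unfolding left_ideal_def line_def using l
      by (auto simp: left_eigenvector_def mult_scaleC_right scaleC_scaleC scaleC_add_left[symmetric]
          image_iff
          intro: exI[of _ 0])
    moreover have "line b \<noteq> {0}" using inline[of 1 b] nz[OF bB] by (auto simp: scaleC_one)
    moreover have "K = line b" if K: "left_ideal K" "K \<subseteq> line b" "K \<noteq> {0}" for K
    proof -
      obtain k where k: "k \<in> K" "k \<noteq> 0" using K left_idealD(1)[OF K(1)] by blast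
      then obtain c where c: "k = c *\<^sub>C b" using K(2) by (auto simp: line_def)
      with k have "c \<noteq> 0" by auto
      then have "d *\<^sub>C b = (d / c) *\<^sub>C k" for d by (simp add: c scaleC_scaleC)
      then have "line b \<subseteq> K" using left_idealD(4)[OF K(1) k(1)] by (auto simp: line_def)
      with K(2) show ?thesis by blast
    qed
    ultimately show ?thesis unfolding simple_left_ideal_def by blast
  qed
  have sum_line: "(\<Sum>I\<in>line ` B. f I) = (\<Sum>b\<in>B. f (line b))" for f :: "'a set \<Rightarrow> 'a"
    by (simp add: sum.reindex[OF inj])
  have ex1: "\<exists>!f. f \<in> (\<Pi>\<^sub>E I\<in>line ` B. I) \<and> (\<Sum>I\<in>line ` B. f I) = a" for a
  proof -
    have "a \<in> complex_vector.span B" using spanB by simp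
    then obtain r where r: "a = (\<Sum>b\<in>B. r b *\<^sub>C b)"
      unfolding complex_vector.span_finite[OF fin] by blast
    define f where "f = restrict (\<lambda>I. r (inv_into B line I) *\<^sub>C inv_into B line I) (line ` B)"
    have "f \<in> (\<Pi>\<^sub>E I\<in>line ` B. I)" by (auto simp: f_def inv_into_f_f[OF inj] inline)
    moreover have "(\<Sum>I\<in>line ` B. f I) = a" by (simp add: sum_line r f_def inv_into_f_f[OF inj])
    moreover have "f = g" if f: "f \<in> (\<Pi>\<^sub>E I\<in>line ` B. I)" "(\<Sum>I\<in>line ` B. f I) = a"
      and g: "g \<in> (\<Pi>\<^sub>E I\<in>line ` B. I)" "(\<Sum>I\<in>line ` B. g I) = a" for f g
    proof (rule PiE_ext[OF f(1) g(1)])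
      fix I assume "I \<in> line ` B"
      then obtain b where b: "b \<in> B" "I = line b" by blast
      have "\<exists>k. \<forall>b\<in>B. f (line b) = k b *\<^sub>C b" if "f \<in> (\<Pi>\<^sub>E I\<in>line ` B. I)" for f
        using that by (intro bchoice) (fastforce simp: line_def PiE_iff)
      then obtain k l where kl: "\<And>b. b \<in> B \<Longrightarrow> f (line b) = k b *\<^sub>C b" "\<And>b. b \<in> B \<Longrightarrow> g (line b) = l b *\<^sub>C b"
        using f(1) g(1) by meson
      have "(\<Sum>b\<in>B. (k b - l b) *\<^sub>C b) = (\<Sum>b\<in>B. f (line b)) - (\<Sum>b\<in>B. g (line b))"
        by (simp add: kl complex_vector.scale_left_diff_distrib sum_subtractf)
      also have "\<dots> = 0" using f(2) g(2) by (simp add: sum_line)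
      finally have "k b - l b = 0" by (rule zero[OF _ b(1)])
      then show "f I = g I" by (simp add: b kl)
    qed
    ultimately show ?thesis by blast
  qed
  show ?thesis
    unfolding semisimple_ring_def
    by (rule exI[of _ "line ` B"]) (use fin simple ex1 in blast)
qed

text \<open>Such a \<open>D\<close> is the off-diagonal entry of a representation by triangular 2 x
  2 matrices with diagonal \<kappa>, \<mu>, that is, an extension of one-dimensional modules; the
  extension splits exactly when \<open>D\<close> is inner.\<close>

definition skew_derivation :: "('a::complex_algebra_1 \<Rightarrow> complex) \<Rightarrow> ('a \<Rightarrow> complex) \<Rightarrow> ('a \<Rightarrow> complex) \<Rightarrow> bool"
  where "skew_derivation \<kappa> \<mu> D \<longleftrightarrow> clinear D \<and> (\<forall>a b. D (a * b) = \<kappa> a * D b + D a * \<mu> b)"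

definition inner_skew :: "('a::complex_algebra_1 \<Rightarrow> complex) \<Rightarrow> ('a \<Rightarrow> complex) \<Rightarrow> ('a \<Rightarrow> complex) \<Rightarrow> bool"
  where "inner_skew \<kappa> \<mu> D \<longleftrightarrow> (\<exists>c. \<forall>a. D a = c * (\<kappa> a - \<mu> a))"

text \<open>Let \<open>J\<close> be the span of the eigenvectors and \<open>f\<close> outside
  \<open>J\<close> an eigenvector modulo \<open>J\<close>. The defects \<open>g a\<close> lie in
  \<open>J\<close>, and their coordinates in a basis of eigenvectors are derivations; were all of
  them inner, their constants would correct \<open>f\<close> to a true eigenvector outside
  \<open>J\<close>.\<close>

lemma outer_skew_derivation_exists:
  fixes \<epsilon> :: "'a::complex_algebra_1 \<Rightarrow> complex"
  assumes dim: "complex_vector.dim (UNIV :: 'a set) = 4" and \<epsilon>: "algebra_hom \<epsilon>"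
    and ns: "\<not> semisimple_ring TYPE('a)"
  obtains \<kappa> \<mu> D :: "'a \<Rightarrow> complex"
  where "algebra_hom \<kappa>" "algebra_hom \<mu>" "skew_derivation \<kappa> \<mu> D" "\<not> inner_skew \<kappa> \<mu> D"
proof -
  have dim0: "complex_vector.dim (UNIV :: 'a set) \<noteq> 0" using dim by simp
  let ?E = "{v :: 'a. \<exists>\<kappa>. left_eigenvector \<kappa> v}"
  define J where "J = complex_vector.span ?E"
  have JU: "J \<noteq> UNIV" using semisimple_if_eigenvectors_span[OF dim0] ns by (auto simp: J_def)
  have smul: "a * x \<in> J" if "x \<in> J" for a x
    using that unfolding J_def
  proof (induct rule: complex_vector.span_induct_alt)
    case base
    show ?case by (simp add: complex_vector.span_zero)
  next
    case (step c x y)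
    then obtain \<kappa> where "left_eigenvector \<kappa> x" by blast
    then have "a * (c *\<^sub>C x + y) = (c * \<kappa> a) *\<^sub>C x + a * y"
      by (simp add: distrib_left mult_scaleC_right left_eigenvector_def scaleC_scaleC)
    with step show ?case
      by (simp add: complex_vector.span_add complex_vector.span_scale complex_vector.span_base)
  qed
  have J: "left_ideal J"
    unfolding left_ideal_def using smul
    by (auto simp: J_def complex_vector.span_zero complex_vector.span_add)
  note D = left_idealD[OF J]
  obtain f where f: "f \<notin> J" "\<And>a. \<exists>c. a * f - c *\<^sub>C f \<in> J"
    using eigenvector_mod_exists[OF dim \<epsilon> J JU] by blast
  then obtain \<mu> where \<mu>: "\<And>a. a * f - \<mu> a *\<^sub>C f \<in> J" by metis
  have uniq: "\<mu> a = c" if "a * f - c *\<^sub>C f \<in> J" for a c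
  proof (rule ccontr)
    assume "\<mu> a \<noteq> c"
    have "(a * f - c *\<^sub>C f) - (a * f - \<mu> a *\<^sub>C f) = (\<mu> a - c) *\<^sub>C f"
      by (simp add: complex_vector.scale_left_diff_distrib)
    then have "(\<mu> a - c) *\<^sub>C f \<in> J" using D(5)[OF that \<mu>[of a]] by metis
    from D(4)[OF this, of "inverse (\<mu> a - c)"] \<open>\<mu> a \<noteq> c\<close> f(1) show False
      by (simp add: scaleC_scaleC scaleC_one)
  qed
  define g where "g a = a * f - \<mu> a *\<^sub>C f" for a
  have gJ: "g a \<in> J" for a using \<mu> by (simp add: g_def)
  have \<mu>_hom: "algebra_hom \<mu>"
    unfolding algebra_hom_def clinear_iff
  proof (intro conjI allI)
    show "\<mu> (x + y) = \<mu> x + \<mu> y" for x y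
      by (rule uniq) (use D(2)[OF gJ[of x] gJ[of y]] in \<open>simp add: g_def distrib_right
          scaleC_add_left algebra_simps\<close>)
    show "\<mu> (c *\<^sub>C x) = c *\<^sub>C \<mu> x" for c x
      by (rule uniq) (use D(4)[OF gJ[of x], of c] in
        \<open>simp add: g_def mult_scaleC_left complex_vector.scale_right_diff_distrib scaleC_scaleC
            scaleC_complex_def\<close>)
    show "\<mu> 1 = 1" by (rule uniq) (simp add: scaleC_one D(1))
    show "\<mu> (x * y) = \<mu> x * \<mu> y" for x y
      by (rule uniq) (use D(2)[OF D(3)[OF gJ[of y], of x] D(4)[OF gJ[of x], of "\<mu> y"]] in
        \<open>simp add: g_def right_diff_distrib mult.assoc mult_scaleC_right
            complex_vector.scale_right_diff_distrib scaleC_scaleC mult.commute[of "\<mu> y"]\<close>)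
  qed
  note \<mu>s = algebra_homD[OF \<mu>_hom]
  obtain B where B: "B \<subseteq> ?E" "complex_vector.independent B" "?E \<subseteq> complex_vector.span B"
    using complex_vector.maximal_independent_subset[of ?E] by blast
  have spanB: "complex_vector.span B = J"
    unfolding J_def using complex_vector.span_mono[OF B(1)] complex_vector.span_mono[OF B(3)]
    by (auto simp: complex_vector.span_span)
  obtain C :: "'a set" where C: "finite C" "complex_vector.span C = UNIV"
    using finite_basis_exists[OF dim0] by metis
  have fin: "finite B" using complex_vector.independent_span_bound[OF C(1) B(2)] C(2) by simp
  obtain \<kappa> where \<kappa>: "\<And>b. b \<in> B \<Longrightarrow> left_eigenvector (\<kappa> b) b"
  proof -
    have "\<forall>b\<in>B. \<exists>\<kappa>. left_eigenvector \<kappa> b" using B(1) by blast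
    from bchoice[OF this] show thesis using that by blast
  qed
  define R where "R = complex_vector.representation B"
  have Rsum: "(\<Sum>b\<in>B. R x b *\<^sub>C b) = x" if "x \<in> J" for x
    using complex_vector.sum_representation_eq[OF B(2) _ fin subset_refl, of x] that spanB by (simp
        add: R_def)
  have R_add: "R (x + y) b = R x b + R y b" if "x \<in> J" "y \<in> J" for x y b
    using complex_vector.representation_add[OF B(2)] that spanB by (simp add: R_def)
  have R_scale: "R (c *\<^sub>C x) b = c * R x b" if "x \<in> J" for x c b
    using complex_vector.representation_scale[OF B(2)] that spanB by (simp add: R_def)
  have R_coeff: "R (\<Sum>b\<in>B. u b *\<^sub>C b) b = u b" if "b \<in> B" for u b
  proof -
    let ?x = "\<Sum>b\<in>B. u b *\<^sub>C b"
    have x: "?x \<in> J" unfolding spanB[symmetric]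
      by (intro complex_vector.span_sum complex_vector.span_scale complex_vector.span_base)
    have "(\<Sum>b\<in>B. (R ?x b - u b) *\<^sub>C b) = 0"
      using Rsum[OF x] by (simp add: complex_vector.scale_left_diff_distrib sum_subtractf)
    from complex_vector.independentD[OF B(2) fin subset_refl this that] show ?thesis by simp
  qed
  have R_mult: "R (a * x) b = \<kappa> b a * R x b" if "x \<in> J" "b \<in> B" for a x b
  proof -
    have "a * x = a * (\<Sum>b\<in>B. R x b *\<^sub>C b)" using Rsum[OF that(1)] by simp
    also have "\<dots> = (\<Sum>b\<in>B. (\<kappa> b a * R x b) *\<^sub>C b)"
      unfolding sum_distrib_left
      by (rule sum.cong) (use \<kappa> in \<open>auto simp: mult_scaleC_right left_eigenvector_def scaleC_scaleC
          mult.commute\<close>)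
    finally show ?thesis using R_coeff[OF that(2)] by simp
  qed
  have \<kappa>_hom: "algebra_hom (\<kappa> b)" if "b \<in> B" for b
  proof -
    have nz: "b \<noteq> 0" and ev: "\<kappa> b a *\<^sub>C b = a * b" for a using \<kappa>[OF that] by (auto simp:
        left_eigenvector_def)
    have m: "\<kappa> b (x * y) *\<^sub>C b = (\<kappa> b x * \<kappa> b y) *\<^sub>C b" for x y
    proof -
      have "\<kappa> b (x * y) *\<^sub>C b = x * (\<kappa> b y *\<^sub>C b)" by (simp only: ev mult.assoc)
      also have "\<dots> = \<kappa> b y *\<^sub>C \<kappa> b x *\<^sub>C b" by (simp only: mult_scaleC_right ev[symmetric])
      finally show ?thesis by (simp add: scaleC_scaleC mult.commute)
    qed
    have "\<kappa> b (x + y) *\<^sub>C b = (\<kappa> b x + \<kappa> b y) *\<^sub>C b" "\<kappa> b (c *\<^sub>C x) *\<^sub>C b = (c * \<kappa> b x) *\<^sub>C b" "\<kappa> b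
        1 *\<^sub>C b = 1 *\<^sub>C b" for x y c
      by (simp_all only: ev distrib_right scaleC_add_left scaleC_scaleC[symmetric] mult_scaleC_left
          mult_1_left scaleC_one)
    note this[unfolded scaleC_cancel[OF nz]] m[unfolded scaleC_cancel[OF nz]]
    then show ?thesis by (simp add: algebra_hom_def clinear_iff scaleC_complex_def)
  qed
  have g_mult: "g (x * y) = x * g y + \<mu> y *\<^sub>C g x" for x y
    by (simp add: g_def \<mu>s right_diff_distrib mult.assoc mult_scaleC_right
        complex_vector.scale_right_diff_distrib
        scaleC_scaleC mult.commute[of "\<mu> y"])
  have g_lin: "g (x + y) = g x + g y" "g (c *\<^sub>C x) = c *\<^sub>C g x" for x y c
    by (simp_all add: g_def \<mu>s distrib_right scaleC_add_left mult_scaleC_left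
        complex_vector.scale_right_diff_distrib
        scaleC_scaleC scaleC_complex_def)
  have der: "skew_derivation (\<kappa> b) \<mu> (\<lambda>a. R (g a) b)" if "b \<in> B" for b
    unfolding skew_derivation_def clinear_iff
    by (simp add: g_lin g_mult R_add R_scale R_mult gJ D that scaleC_complex_def)
  have "\<exists>b\<in>B. \<not> inner_skew (\<kappa> b) \<mu> (\<lambda>a. R (g a) b)"
  proof (rule ccontr)
    assume "\<not> ?thesis"
    then obtain c where c: "\<And>b a. b \<in> B \<Longrightarrow> R (g a) b = c b * (\<kappa> b a - \<mu> a)"
      unfolding inner_skew_def by metis
    define s where "s = (\<Sum>b\<in>B. c b *\<^sub>C b)"
    have sJ: "s \<in> J" unfolding s_def spanB[symmetric]
      by (intro complex_vector.span_sum complex_vector.span_scale complex_vector.span_base)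
    have "a * (f - s) = \<mu> a *\<^sub>C (f - s)" for a
    proof -
      have as: "a * s = (\<Sum>b\<in>B. (c b * \<kappa> b a) *\<^sub>C b)"
        unfolding s_def sum_distrib_left
        by (rule sum.cong) (use \<kappa> in \<open>auto simp: mult_scaleC_right left_eigenvector_def scaleC_scaleC\<close>)
      have g: "g a = (\<Sum>b\<in>B. (c b * (\<kappa> b a - \<mu> a)) *\<^sub>C b)"
        by (rule trans[OF Rsum[OF gJ[of a], symmetric]], rule sum.cong) (simp_all add: c)
      have "g a = (\<Sum>b\<in>B. (c b * \<kappa> b a) *\<^sub>C b) - \<mu> a *\<^sub>C s"
        unfolding g s_def by (simp add: right_diff_distrib complex_vector.scale_left_diff_distrib
            sum_subtractf
            complex_vector.scale_sum_right scaleC_scaleC mult.commute[of "\<mu> a"])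
      then have "g a = a * s - \<mu> a *\<^sub>C s" by (simp only: as)
      then show ?thesis
        by (simp add: g_def right_diff_distrib complex_vector.scale_right_diff_distrib algebra_simps)
    qed
    moreover have "f - s \<noteq> 0" using f(1) sJ by auto
    ultimately have "left_eigenvector \<mu> (f - s)" by (simp add: left_eigenvector_def)
    then have "f - s \<in> J" unfolding J_def by (intro complex_vector.span_base) blast
    with D(2)[OF this sJ] f(1) show False by simp
  qed
  with that[OF \<kappa>_hom \<mu>_hom der] show thesis by blast
qed

section \<open>Convolution of characters and derivations\<close>

lemma skew_derivationD:
  assumes "skew_derivation \<kappa> \<mu> D"
  shows "clinear D" "D (a * b) = \<kappa> a * D b + D a * \<mu> b"
  using assms by (auto simp: skew_derivation_def)

lemma skew_derivation_shift:
  assumes "algebra_hom \<kappa>" "algebra_hom \<mu>" "skew_derivation \<kappa> \<mu> D"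
  shows "skew_derivation \<kappa> \<mu> (\<lambda>a. D a + c * (\<kappa> a - \<mu> a))"
  using skew_derivationD[OF assms(3)] algebra_homD[OF assms(1)] algebra_homD[OF assms(2)]
  by (simp add: skew_derivation_def clinear_iff scaleC_complex_def algebra_simps)

context quasi_hopf_algebra begin

definition conv :: "('a \<Rightarrow> complex) \<Rightarrow> ('a \<Rightarrow> complex) \<Rightarrow> 'a \<Rightarrow> complex"
  where "conv f h a = h (slice_left f (\<Delta> a))"

lemma conv_lin:
  assumes "clinear f" "clinear h" shows "clinear (conv f h)"
  unfolding conv_def[abs_def]
  by (rule clinear_compose[OF clinear_compose[OF \<Delta>_lin clinear_slice_left[OF assms(1)]] assms(2)])

lemma conv_counit: "conv \<epsilon> h = h" "clinear f \<Longrightarrow> conv f \<epsilon> = f"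
  by (simp_all add: conv_def[abs_def] counit_left slice_left_slice_right \<epsilon>_lin counit_right)

lemma conv_hom:
  assumes "algebra_hom f" "algebra_hom h" shows "algebra_hom (conv f h)"
  unfolding conv_def[abs_def]
  by (rule algebra_hom_compose[OF algebra_hom_compose[OF comult_hom algebra_hom_slice_left[OF
      assms(1)]] assms(2)])

lemma conv_skew:
  assumes "algebra_hom \<kappa>" "algebra_hom \<mu>" "skew_derivation \<kappa> \<mu> D" "algebra_hom \<phi>"
  shows "skew_derivation (conv \<kappa> \<phi>) (conv \<mu> \<phi>) (conv D \<phi>)"
proof -
  note d = skew_derivationD[OF assms(3)]
  have "slice_left D (\<Delta> a * \<Delta> b) =
      slice_left \<kappa> (\<Delta> a) * slice_left D (\<Delta> b) + slice_left D (\<Delta> a) * slice_left \<mu> (\<Delta> b)" for a b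
    by (rule slice_left_derivation[OF d(1) algebra_homD(1)[OF assms(1)] algebra_homD(1)[OF assms(2)] d(2)])
  then show ?thesis
    unfolding skew_derivation_def
    by (simp add: conv_lin[OF d(1) algebra_homD(1)[OF assms(4)]]) (simp add: conv_def \<Delta>_simps
        algebra_homD[OF assms(4)])
qed

text \<open>Values of a character commute, so the value at beta factors out of the antipode axioms.
  The axiom with the associator shows that it is nonzero, and cancelling it from the right antipode
  axiom leaves the convolution identity.\<close>

lemma hom_antipode:
  assumes "algebra_hom \<phi>"
  shows "algebra_hom (\<lambda>a. \<phi> (S a))" "conv \<phi> (\<lambda>a. \<phi> (S a)) = \<epsilon>"
proof -
  note f = algebra_homD[OF assms]
  show "algebra_hom (\<lambda>a. \<phi> (S a))"
    by (simp add: algebra_hom_def clinear_iff S_simps f)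
  have 1: "\<phi> (act_left p u) = \<phi> p * \<phi> (act_left 1 u)" for p u
    by (induct u rule: tensor_induct) (simp_all add: act_simps f distrib_left)
  have 2: "\<phi> (act3 p q w) = \<phi> q * (\<phi> p * \<phi> (act3 1 1 w))" for p q w
  proof (induct w rule: tensor_induct)
    case (tens x u)
    then show ?case by (simp add: act3_tens f 1[of p])
  qed (simp add: act3_simps f distrib_left)
  have "\<phi> (beta H) \<noteq> 0"
    using 2[of "alpha H" "beta H" \<Phi>] by (auto simp: act3_one f)
  moreover have "\<phi> (act_right q u) = \<phi> q * \<phi> (S (slice_left \<phi> u))" for q u
    by (induct u rule: tensor_induct) (simp_all add: act_simps f S_simps slice_left_tens
        slice_left_add scaleC_complex_def distrib_left)
  from this[of "beta H" "\<Delta> _"] have "\<epsilon> a * \<phi> (beta H) = \<phi> (beta H) * \<phi> (S (slice_left \<phi> (\<Delta> a)))" for a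
    by (simp add: act_right_def antipode_right f scaleC_complex_def)
  ultimately show "conv \<phi> (\<lambda>a. \<phi> (S a)) = \<epsilon>"
    by (simp add: conv_def fun_eq_iff mult.commute)
qed

text \<open>\<open>T = (D \<otimes> id) \<Delta>\<close> is a derivation of \<open>H\<close> with \<open>\<epsilon> T = D\<close>, hence \<open>a \<mapsto> \<Sum> \<epsilon> (T\<^sup>n a) X\<^sup>n / n!\<close> is a
  homomorphism into power series; powers of an element with \<open>D a \<noteq> 0\<close> would be independent.\<close>
lemma counit_derivation_trivial:
  assumes dim: "complex_vector.dim (UNIV :: 'a set) \<noteq> 0" and D: "skew_derivation \<epsilon> \<epsilon> D"
  shows "D a = 0"
proof (rule ccontr)
  assume "D a \<noteq> 0"
  note d = skew_derivationD[OF D]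
  define T where "T a = slice_left D (\<Delta> a)" for a
  have T_lin: "clinear T" unfolding T_def[abs_def]
    by (rule clinear_compose[OF \<Delta>_lin clinear_slice_left[OF d(1)]])
  have T_mult: "T (a * b) = a * T b + T a * b" for a b
    by (simp add: T_def \<Delta>_simps slice_left_derivation[OF d(1) \<epsilon>_lin \<epsilon>_lin d(2)] counit_left)
  have T_counit: "\<epsilon> (T a) = D a" for a
    by (simp add: T_def slice_left_slice_right[OF d(1) \<epsilon>_lin] counit_right)
  define F where "F n a = \<epsilon> ((T ^^ n) a) / fact n" for n a
  have Tn_lin: "clinear (T ^^ n)" for n
  proof (induct n)
    case 0
    show ?case by (simp add: clinear_iff)
  next
    case (Suc n)
    show ?case using clinear_compose[OF Suc T_lin] by (simp add: comp_def)
  qed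
  have F_lin: "clinear (F n)" for n
    unfolding F_def[abs_def]
    by (simp add: clinear_iff clinear_add[OF Tn_lin] clinear_scale[OF Tn_lin] \<epsilon>_simps
        add_divide_distrib scaleC_complex_def)
  have F_Suc: "of_nat (Suc n) * F (Suc n) a = F n (T a)" for n a
    by (simp only: F_def funpow_Suc_right comp_def fact_Suc) (simp add: field_simps del: of_nat_Suc)
  define E where "E a = Abs_fps (\<lambda>n. F n a)" for a
  have deriv: "fps_deriv (E a) = E (T a)" for a
    by (rule fps_ext) (simp add: E_def F_Suc[symmetric])
  have F_mult: "F n (a * b) = fps_nth (E a * E b) n" for n a b
  proof (induct n arbitrary: a b)
    case 0
    show ?case by (simp add: E_def F_def \<epsilon>_simps)
  next
    case (Suc n)
    have "of_nat (Suc n) * F (Suc n) (a * b) = F n (a * T b) + F n (T a * b)"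
      unfolding F_Suc T_mult by (rule clinear_add[OF F_lin])
    also have "\<dots> = fps_nth (fps_deriv (E a * E b)) n"
      by (simp add: Suc deriv)
    also have "\<dots> = of_nat (Suc n) * fps_nth (E a * E b) (Suc n)" by (simp only: fps_deriv_nth Suc_eq_plus1)
    finally show ?case by (simp del: of_nat_Suc)
  qed
  \<comment> \<open>Removing the scalar part kills the constant term of \<open>E b\<close> and keeps
    the linear one; then \<open>E b ^ k\<close> has order exactly \<open>k\<close> and the family of
    powers is triangular.\<close>
  define b where "b = a - \<epsilon> a *\<^sub>C 1"
  have "D 1 = 0" using d(2)[of 1 1] by (simp add: \<epsilon>_simps)
  then have "D b = D a" by (simp add: b_def clinear_diff[OF d(1)] clinear_scale[OF d(1)] scaleC_complex_def)
  have E0: "fps_nth (E b) 0 = 0" using algebra_hom_kernel_split[OF counit_hom] by (simp add: E_def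
      F_def b_def)
  have E1: "fps_nth (E b) 1 \<noteq> 0" using \<open>D a \<noteq> 0\<close> \<open>D b = D a\<close> by (simp add: E_def F_def T_counit)
  have Eb: "F n (b ^ k) = fps_nth (E b ^ k) n" for n k
  proof (induct k arbitrary: n)
    case 0
    have "(T ^^ n) 1 = (if n = 0 then 1 else 0)"
    proof (induct n)
      case (Suc n)
      have "T 1 = 0" using T_mult[of 1 1] by simp
      with Suc show ?case by (simp add: clinear_zero[OF T_lin])
    qed simp
    then show ?case by (simp add: F_def \<epsilon>_simps clinear_zero[OF \<epsilon>_lin])
  next
    case (Suc k)
    have "E (b ^ k) = E b ^ k" by (rule fps_ext) (simp only: Suc[symmetric], simp add: E_def)
    then show ?case by (simp add: F_mult)
  qed
  have "Suc (complex_vector.dim (UNIV :: 'a set)) \<le> complex_vector.dim (UNIV :: 'a set)"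
  proof (rule triangular_family_bound[where F = F and v = "\<lambda>n. b ^ n"])
    show "F i (b ^ i) \<noteq> 0" for i
      unfolding Eb using startsby_zero_power_nth_same[OF E0, of i] E1 by simp
    show "F i (b ^ j) = 0" if "i < j" for i j
      unfolding Eb using startsby_zero_power_prefix[OF E0, of j] that by simp
  qed (use dim F_lin in auto)
  then show False by simp
qed

text \<open>Without coassociativity, \<open>(D * \<phi>) * \<psi>\<close> agrees with \<open>D * (\<phi> * \<psi>) = D\<close> only up to a nonzero factor
  and an inner derivation, both coming from conjugation by \<open>\<Phi>\<close>.\<close>
lemma inner_skew_conv:
  assumes h: "algebra_hom \<kappa>" "algebra_hom \<mu>" "algebra_hom \<phi>" "algebra_hom \<psi>" and D: "skew_derivation \<kappa> \<mu> D"
    and inv: "conv \<phi> \<psi> = \<epsilon>" and inner: "inner_skew (conv \<kappa> \<phi>) (conv \<mu> \<phi>) (conv D \<phi>)"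
  shows "inner_skew \<kappa> \<mu> D"
proof -
  note d = skew_derivationD[OF D]
  \<comment> \<open>The form \<nu> \<otimes> \<phi> \<otimes> \<psi>. On the two iterated coproducts
    it yields \<nu> convolved with \<phi> * \<psi>, which is \<nu> again, and (\<nu> * \<phi>) *
    \<psi>.\<close>
  define E where "E \<nu> x = \<psi> (slice_left \<phi> (slice_left \<nu> x))" for \<nu> and x :: "'a \<otimes> 'a \<otimes> 'a"
  have E_hom: "algebra_hom (E \<nu>)" if "algebra_hom \<nu>" for \<nu>
    unfolding E_def[abs_def] by (intro algebra_hom_compose[OF _ h(4)] algebra_hom_compose[OF _
        algebra_hom_slice_left[OF h(3)]] algebra_hom_slice_left that)
  have E_D: "E D (x * y) = E \<kappa> x * E D y + E D x * E \<mu> y" for x y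
    by (simp add: E_def slice_left_derivation[OF d(1) algebra_homD(1)[OF h(1)] algebra_homD(1)[OF
        h(2)] d(2)]
       algebra_homD[OF algebra_hom_slice_left[OF h(3)]] algebra_homD[OF h(4)])
  have E2: "E \<nu> (face2 (\<Delta> a)) = \<nu> a" if "clinear \<nu>" for \<nu> a
  proof -
    have "E \<nu> (face2 (\<Delta> a)) = conv \<phi> \<psi> (slice_left \<nu> (\<Delta> a))"
      by (simp only: E_def face2_def slice_left_tensor_map[OF that clinear_id(1) \<Delta>_lin] conv_def id_apply)
    then show ?thesis by (simp add: inv slice_left_slice_right that \<epsilon>_lin counit_right)
  qed
  have E1: "E \<nu> (face1 (\<Delta> a)) = conv (conv \<nu> \<phi>) \<psi> a" if "clinear \<nu>" for \<nu> a
  proof -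
    have l: "clinear (\<lambda>w. \<phi> (slice_left \<nu> w))"
      by (rule clinear_compose[OF clinear_slice_left[OF that] algebra_homD(1)[OF h(3)]])
    have "slice_left \<phi> (slice_left \<nu> (face1 (\<Delta> a))) = slice_left (conv \<nu> \<phi>) (\<Delta> a)"
      unfolding face1_def slice_left_tensor_assoc[OF that algebra_homD(1)[OF h(3)]]
          slice_left_tensor_map[OF l \<Delta>_lin clinear_id(1)]
      by (simp add: conv_def[abs_def])
    then show ?thesis by (simp add: E_def conv_def)
  qed
  have nz: "E \<nu> \<Phi> \<noteq> 0" if "algebra_hom \<nu>" for \<nu>
    using algebra_homD(2,3)[OF E_hom[OF that]] invertible_elementD(1)[OF associator_invertible] by
        (metis mult_zero_left zero_neq_one)
  have E12: "E \<nu> (face1 (\<Delta> a)) = \<nu> a" if "algebra_hom \<nu>" for \<nu> a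
    using arg_cong[OF quasi_coassoc'[of a], of "E \<nu>"] nz[OF that]
    by (simp add: algebra_homD(3)[OF E_hom[OF that]] E2 algebra_homD(1)[OF that])
  obtain c where c: "\<And>a. conv D \<phi> a = c * (conv \<kappa> \<phi> a - conv \<mu> \<phi> a)"
    using inner by (auto simp: inner_skew_def)
  have sl: "slice_left (conv D \<phi>) u = c *\<^sub>C (slice_left (conv \<kappa> \<phi>) u - slice_left (conv \<mu> \<phi>) u)" for
      u :: "'a \<otimes> 'a"
  proof -
    have l: "clinear (conv \<kappa> \<phi>)" "clinear (conv \<mu> \<phi>)" "clinear (conv D \<phi>)"
      using h d by (simp_all add: conv_lin algebra_homD(1))
    show ?thesis
      by (induct u rule: tensor_induct)
        (simp_all add: slice_left_tens l slice_left_add, simp_all add: c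
            complex_vector.scale_right_diff_distrib scaleC_scaleC
          complex_vector.scale_left_diff_distrib right_diff_distrib scaleC_add_right)
  qed
  have "E D (face1 (\<Delta> a)) = c * (\<kappa> a - \<mu> a)" for a
  proof -
    have "E D (face1 (\<Delta> a)) = c * (E \<kappa> (face1 (\<Delta> a)) - E \<mu> (face1 (\<Delta> a)))"
      unfolding E1[OF d(1)] E1[OF algebra_homD(1)[OF h(1)]] E1[OF algebra_homD(1)[OF h(2)]]
      by (simp add: conv_def[of "conv _ _"] sl clinear_diff[OF algebra_homD(1)[OF h(4)]]
          algebra_homD[OF h(4)] scaleC_complex_def)
    then show ?thesis by (simp add: E12 h)
  qed
  \<comment> \<open>The Leibniz rule on both sides of quasi-coassociativity adds the value of
    \<open>E D\<close> at \<Phi> times a character; solving for \<open>D a\<close>, these terms join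
    the inner part.\<close>
  then have eq: "\<kappa> a * E D \<Phi> + D a * E \<mu> \<Phi> = E \<kappa> \<Phi> * (c * (\<kappa> a - \<mu> a)) + E D \<Phi> * \<mu> a" for a
    using arg_cong[OF quasi_coassoc'[of a], of "E D"] by (simp add: E_D E2 E12 h d algebra_homD(1))
  have "D a = ((E \<kappa> \<Phi> * c - E D \<Phi>) / E \<mu> \<Phi>) * (\<kappa> a - \<mu> a)" for a
    using eq[of a] nz[OF h(2)] by (simp add: field_simps)
  then show ?thesis unfolding inner_skew_def by blast
qed

text \<open>Convolution with the composite of \<kappa> and \<open>S\<close> moves \<open>D\<close>
  to the counit, where it vanishes. Zero is inner, and \<open>inner_skew_conv\<close> carries this
  back, composing once more with \<open>S\<close> giving a right convolution inverse.\<close>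

lemma self_derivation_inner:
  fixes \<kappa> D :: "'a \<Rightarrow> complex"
  assumes "complex_vector.dim (UNIV :: 'a set) \<noteq> 0" "algebra_hom \<kappa>" "skew_derivation \<kappa> \<kappa> D"
  shows "inner_skew \<kappa> \<kappa> D"
proof (rule inner_skew_conv[OF assms(2,2)])
  show "algebra_hom (\<lambda>a. \<kappa> (S a))" "algebra_hom (\<lambda>a. \<kappa> (S (S a)))" "conv (\<lambda>a. \<kappa> (S a)) (\<lambda>a. \<kappa> (S (S
      a))) = \<epsilon>"
    using hom_antipode[OF hom_antipode(1)[OF assms(2)]] hom_antipode(1)[OF assms(2)] by auto
  have "skew_derivation \<epsilon> \<epsilon> (conv D (\<lambda>a. \<kappa> (S a)))"
    using conv_skew[OF assms(2,2,3) hom_antipode(1)[OF assms(2)]] by (simp add: hom_antipode(2)[OF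
        assms(2)])
  then show "inner_skew (conv \<kappa> (\<lambda>a. \<kappa> (S a))) (conv \<kappa> (\<lambda>a. \<kappa> (S a))) (conv D (\<lambda>a. \<kappa> (S a)))"
    using counit_derivation_trivial[OF assms(1)] by (simp add: inner_skew_def)
qed (rule assms)

end

section \<open>Two characters and two derivations as a basis of the dual space\<close>

lemma characters_separated:
  fixes \<kappa> \<mu> :: "'a::complex_algebra_1 \<Rightarrow> complex"
  assumes "algebra_hom \<kappa>" "algebra_hom \<mu>" "\<kappa> \<noteq> \<mu>"
  obtains q where "\<kappa> q = 0" "\<mu> q = 1"
proof -
  obtain a where a: "\<kappa> a \<noteq> \<mu> a" using assms(3) by auto
  show thesis
    by (rule that[of "inverse (\<mu> a - \<kappa> a) *\<^sub>C (a - \<kappa> a *\<^sub>C 1)"])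
      (use a in \<open>simp_all add: algebra_homD[OF assms(1)] algebra_homD[OF assms(2)] scaleC_complex_def
        clinear_diff[OF algebra_homD(1)[OF assms(1)]] clinear_diff[OF algebra_homD(1)[OF assms(2)]]\<close>)
qed

text \<open>Sandwiching \<open>a\<close> between \<open>1 - q\<close> and \<open>q\<close> kills
  both characters and turns \<open>D\<close> into \<open>D a + D q * (\<kappa> a - \<mu> a)\<close>.
  This differs from \<open>D\<close> by an inner derivation, so it is nonzero for some
  \<open>a\<close>.\<close>

lemma outer_skew_witness:
  fixes \<kappa> \<mu> :: "'a::complex_algebra_1 \<Rightarrow> complex"
  assumes h: "algebra_hom \<kappa>" "algebra_hom \<mu>" "\<kappa> \<noteq> \<mu>" and D: "skew_derivation \<kappa> \<mu> D" "\<not> inner_skew \<kappa> \<mu> D"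
  obtains r where "\<kappa> r = 0" "\<mu> r = 0" "D r = 1"
proof -
  note k = algebra_homD[OF h(1)] and m = algebra_homD[OF h(2)] and d = skew_derivationD[OF D(1)]
  obtain q where q: "\<kappa> q = 0" "\<mu> q = 1" using characters_separated[OF h] .
  obtain a where a: "D a + D q * (\<kappa> a - \<mu> a) \<noteq> 0"
  proof (rule ccontr)
    assume "\<not> thesis"
    then have "D a + D q * (\<kappa> a - \<mu> a) = 0" for a using that by blast
    then have "D a = (- D q) * (\<kappa> a - \<mu> a)" for a by (simp add: add_eq_0_iff)
    then have "inner_skew \<kappa> \<mu> D" unfolding inner_skew_def by blast
    with D(2) show False ..
  qed
  define r where "r = (1 - q) * a * q"
  have "D 1 = 0" using d(2)[of 1 1] by (simp add: k m)
  then have r: "\<kappa> r = 0" "\<mu> r = 0" "D r = D a + D q * (\<kappa> a - \<mu> a)"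
    using q by (simp_all add: r_def k m clinear_diff[OF k(1)] clinear_diff[OF m(1)] clinear_diff[OF
        d(1)] d algebra_simps)
  show thesis
    by (rule that[of "inverse (D r) *\<^sub>C r"]) (use r a in \<open>simp_all add: k m clinear_scale[OF d(1)]
        scaleC_complex_def\<close>)
qed

text \<open>The index \<open>False\<close> stands for \<open>\<epsilon>\<close> and \<open>True\<close> for \<open>\<chi>\<close>, so that \<open>\<noteq>\<close> is the group law of \<open>{\<epsilon>, \<chi>}\<close>. The
  \<open>p i\<close> are the primitive idempotents and \<open>r i = x * p i\<close>.\<close>

locale sweedler_dual_basis =
  fixes e D :: "bool \<Rightarrow> 'a::complex_algebra_1 \<Rightarrow> complex" and p r :: "bool \<Rightarrow> 'a"
  assumes e_hom: "algebra_hom (e i)"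
    and D_skew: "skew_derivation (e (\<not> i)) (e i) (D i)"
    and e_p: "e i (p j) = (if i = j then 1 else 0)" and e_r: "e i (r j) = 0"
    and D_p: "D i (p j) = 0" and D_r: "D i (r j) = (if i = j then 1 else 0)"
    and expand: "a = (\<Sum>i\<in>UNIV. e i a *\<^sub>C p i) + (\<Sum>i\<in>UNIV. D i a *\<^sub>C r i)"

lemma skew_witness_mult:
  assumes "skew_derivation \<kappa> \<mu> D" "\<mu> r = 0" shows "D (s * r) = \<kappa> s * D r"
  using skew_derivationD(2)[OF assms(1), of s r] assms(2) by simp

context quasi_hopf_algebra begin

lemma sweedler_dual_basis_exists:
  assumes dim: "complex_vector.dim (UNIV :: 'a set) = 4" and ns: "\<not> semisimple_ring TYPE('a)"
  obtains e D p r where "sweedler_dual_basis e D (p :: bool \<Rightarrow> 'a) r" "e False = \<epsilon>" "conv (e True) (e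
      True) = \<epsilon>"
proof -
  have dim0: "complex_vector.dim (UNIV :: 'a set) \<noteq> 0" using dim by simp
  obtain \<kappa> \<mu> D :: "'a \<Rightarrow> complex" where K: "algebra_hom \<kappa>" "algebra_hom \<mu>" "skew_derivation \<kappa> \<mu> D" "\<not>
      inner_skew \<kappa> \<mu> D"
    using outer_skew_derivation_exists[OF dim counit_hom ns] .
  \<comment> \<open>A right convolution inverse of \<kappa>: translation by it makes
    \<open>D\<close> start at the counit.\<close>
  define \<phi> where "\<phi> a = \<kappa> (S a)" for a
  have \<phi>: "algebra_hom \<phi>" "conv \<kappa> \<phi> = \<epsilon>" "algebra_hom (\<lambda>a. \<phi> (S a))" "conv \<phi> (\<lambda>a. \<phi> (S a)) = \<epsilon>"
    using hom_antipode[OF K(1)] hom_antipode[OF hom_antipode(1)[OF K(1)]] by (simp_all add: \<phi>_def[abs_def])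
  define \<chi> where "\<chi> = conv \<mu> \<phi>"
  have \<chi>_hom: "algebra_hom \<chi>" unfolding \<chi>_def by (rule conv_hom[OF K(2) \<phi>(1)])
  define D1 where "D1 = conv D \<phi>"
  have D1: "skew_derivation \<epsilon> \<chi> D1"
    using conv_skew[OF K(1-3) \<phi>(1)] by (simp add: \<phi>(2) \<chi>_def D1_def)
  have D1_outer: "\<not> inner_skew \<epsilon> \<chi> D1"
    using inner_skew_conv[OF K(1,2) \<phi>(1,3) K(3) \<phi>(4)] K(4) by (auto simp: \<phi>(2) \<chi>_def D1_def)
  have \<chi>\<epsilon>: "\<epsilon> \<noteq> \<chi>"
    using self_derivation_inner[OF dim0 counit_hom, of D1] D1 D1_outer by auto
  define \<chi>2 where "\<chi>2 = conv \<chi> \<chi>"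
  have \<chi>2_hom: "algebra_hom \<chi>2" unfolding \<chi>2_def by (rule conv_hom[OF \<chi>_hom \<chi>_hom])
  define D0 where "D0 = conv D1 \<chi>"
  have D0: "skew_derivation \<chi> \<chi>2 D0"
    using conv_skew[OF counit_hom \<chi>_hom D1 \<chi>_hom] by (simp add: \<chi>2_def D0_def conv_counit)
  have D0_outer: "\<not> inner_skew \<chi> \<chi>2 D0"
    using inner_skew_conv[OF counit_hom \<chi>_hom \<chi>_hom hom_antipode(1)[OF \<chi>_hom] D1 hom_antipode(2)[OF
        \<chi>_hom]] D1_outer
    by (auto simp: \<chi>2_def D0_def conv_counit)
  have \<chi>2\<chi>: "\<chi> \<noteq> \<chi>2"
    using self_derivation_inner[OF dim0 \<chi>_hom, of D0] D0 D0_outer by auto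
  note e = algebra_homD[OF counit_hom] and x = algebra_homD[OF \<chi>_hom] and y = algebra_homD[OF \<chi>2_hom]
  note d1 = skew_derivationD[OF D1] and d0 = skew_derivationD[OF D0]
  obtain q where q: "\<epsilon> q = 0" "\<chi> q = 1" using characters_separated[OF counit_hom \<chi>_hom \<chi>\<epsilon>] .
  obtain q' where q': "\<chi> q' = 0" "\<epsilon> q' = 1" using characters_separated[OF \<chi>_hom counit_hom] \<chi>\<epsilon> by metis
  obtain r1 where r1: "\<epsilon> r1 = 0" "\<chi> r1 = 0" "D1 r1 = 1"
    using outer_skew_witness[OF counit_hom \<chi>_hom \<chi>\<epsilon> D1 D1_outer] .
  obtain r0 where r0: "\<chi> r0 = 0" "\<chi>2 r0 = 0" "D0 r0 = 1"
    using outer_skew_witness[OF \<chi>_hom \<chi>2_hom \<chi>2\<chi> D0 D0_outer] .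
  have \<chi>2_eq: "\<chi>2 = \<epsilon>"
  proof (rule ccontr)
    assume neq: "\<chi>2 \<noteq> \<epsilon>"
    obtain s where s: "\<chi>2 s = 0" "\<epsilon> s = 1" using characters_separated[OF \<chi>2_hom counit_hom neq] .
    obtain t where t: "\<epsilon> t = 0" "\<chi>2 t = 1" using characters_separated[OF counit_hom \<chi>2_hom] neq by metis
    obtain t' where t': "\<chi> t' = 0" "\<chi>2 t' = 1" using characters_separated[OF \<chi>_hom \<chi>2_hom \<chi>2\<chi>] .
    \<comment> \<open>Five forms against five vectors, made triangular by the choice of factors:
      \<open>t\<close> and \<open>t'\<close> kill \<epsilon> and \<chi>, \<open>q\<close> kills
      \<epsilon>, \<open>s\<close> kills \<open>\<chi>2\<close>, and \<open>q'\<close> kills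
      \<open>D0\<close> because a left factor enters a derivation through its first
      character.\<close>
    define F where "F i = [\<epsilon>, \<chi>, \<chi>2, D0, D1] ! i" for i
    define v where "v i = [1, q, t * t', q * r0, q' * (s * r1)] ! i" for i
    have D0r: "D0 (q * r0) = 1" by (simp add: skew_witness_mult[OF D0 r0(2)] q r0)
    have "\<chi>2 (s * r1) = 0" by (simp add: y s)
    then have D0r1: "D0 (q' * (s * r1)) = 0" by (simp add: skew_witness_mult[OF D0] q')
    have "\<chi> (s * r1) = 0" by (simp add: x r1)
    then have D1r1: "D1 (q' * (s * r1)) = 1" by (simp add: skew_witness_mult[OF D1] q' s r1)
    have le: "i < 5 \<longleftrightarrow> i = 0 \<or> i = 1 \<or> i = 2 \<or> i = 3 \<or> i = 4" for i :: nat by linarith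
    have "5 \<le> complex_vector.dim (UNIV :: 'a set)"
    proof (rule triangular_family_bound[OF dim0, of _ F v])
      show "clinear (F i)" if "i < 5" for i
        using that e(1) x(1) y(1) d0(1) d1(1) unfolding le by (auto simp: F_def)
      show "F i (v i) \<noteq> 0" if "i < 5" for i
        using that D0r D1r1 unfolding le by (auto simp: F_def v_def e x y q t t')
      show "F i (v j) = 0" if "i < j" "j < 5" for i j
        using that D0r1 unfolding le by (auto simp: F_def v_def e x y q t t' s r0 r1 q' less_Suc_eq
            numeral_eq_Suc)
    qed
    with dim show False by simp
  qed
  note D0 = D0[unfolded \<chi>2_eq] and d0 = d0[unfolded \<chi>2_eq] and r0 = r0[unfolded \<chi>2_eq]
  have one: "D0 1 = 0" "D1 1 = 0" using d0(2)[of 1 1] d1(2)[of 1 1] by (simp_all add: e x)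
  \<comment> \<open>Inner parts are removed so that both derivations vanish at \<open>q\<close>,
    hence at both \<open>p i\<close>. The left factors \<open>q'\<close> and \<open>q\<close> in
    \<open>r\<close> then make each derivation vanish on the witness of the other.\<close>
  define E0 where "E0 a = D0 a + (- D0 q) * (\<chi> a - \<epsilon> a)" for a
  define E1 where "E1 a = D1 a + D1 q * (\<epsilon> a - \<chi> a)" for a
  have E: "skew_derivation \<chi> \<epsilon> E0" "skew_derivation \<epsilon> \<chi> E1"
    using skew_derivation_shift[OF \<chi>_hom counit_hom D0] skew_derivation_shift[OF counit_hom \<chi>_hom D1]
    by (simp_all only: E0_def[abs_def] E1_def[abs_def])
  note E_lin = skew_derivationD(1)[OF E(1)] skew_derivationD(1)[OF E(2)]
  define e' where "e' i = (if i then \<chi> else \<epsilon>)" for i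
  define D' where "D' i = (if i then E1 else E0)" for i
  define p where "p i = (if i then q else 1 - q)" for i
  define r where "r i = (if i then q' * r1 else q * r0)" for i
  have rr: "E0 (q * r0) = 1" "E1 (q * r0) = 0" "E0 (q' * r1) = 0" "E1 (q' * r1) = 1"
    by (simp_all add: skew_witness_mult[OF E(1)] skew_witness_mult[OF E(2)] r0 r1 q q')
      (simp_all add: E0_def E1_def r0 r1)
  have pp: "E0 q = 0" "E1 q = 0" "E0 (1 - q) = 0" "E1 (1 - q) = 0"
    by (simp_all add: E0_def E1_def q e x one clinear_diff[OF d0(1)] clinear_diff[OF d1(1)]
        clinear_diff[OF e(1)] clinear_diff[OF x(1)])
  have dual: "e' i (p j) = (if i = j then 1 else 0)" "e' i (r j) = 0" "D' i (p j) = 0" "D' i (r j) =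
      (if i = j then 1 else 0)" for i j
    by (cases i; cases j; simp add: e'_def D'_def p_def r_def rr pp e x q q' r0 r1 clinear_diff[OF
        e(1)] clinear_diff[OF x(1)])+
  have lin: "clinear (e' i)" "clinear (D' i)" for i
    using e(1) x(1) E_lin by (auto simp: e'_def D'_def)
  have expand: "a = (\<Sum>i\<in>UNIV. e' i a *\<^sub>C p i) + (\<Sum>i\<in>UNIV. D' i a *\<^sub>C r i)" for a
  proof -
    define b where "b = a - (\<Sum>i\<in>UNIV. e' i a *\<^sub>C p i) - (\<Sum>i\<in>UNIV. D' i a *\<^sub>C r i)"
    have b: "e' i b = 0" "D' i b = 0" for i
      by (cases i; simp add: b_def clinear_diff[OF lin(1)] clinear_diff[OF lin(2)] clinear_sum[OF
          lin(1)] clinear_sum[OF lin(2)]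
          clinear_scale[OF lin(1)] clinear_scale[OF lin(2)] clinear_add[OF lin(1)] clinear_add[OF
              lin(2)] dual UNIV_bool scaleC_complex_def)+
    obtain c where c: "\<exists>i<5. c i \<noteq> (0::complex)" "(\<Sum>i<5. c i *\<^sub>C [p False, p True, r False, r True,
        b] ! i) = 0"
      using dependent_family[OF dim0, of 5 "\<lambda>i. [p False, p True, r False, r True, b] ! i"] dim by auto
    have "(\<Sum>i<5. g i) = g 0 + g 1 + g 2 + g 3 + g (4::nat)" for g :: "nat \<Rightarrow> 'a"
      by (simp add: eval_nat_numeral)
    note c2 = c(2)[unfolded this, simplified]
    have "e' i 0 = 0" "D' i 0 = 0" for i using clinear_zero[OF lin(1)] clinear_zero[OF lin(2)] by auto
    note z = clinear_add[OF lin(1)] clinear_add[OF lin(2)] clinear_scale[OF lin(1)] clinear_scale[OF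
        lin(2)] dual b scaleC_complex_def this
    have "c 0 = 0" "c 1 = 0" "c 2 = 0" "c 3 = 0"
      using arg_cong[OF c2, of "e' False"] arg_cong[OF c2, of "e' True"] arg_cong[OF c2, of "D'
          False"] arg_cong[OF c2, of "D' True"]
      by (simp_all add: z)
    moreover have "i = 0 \<or> i = 1 \<or> i = 2 \<or> i = 3 \<or> i = 4" if "i < 5" for i :: nat using that by linarith
    ultimately have "c 4 \<noteq> 0" "c 4 *\<^sub>C b = 0" using c(1) c2 by auto
    then have "b = 0" by simp
    then show ?thesis by (simp add: b_def algebra_simps)
  qed
  show thesis
  proof (rule that)
    show "sweedler_dual_basis e' D' p r"
    proof
      show "algebra_hom (e' i)" for i using counit_hom \<chi>_hom by (simp add: e'_def)
      show "skew_derivation (e' (\<not> i)) (e' i) (D' i)" for i using E by (simp add: e'_def D'_def)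
    qed (fact dual expand)+
    show "e' False = \<epsilon>" "conv (e' True) (e' True) = \<epsilon>" using \<chi>2_eq by (simp_all add: e'_def \<chi>2_def)
  qed
qed

end

section \<open>Normalising the coproduct\<close>

lemma invertible_element_leftright:
  fixes x :: "'a::ring_1"
  assumes "a * x = 1" "x * b = 1" shows "invertible_element x"
proof -
  have "a = b" using mult_cancel_left_inverse[OF assms(1), of b] by (simp add: assms(2))
  then show ?thesis using assms by (auto intro: invertible_elementI)
qed

abbreviation (input) sgn_of :: "bool \<Rightarrow> complex" where "sgn_of i \<equiv> (if i then - 1 else 1)"

context sweedler_dual_basis begin

section \<open>Coefficients with respect to the four forms\<close>

lemmas e_lin = algebra_homD(1)[OF e_hom] and D_lin = skew_derivationD(1)[OF D_skew]
lemmas e_mult = algebra_homD(3)[OF e_hom] and D_mult = skew_derivationD(2)[OF D_skew]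
lemmas e_1 = algebra_homD(2)[OF e_hom]

lemma D_1: "D i 1 = 0"
  using D_mult[of i 1 1] by (simp add: e_1)

lemmas ev_simps = e_mult D_mult e_1 D_1 e_p e_r D_p D_r
  clinear_add[OF e_lin] clinear_add[OF D_lin] clinear_diff[OF e_lin] clinear_diff[OF D_lin]
  clinear_neg[OF e_lin] clinear_neg[OF D_lin] clinear_scale[OF e_lin] clinear_scale[OF D_lin]
  clinear_zero[OF e_lin] clinear_zero[OF D_lin] scaleC_complex_def

lemmas sl_lin = clinear_slice_left[OF e_lin] clinear_slice_left[OF D_lin]

lemma sl_e_mult: "slice_left (e i) (u * v) = slice_left (e i) u * slice_left (e i) v"
  by (rule slice_left_hom[OF e_hom])

lemma sl_D_mult: "slice_left (D i) (u * v) = slice_left (e (\<not> i)) u * slice_left (D i) v +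
    slice_left (D i) u * slice_left (e i) v"
  by (rule slice_left_derivation[OF D_lin e_lin e_lin D_mult])

lemma sl_1: "slice_left (e i) 1 = 1" "slice_left (D i) 1 = 0"
  by (simp_all add: one_tensor_def slice_left_tens e_lin D_lin e_1 D_1 scaleC_one)

lemmas sl_simps = sl_e_mult sl_D_mult sl_1 slice_left_tens[OF e_lin] slice_left_tens[OF D_lin]
  clinear_add[OF sl_lin(1)] clinear_add[OF sl_lin(2)] clinear_diff[OF sl_lin(1)] clinear_diff[OF sl_lin(2)]
  clinear_neg[OF sl_lin(1)] clinear_neg[OF sl_lin(2)] clinear_scale[OF sl_lin(1)] clinear_scale[OF
      sl_lin(2)]
  clinear_zero[OF sl_lin(1)] clinear_zero[OF sl_lin(2)]

lemma ev_eqI: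
  assumes "\<And>i. e i a = e i b" "\<And>i. D i a = D i b" shows "a = b"
  by (subst expand[of a], subst expand[of b]) (simp add: assms)

lemma tensor_expand: "t = (\<Sum>i\<in>UNIV. p i \<otimes>\<^sub>t slice_left (e i) t) + (\<Sum>i\<in>UNIV. r i \<otimes>\<^sub>t slice_left (D i) t)"
proof (induct t rule: tensor_induct)
  case (tens a b)
  have "a \<otimes>\<^sub>t b = ((\<Sum>i\<in>UNIV. e i a *\<^sub>C p i) + (\<Sum>i\<in>UNIV. D i a *\<^sub>C r i)) \<otimes>\<^sub>t b"
    by (rule arg_cong[where f = "\<lambda>a. a \<otimes>\<^sub>t b", OF expand])
  then show ?case by (simp add: UNIV_bool tens_linear sl_simps e_p e_r D_p D_r)
next
  case (add s t)
  have "s + t = (\<Sum>i\<in>UNIV. p i \<otimes>\<^sub>t slice_left (e i) s) + (\<Sum>i\<in>UNIV. r i \<otimes>\<^sub>t slice_left (D i) s) +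
    ((\<Sum>i\<in>UNIV. p i \<otimes>\<^sub>t slice_left (e i) t) + (\<Sum>i\<in>UNIV. r i \<otimes>\<^sub>t slice_left (D i) t))"
    by (rule arg_cong2[where f = "(+)", OF add])
  also have "\<dots> = (\<Sum>i\<in>UNIV. p i \<otimes>\<^sub>t slice_left (e i) (s + t)) + (\<Sum>i\<in>UNIV. r i \<otimes>\<^sub>t slice_left (D i) (s + t))"
    by (simp add: UNIV_bool tens_linear sl_simps)
  finally show ?case .
qed

lemma sl_eqI:
  assumes "\<And>i. slice_left (e i) u = slice_left (e i) v" "\<And>i. slice_left (D i) u = slice_left (D i)
      v" shows "u = v"
  by (subst tensor_expand[of u], subst tensor_expand[of v]) (simp add: assms)

definition g where "g = p False - p True"
definition x where "x = r False + r True"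

lemma ev_g: "e i g = sgn_of i" "D i g = 0" and ev_x: "e i x = 0" "D i x = 1"
  by (cases i; simp add: g_def x_def ev_simps)+

text \<open>\<open>D i\<close> passes between two characters that give \<open>g\<close> opposite
  signs, hence the anticommutation. For the square, both Leibniz terms contain the value of a
  character at \<open>x\<close>, which is 0.\<close>

lemma gx: "g * g = 1" "x * x = 0" "g * x = - (x * g)"
  by (rule ev_eqI; simp add: ev_simps ev_g ev_x)+

lemma pr: "p i = (1 / 2) *\<^sub>C (1 + sgn_of i *\<^sub>C g)" "r i = x * p i"
proof -
  show "p i = (1 / 2) *\<^sub>C (1 + sgn_of i *\<^sub>C g)"
    by (rule ev_eqI) (auto simp add: ev_simps ev_g)
  show "r i = x * p i"
    by (rule ev_eqI) (auto simp add: ev_simps ev_x)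
qed

end

locale sweedler_quasi_hopf = quasi_hopf_algebra H + sweedler_dual_basis e D p r
  for H :: "'a::complex_algebra_1 quasi_hopf" and e D :: "bool \<Rightarrow> 'a \<Rightarrow> complex" and p r :: "bool \<Rightarrow> 'a" +
  assumes e_counit: "e False = counit H"
    and e_True_square: "e True (slice_left (e True) (comult H a)) = counit H a"
begin

lemma conv_e: "e j (slice_left (e i) (\<Delta> a)) = e (i \<noteq> j) a"
  by (cases i; cases j; simp add: e_counit e_True_square counit_left slice_left_slice_right[OF e_lin
      \<epsilon>_lin] counit_right)

text \<open>Only the convolution square of \<open>e True\<close> needs checking: conjugation
  multiplies it by the values of \<open>J\<close> and of its inverse at a pair of characters, and
  these cancel.\<close>

lemma twist_sweedler:
  assumes "invertible_element J" "slice_left \<epsilon> J = 1" "slice_right \<epsilon> J = 1"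
  shows "sweedler_quasi_hopf (twist J H) e D p r"
proof -
  interpret tw: twisted_quasi_hopf H J by unfold_locales (use assms in auto)
  interpret T: quasi_hopf_algebra "twist J H" by (rule tw.quasi_hopf_algebra_twist)
  have 1: "e True (slice_left (e True) J) * e True (slice_left (e True) (inverse_element J)) = 1"
    by (simp only: e_mult[symmetric] sl_e_mult[symmetric] tw.JK sl_1 e_1)
  show ?thesis
  proof
    show "e False = counit (twist J H)" by (simp add: tw.T_simps e_counit)
    show "e True (slice_left (e True) (comult (twist J H) a)) = counit (twist J H) a" for a
      using 1 by (simp add: tw.T_simps sl_e_mult e_mult e_True_square)
  qed
qed

text \<open>\<open>(1 + s d) / 2\<close> intertwines the involutions \<open>d = \<Delta> g\<close> and \<open>s = g \<otimes> g\<close>; it is invertible since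
  \<open>d - s\<close> is nilpotent.\<close>

lemma grouplike_twist_exists:
  obtains J where "invertible_element J" "slice_left \<epsilon> J = 1" "slice_right \<epsilon> J = 1"
    "comult (twist J H) g = g \<otimes>\<^sub>t g"
proof -
  define s where "s = g \<otimes>\<^sub>t g"
  define d where "d = \<Delta> g"
  have ss: "s * s = 1" by (simp add: s_def tens_mult gx one_tensor_def)
  have dd: "d * d = 1" by (simp add: d_def \<Delta>_simps(2)[symmetric] gx) (simp add: \<Delta>_simps)
  note c = ss[THEN mult_cancel_left_inverse] dd[THEN mult_cancel_left_inverse] ss dd
  define \<rho> where "\<rho> = d - s"
  have \<rho>: "e j (slice_left (e i) \<rho>) = 0" for i j
    by (cases i; cases j; simp add: \<rho>_def sl_simps ev_simps ev_g conv_e s_def d_def)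
  \<comment> \<open>\<rho> vanishes on all pairs of characters, so its degree in \<open>x\<close> is
    positive, while degrees in the tensor square stop at 2.\<close>
  have \<rho>4: "(\<rho> * \<rho>) * (\<rho> * \<rho>) = 0"
    by (rule sl_eqI; rule ev_eqI; simp add: sl_simps ev_simps \<rho>)
  \<comment> \<open>The factor makes \<open>1 + m\<close> the product of \<open>J\<close> and
    \<open>K\<close> in either order.\<close>
  define m where "m = (- 1 / 4) *\<^sub>C (\<rho> * \<rho>)"
  have mm: "m * m = 0" by (simp add: m_def mult_scaleC_left mult_scaleC_right \<rho>4)
  define J where "J = (1 / 2) *\<^sub>C (1 + s * d)"
  define K where "K = (1 / 2) *\<^sub>C (1 + d * s)"
  have four: "(4::complex) *\<^sub>C y = y + y + y + y" for y :: "'a \<otimes> 'a"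
  proof -
    have "(4::complex) = 1 + 1 + 1 + 1" by simp
    then show ?thesis by (simp only: scaleC_add_left scaleC_one)
  qed
  have "\<rho> * \<rho> = 1 + 1 - d * s - s * d"
    by (simp add: \<rho>_def left_diff_distrib right_diff_distrib ss dd)
  moreover have "1 + m = (1 / 4) *\<^sub>C (4 *\<^sub>C 1 - \<rho> * \<rho>)"
    by (simp add: m_def complex_vector.scale_right_diff_distrib scaleC_scaleC scaleC_one)
  moreover have "4 *\<^sub>C 1 - (1 + 1 - d * s - s * d) = 1 + 1 + d * s + s * d"
    by (simp only: four) simp
  ultimately have m_eq: "1 + m = (1 / 4) *\<^sub>C (1 + 1 + d * s + s * d)"
    by (simp only:)
  have two: "c *\<^sub>C (2 :: 'a \<otimes> 'a) = c *\<^sub>C 1 + c *\<^sub>C 1" for c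
    unfolding scaleC_add_right[symmetric] by simp
  have KJ: "K * J = 1 + m" "J * K = 1 + m"
    unfolding m_eq
    by (simp_all add: J_def K_def mult_scaleC_left mult_scaleC_right scaleC_scaleC distrib_left
        distrib_right mult.assoc c)
      (simp_all add: algebra_simps two)
  have inv: "invertible_element J"
  proof (rule invertible_element_leftright)
    have "(1 - m) * (1 + m) = 1" "(1 + m) * (1 - m) = 1"
      by (simp_all add: algebra_simps mm)
    then show "((1 - m) * K) * J = 1" "J * (K * (1 - m)) = 1"
      by (simp_all add: mult.assoc KJ) (simp_all add: mult.assoc[symmetric] KJ)
  qed
  have sJ: "J * d = s * J"
    by (simp add: J_def mult_scaleC_left mult_scaleC_right distrib_left distrib_right mult.assoc c
        add.commute)
  have half: "(1 / 2) *\<^sub>C 2 = (1::'a)"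
    unfolding one_add_one[where 'a = 'a, symmetric] scaleC_add_right scaleC_add_left[symmetric]
    by (simp add: scaleC_one)
  have \<epsilon>g: "\<epsilon> g = 1" using ev_g(1)[of False] by (simp add: e_counit)
  have l: "slice_left \<epsilon> J = 1" "slice_right \<epsilon> J = 1"
    by (simp_all add: J_def s_def d_def algebra_homD[OF algebra_hom_slice_left[OF counit_hom]]
        algebra_homD[OF algebra_hom_slice_right[OF counit_hom]]
      slice_left_tens slice_right_tens \<epsilon>_lin \<epsilon>g counit_left counit_right gx scaleC_one half)
  have "comult (twist J H) g = s * (J * inverse_element J)"
    by (simp add: twist_def mult.assoc[symmetric] sJ[symmetric] d_def)
  then have "comult (twist J H) g = g \<otimes>\<^sub>t g" by (simp add: invertible_elementD[OF inv] s_def)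
  with inv l that show thesis by blast
qed

text \<open>Anticommutation with \<open>g \<otimes>\<^sub>t g\<close> leaves only coefficients of
  degree 1, the counit axioms fix half of them, and \<open>x * x = 0\<close> expresses the others by
  one nonzero number \<open>t\<close>. A twist diagonal in the idempotents rescales these
  coefficients and can absorb \<open>t\<close>.\<close>

lemma sweedler_comult_twist_exists:
  assumes g_grouplike: "\<Delta> g = g \<otimes>\<^sub>t g"
  obtains J where "invertible_element J" "slice_left \<epsilon> J = 1" "slice_right \<epsilon> J = 1"
    "comult (twist J H) g = g \<otimes>\<^sub>t g" "comult (twist J H) x = x \<otimes>\<^sub>t 1 + g \<otimes>\<^sub>t x"
proof -
  define X where "X = \<Delta> x"
  define s where "s = g \<otimes>\<^sub>t g"
  have s: "e j (slice_left (e i) s) = sgn_of i * sgn_of j" "slice_left (D i) s = 0" "D j (slice_left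
      (e i) s) = 0" for i j
    by (simp_all add: s_def sl_simps ev_simps ev_g)
  have anti: "s * X = - (X * s)"
    unfolding s_def X_def g_grouplike[symmetric] \<Delta>_simps[symmetric] gx by (rule clinear_neg[OF \<Delta>_lin])
  have even: "e j (slice_left (e i) X) = 0" "D j (slice_left (D i) X) = 0" for i j
    using arg_cong[OF anti, of "\<lambda>u. e j (slice_left (e i) u)"] arg_cong[OF anti, of "\<lambda>u. D j
        (slice_left (D i) u)"]
    by (auto simp: sl_simps ev_simps s split: if_splits)
  define F where "F i j = e j (slice_left (D i) X)" for i j
  define G where "G i j = D j (slice_left (e i) X)" for i j
  have F0: "F i False = 1" for i
    by (simp add: F_def X_def e_counit slice_left_slice_right[OF D_lin \<epsilon>_lin] counit_right ev_x)
  have G0: "G False i = 1" for i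
    by (simp add: G_def X_def e_counit counit_left ev_x)
  have "X * X = 0" by (simp add: X_def \<Delta>_simps(2)[symmetric] gx clinear_zero[OF \<Delta>_lin])
  from arg_cong[OF this, of "\<lambda>u. D _ (slice_left (D _) u)"]
  have FG: "G (\<not> i) j * F i j + F i (\<not> j) * G i j = 0" for i j
    by (simp add: sl_simps ev_simps even F_def G_def algebra_simps)
  define t where "t = F False True"
  have G10: "G True False = - t" and t0: "t \<noteq> 0" and G11: "G True True = - 1 / t" and F11: "F True
      True = 1 / t"
  proof -
    show "G True False = - t" using FG[of False False] by (simp add: F0 G0 t_def add_eq_0_iff)
    have *: "G True True * t = - 1" using FG[of False True] by (simp add: F0 G0 t_def add_eq_0_iff2)
    then show t0: "t \<noteq> 0" by auto
    with * show "G True True = - 1 / t" by (simp add: field_simps)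
    then show "F True True = 1 / t" using FG[of True True] by (simp add: F0 G0 add_eq_0_iff)
  qed
  \<comment> \<open>Normalisation fixes the weight 1 at every pair of idempotents but the last;
    comparing the coefficient \<open>F False True\<close> with its target value 1 forces
    \<open>1 / t\<close> there.\<close>
  define J where "J = 1 + (1 / t - 1) *\<^sub>C (p True \<otimes>\<^sub>t p True)"
  define K where "K = 1 + (t - 1) *\<^sub>C (p True \<otimes>\<^sub>t p True)"
  have Je: "e j (slice_left (e i) J) = (if i \<and> j then 1 / t else 1)" "slice_left (D i) J = 0" "D j
      (slice_left (e i) J) = 0" for i j
    by (cases i; cases j; simp add: J_def sl_simps ev_simps)+
  have Ke: "e j (slice_left (e i) K) = (if i \<and> j then t else 1)" "slice_left (D i) K = 0" "D j
      (slice_left (e i) K) = 0" for i j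
    by (cases i; cases j; simp add: K_def sl_simps ev_simps)+
  have JK: "J * K = 1" "K * J = 1"
    by (rule sl_eqI; rule ev_eqI; simp add: sl_simps ev_simps Je Ke t0)+
  have inv: "invertible_element J" by (rule invertible_elementI[OF JK])
  note JK = invertible_elementD[OF inv]
  have "\<epsilon> (p True) = 0" using e_p[of False True] by (simp add: e_counit)
  then have l: "slice_left \<epsilon> J = 1" "slice_right \<epsilon> J = 1"
    by (simp_all add: J_def algebra_homD[OF algebra_hom_slice_left[OF counit_hom]] algebra_homD[OF
        algebra_hom_slice_right[OF counit_hom]]
      slice_left_tens slice_right_tens \<epsilon>_lin)
  have "J * s = s * J"
    by (rule sl_eqI; rule ev_eqI; simp add: sl_simps ev_simps Je s)
  then have "comult (twist J H) g = s * (J * inverse_element J)"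
    by (simp add: twist_def g_grouplike s_def mult.assoc[symmetric])
  then have g': "comult (twist J H) g = g \<otimes>\<^sub>t g" by (simp add: JK s_def)
  have "J * X = (x \<otimes>\<^sub>t 1 + g \<otimes>\<^sub>t x) * J"
  proof (rule sl_eqI; rule ev_eqI)
    fix i j
    show "e j (slice_left (e i) (J * X)) = e j (slice_left (e i) ((x \<otimes>\<^sub>t 1 + g \<otimes>\<^sub>t x) * J))"
      by (simp add: sl_simps ev_simps Je even ev_x ev_g)
    show "D j (slice_left (e i) (J * X)) = D j (slice_left (e i) ((x \<otimes>\<^sub>t 1 + g \<otimes>\<^sub>t x) * J))"
      by (cases i; cases j; simp add: sl_simps ev_simps Je even ev_x ev_g G_def[symmetric] G0 G10 G11 t0)
    show "e j (slice_left (D i) (J * X)) = e j (slice_left (D i) ((x \<otimes>\<^sub>t 1 + g \<otimes>\<^sub>t x) * J))"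
      by (cases i; cases j; simp add: sl_simps ev_simps Je even ev_x ev_g F_def[symmetric] F0 F11
          t_def[symmetric] t0)
    show "D j (slice_left (D i) (J * X)) = D j (slice_left (D i) ((x \<otimes>\<^sub>t 1 + g \<otimes>\<^sub>t x) * J))"
      by (simp add: sl_simps ev_simps Je even ev_x ev_g)
  qed
  then have "comult (twist J H) x = (x \<otimes>\<^sub>t 1 + g \<otimes>\<^sub>t x) * (J * inverse_element J)"
    by (simp add: twist_def X_def mult.assoc[symmetric])
  then have x': "comult (twist J H) x = x \<otimes>\<^sub>t 1 + g \<otimes>\<^sub>t x" by (simp add: JK)
  show thesis by (rule that[OF inv l g' x'])
qed

end

section \<open>Trivialising the associator\<close>

locale sweedler_comult = sweedler_quasi_hopf +
  assumes \<Delta>_g: "comult H g = g \<otimes>\<^sub>t g" and \<Delta>_x: "comult H x = x \<otimes>\<^sub>t 1 + g \<otimes>\<^sub>t x"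
begin

lemma \<Delta>_pr: "\<Delta> (p i) = (1 / 2) *\<^sub>C (1 + sgn_of i *\<^sub>C (g \<otimes>\<^sub>t g))" "\<Delta> (r i) = (x \<otimes>\<^sub>t 1 + g \<otimes>\<^sub>t x) * \<Delta> (p i)"
  by (simp_all only: pr(2) \<Delta>_simps \<Delta>_x pr(1)[of i] \<Delta>_g)

lemma functional_expand:
  assumes "clinear L"
  shows "L a = (\<Sum>i\<in>UNIV. e i a *\<^sub>C L (p i)) + (\<Sum>i\<in>UNIV. D i a *\<^sub>C L (r i))"
  by (subst expand[of a]) (simp only: clinear_add[OF assms] clinear_sum[OF assms] clinear_scale[OF assms])

text \<open>The convolution table of the dual space, checked on the basis \<open>p\<close>,
  \<open>r\<close>. The sign comes from the \<open>g\<close> in front of \<open>x\<close> in the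
  coproduct of \<open>x\<close>; derivations convolve to 0 because no basis element has a coproduct
  with a term of degree 2.\<close>

lemma conv_table:
  "e j (slice_left (D i) (\<Delta> a)) = D (i \<noteq> j) a"
  "D j (slice_left (e i) (\<Delta> a)) = sgn_of i * D (i \<noteq> j) a"
  "D j (slice_left (D i) (\<Delta> a)) = 0"
proof -
  note l = clinear_compose[OF clinear_compose[OF \<Delta>_lin sl_lin(1)] e_lin] clinear_compose[OF
      clinear_compose[OF \<Delta>_lin sl_lin(1)] D_lin]
    clinear_compose[OF clinear_compose[OF \<Delta>_lin sl_lin(2)] e_lin] clinear_compose[OF
        clinear_compose[OF \<Delta>_lin sl_lin(2)] D_lin]
  note simps = UNIV_bool \<Delta>_pr sl_simps ev_simps ev_g ev_x
  show "e j (slice_left (D i) (\<Delta> a)) = D (i \<noteq> j) a"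
    by (subst functional_expand[OF l(3)]) (cases i; cases j; simp add: simps)
  show "D j (slice_left (e i) (\<Delta> a)) = sgn_of i * D (i \<noteq> j) a"
    by (subst functional_expand[OF l(2)]) (cases i; cases j; simp add: simps)
  show "D j (slice_left (D i) (\<Delta> a)) = 0"
    by (subst functional_expand[OF l(4)]) (cases i; cases j; simp add: simps)
qed

text \<open>Slices of a coproduct are convolutions, so the tables apply. The free type of the second
  factor lets one statement serve both \<open>face1\<close> and \<open>face31\<close>.\<close>

lemma sl_assoc_comult:
  fixes u :: "'a \<otimes> 'b::complex_vector"
  shows
  "slice_left (e j) (slice_left (e i) (tensor_assoc (tensor_map \<Delta> id u))) = slice_left (e (i \<noteq> j)) u"
  "slice_left (e j) (slice_left (D i) (tensor_assoc (tensor_map \<Delta> id u))) = slice_left (D (i \<noteq> j)) u"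
  "slice_left (D j) (slice_left (e i) (tensor_assoc (tensor_map \<Delta> id u))) = sgn_of i *\<^sub>C slice_left
      (D (i \<noteq> j)) u"
  "slice_left (D j) (slice_left (D i) (tensor_assoc (tensor_map \<Delta> id u))) = 0"
proof -
  have gen: "slice_left h (slice_left f (tensor_assoc (tensor_map \<Delta> id u))) = slice_left (\<lambda>y. h
      (slice_left f (\<Delta> y))) u"
    if "clinear f" "clinear h" for f h
    unfolding slice_left_tensor_assoc[OF that]
      slice_left_tensor_map[OF clinear_compose[OF clinear_slice_left[OF that(1)] that(2)] \<Delta>_lin
          clinear_id(1)]
    by simp
  have sc: "slice_left (\<lambda>y. c * f y) u = c *\<^sub>C slice_left f u" if "clinear f" for c f
  proof -
    have l: "clinear (\<lambda>y. c * f y)" using that by (simp add: clinear_iff scaleC_complex_def algebra_simps)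
    show ?thesis
      by (induct u rule: tensor_induct)
        (simp_all add: slice_left_tens that l slice_left_add scaleC_add_right scaleC_scaleC)
  qed
  have z: "slice_left (\<lambda>y. 0) u = 0"
    using sc[OF e_lin[of False], of 0] by simp
  show "slice_left (e j) (slice_left (e i) (tensor_assoc (tensor_map \<Delta> id u))) = slice_left (e (i \<noteq> j)) u"
    "slice_left (e j) (slice_left (D i) (tensor_assoc (tensor_map \<Delta> id u))) = slice_left (D (i \<noteq> j)) u"
    "slice_left (D j) (slice_left (e i) (tensor_assoc (tensor_map \<Delta> id u))) = sgn_of i *\<^sub>C
        slice_left (D (i \<noteq> j)) u"
    "slice_left (D j) (slice_left (D i) (tensor_assoc (tensor_map \<Delta> id u))) = 0"
    by (simp_all only: gen e_lin D_lin conv_e conv_table sc z)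
qed

lemmas sl_face1 = sl_assoc_comult[where 'b = 'a, folded face1_def]
  and sl_face31 = sl_assoc_comult[where 'b = "'a \<otimes> 'a", folded face31_def]

lemma sl_face2: "slice_left (e i) (face2 u) = \<Delta> (slice_left (e i) u)" "slice_left (D i) (face2 u) =
    \<Delta> (slice_left (D i) u)"
  unfolding face2_def by (simp_all add: slice_left_tensor_map e_lin D_lin clinear_id \<Delta>_lin)

lemma sl_face32: "slice_left (e i) (face32 w) = face1 (slice_left (e i) w)" "slice_left (D i)
    (face32 w) = face1 (slice_left (D i) w)"
  by (rule clinear_comp_tensor_eqI[OF sl_lin(1) face_lin(5) face_lin(1) sl_lin(1)], simp add:
      face_tens sl_simps clinear_scale[OF face_lin(1)],
      rule clinear_comp_tensor_eqI[OF sl_lin(2) face_lin(5) face_lin(1) sl_lin(2)], simp add: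
          face_tens sl_simps clinear_scale[OF face_lin(1)])

lemma sl_face33: "slice_left (e i) (face33 w) = face2 (slice_left (e i) w)" "slice_left (D i)
    (face33 w) = face2 (slice_left (D i) w)"
  by (rule clinear_comp_tensor_eqI[OF sl_lin(1) face_lin(6) face_lin(2) sl_lin(1)], simp add:
      face_tens sl_simps clinear_scale[OF face_lin(2)],
      rule clinear_comp_tensor_eqI[OF sl_lin(2) face_lin(6) face_lin(2) sl_lin(2)], simp add:
          face_tens sl_simps clinear_scale[OF face_lin(2)])

lemma sl_face34: "slice_left (e i) (face34 w) = face3 (slice_left (e i) w)" "slice_left (D i)
    (face34 w) = face3 (slice_left (D i) w)"
  by (rule clinear_comp_tensor_eqI[OF sl_lin(1) face_lin(7) face_lin(3) sl_lin(1)], simp add: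
      face_tens sl_simps clinear_scale[OF face_lin(3)],
      rule clinear_comp_tensor_eqI[OF sl_lin(2) face_lin(7) face_lin(3) sl_lin(2)], simp add:
          face_tens sl_simps clinear_scale[OF face_lin(3)])

lemma sl_face3:
  assumes "clinear f" "clinear h"
  shows "slice_left h (slice_left f (face3 u)) = h (slice_left f u) *\<^sub>C 1"
  unfolding face3_def slice_left_tensor_assoc[OF assms]
  by (simp add: slice_left_tens clinear_compose[OF clinear_slice_left[OF assms(1)] assms(2)])

lemmas sl_face3' = sl_face3[OF e_lin e_lin] sl_face3[OF e_lin D_lin] sl_face3[OF D_lin e_lin]
    sl_face3[OF D_lin D_lin]

lemmas coeff_simps = sl_simps ev_simps conv_e conv_table sl_face1 sl_face2 sl_face31 sl_face32
    sl_face33 sl_face34 sl_face3'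
  scaleC_one

text \<open>The counit axiom covers the middle index \<open>False\<close>. Intertwining the iterated
  coproducts of \<open>x\<close>, read off at \<open>D False\<close> in the middle slot, equates the
  coefficients for the two middle indices; this is where the nontrivial 3-cocycle is
  excluded.\<close>

lemma \<Phi>_eee: "e k (slice_left (e j) (slice_left (e i) \<Phi>)) = 1"
proof -
  have l: "clinear (slice_left (e False) :: 'a \<otimes> 'a \<Rightarrow> 'a)" by (rule sl_lin(1))
  have "e k (slice_left (e i) (tensor_map id (slice_left (e False)) \<Phi>)) = 1"
    using associator_counit by (simp add: e_counit coeff_simps)
  then have F: "e k (slice_left (e False) (slice_left (e i) \<Phi>)) = 1"
    by (simp add: slice_left_tensor_map[OF e_lin clinear_id(1) l])
  have "e k (slice_left (e True) (slice_left (e i) \<Phi>)) = e k (slice_left (e False) (slice_left (e i) \<Phi>))"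
    using arg_cong[OF quasi_coassoc'[of x], of "\<lambda>w. e k (slice_left (D False) (slice_left (e i) w))"]
    by (cases i) (simp_all add: coeff_simps ev_x)
  with F show ?thesis by (cases j) simp_all
qed

text \<open>Multiplying by the iterated coproduct of \<open>g\<close> on the left and on the right
  gives an odd coefficient opposite signs, so it equals its own negative.\<close>

lemma \<Phi>_odd:
  "D k (slice_left (e j) (slice_left (e i) \<Phi>)) = 0" "e k (slice_left (D j) (slice_left (e i) \<Phi>)) = 0"
  "e k (slice_left (e j) (slice_left (D i) \<Phi>)) = 0" "D k (slice_left (D j) (slice_left (D i) \<Phi>)) = 0"
  using arg_cong[OF quasi_coassoc'[of g], of "\<lambda>w. D k (slice_left (e j) (slice_left (e i) w))"]
    arg_cong[OF quasi_coassoc'[of g], of "\<lambda>w. e k (slice_left (D j) (slice_left (e i) w))"]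
    arg_cong[OF quasi_coassoc'[of g], of "\<lambda>w. e k (slice_left (e j) (slice_left (D i) w))"]
    arg_cong[OF quasi_coassoc'[of g], of "\<lambda>w. D k (slice_left (D j) (slice_left (D i) w))"]
  by (cases i; cases j; cases k; simp add: coeff_simps ev_g)+

definition P where "P i j k = e k (slice_left (D j) (slice_left (D i) \<Phi>))"
definition Q where "Q i j k = D k (slice_left (e j) (slice_left (D i) \<Phi>))"
definition N where "N i j k = D k (slice_left (D j) (slice_left (e i) \<Phi>))"

lemmas \<Phi>_simps = \<Phi>_eee \<Phi>_odd P_def[symmetric] Q_def[symmetric] N_def[symmetric]

text \<open>The coefficients of the pentagon equation at two odd and two even slots. In each product exactly
  one factor can contribute its degree \<open>2\<close> part, so the equations are linear.\<close>

lemma coeff_pentagon: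
  "P a b (c \<noteq> d) = P a (b \<noteq> c) d + P a b c"
  "Q a b (c \<noteq> d) + P (a \<noteq> b) c d = sgn_of b * P a (b \<noteq> c) d + Q a b c"
  "sgn_of c * Q a b (c \<noteq> d) + Q (a \<noteq> b) c d = Q a (b \<noteq> c) d"
  "N a b (c \<noteq> d) + sgn_of a * P (a \<noteq> b) c d = P b c d + N a b c"
  "sgn_of c * N a b (c \<noteq> d) + sgn_of a * Q (a \<noteq> b) c d = Q b c d + N a (b \<noteq> c) d"
  "N (a \<noteq> b) c d = N b c d + sgn_of b * N a (b \<noteq> c) d"
proof -
  show "P a b (c \<noteq> d) = P a (b \<noteq> c) d + P a b c"
    using arg_cong[OF pentagon', of "\<lambda>w. e d (slice_left (e c) (slice_left (D b) (slice_left (D a) w)))"]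
    by (cases a; cases b; cases c; cases d; simp add: coeff_simps \<Phi>_simps add.commute)
  show "Q a b (c \<noteq> d) + P (a \<noteq> b) c d = sgn_of b * P a (b \<noteq> c) d + Q a b c"
    using arg_cong[OF pentagon', of "\<lambda>w. e d (slice_left (D c) (slice_left (e b) (slice_left (D a) w)))"]
    by (cases a; cases b; cases c; cases d; simp add: coeff_simps \<Phi>_simps add.commute)
  show "sgn_of c * Q a b (c \<noteq> d) + Q (a \<noteq> b) c d = Q a (b \<noteq> c) d"
    using arg_cong[OF pentagon', of "\<lambda>w. D d (slice_left (e c) (slice_left (e b) (slice_left (D a) w)))"]
    by (cases a; cases b; cases c; cases d; simp add: coeff_simps \<Phi>_simps add.commute)
  show "N a b (c \<noteq> d) + sgn_of a * P (a \<noteq> b) c d = P b c d + N a b c"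
    using arg_cong[OF pentagon', of "\<lambda>w. e d (slice_left (D c) (slice_left (D b) (slice_left (e a) w)))"]
    by (cases a; cases b; cases c; cases d; simp add: coeff_simps \<Phi>_simps add.commute)
  show "sgn_of c * N a b (c \<noteq> d) + sgn_of a * Q (a \<noteq> b) c d = Q b c d + N a (b \<noteq> c) d"
    using arg_cong[OF pentagon', of "\<lambda>w. D d (slice_left (e c) (slice_left (D b) (slice_left (e a) w)))"]
    by (cases a; cases b; cases c; cases d; simp add: coeff_simps \<Phi>_simps add.commute)
  show "N (a \<noteq> b) c d = N b c d + sgn_of b * N a (b \<noteq> c) d"
    using arg_cong[OF pentagon', of "\<lambda>w. D d (slice_left (D c) (slice_left (e b) (slice_left (e a) w)))"]
    by (cases a; cases b; cases c; cases d; simp add: coeff_simps \<Phi>_simps add.commute)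
qed

text \<open>\<open>\<psi>\<close> is normalised by \<open>\<psi> False False = 0\<close>; the other values are then forced by three of the
  equations in \<open>coeff_coboundary\<close>.\<close>

definition \<psi> where "\<psi> a b = (if a then if b then - N True False False - P True False True else - N
    True False False
  else if b then - P False False True else 0)"

text \<open>The right-hand sides are the degree 2 coefficients of \<open>face3 J * face1 J\<close>
  less those of \<open>(1 \<otimes>\<^sub>t J) * face2 J\<close>, where \<open>J\<close> is 1 plus
  the sum of all \<open>\<psi> i j *\<^sub>C (r i \<otimes>\<^sub>t r j)\<close>. Special cases of
  \<open>coeff_pentagon\<close> reduce \<open>P\<close>, \<open>Q\<close>, \<open>N\<close> to the
  few values that enter \<psi>.\<close>

lemma coeff_coboundary:
  "P a b c = \<psi> a b - \<psi> a (b \<noteq> c)"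
  "Q a b c = \<psi> (a \<noteq> b) c - sgn_of b * \<psi> a (b \<noteq> c)"
  "N a b c = sgn_of a * \<psi> (a \<noteq> b) c - \<psi> b c"
proof -
  have P0: "P a b False = 0" for a b using coeff_pentagon(1)[where a = a and b = b and c = False and
      d = False] by simp
  have PT: "P a True True = - P a False True" for a
    using coeff_pentagon(1)[where a = a and b = False and c = True and d = True] P0 by (simp add:
        eq_neg_iff_add_eq_0)
  have N0: "N False c d = 0" for c d using coeff_pentagon(6)[where a = True and b = False and c = c
      and d = d] by simp
  have NT: "N True True d = N True False d" for d
    using coeff_pentagon(6)[where a = True and b = True and c = True and d = d] N0 by simp
  have Q0: "Q a False d = 0" for a d using coeff_pentagon(3)[where a = a and b = False and c = False
      and d = d] by simp
  have QT: "Q True True True = Q False True False" "Q True True False = Q False True True"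
    using coeff_pentagon(3)[where a = True and b = True and c = True and d = True]
        coeff_pentagon(3)[where a = True and b = True and c = True and d = False] Q0 by simp_all
  have k: "N True False True = P False False True + P True False True + N True False False"
    using coeff_pentagon(4)[where a = True and b = False and c = False and d = True] by (simp add:
        algebra_simps)
  have u: "Q False True False = P True False True - P False False True + Q False True True"
    using coeff_pentagon(2)[where a = False and b = True and c = True and d = True] by (simp add: PT
        algebra_simps)
  \<comment> \<open>The pentagon yields this value only after division by 2.\<close>
  have "2 * Q False True True = 2 * (- N True False False - P True False True)"
    using coeff_pentagon(5)[where a = True and b = False and c = True and d = False] by (simp add:
        QT NT k u algebra_simps) algebra
  then have v: "Q False True True = - N True False False - P True False True"
    by (simp only: mult_left_cancel[OF zero_neq_numeral[symmetric]])
  show "P a b c = \<psi> a b - \<psi> a (b \<noteq> c)"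
    by (cases a; cases b; cases c; simp add: \<psi>_def P0 PT)
  show "Q a b c = \<psi> (a \<noteq> b) c - sgn_of b * \<psi> a (b \<noteq> c)"
    by (cases a; cases b; cases c; simp add: \<psi>_def Q0 QT u v)
  show "N a b c = sgn_of a * \<psi> (a \<noteq> b) c - \<psi> b c"
    by (cases a; cases b; cases c; simp add: \<psi>_def N0 NT k)
qed

lemma trivial_associator_twist_exists:
  obtains J where "invertible_element J" "slice_left \<epsilon> J = 1" "slice_right \<epsilon> J = 1"
    "comult (twist J H) = \<Delta>" "associator (twist J H) = 1"
proof -
  define w where "w = (\<Sum>i\<in>UNIV. \<Sum>j\<in>UNIV. \<psi> i j *\<^sub>C (r i \<otimes>\<^sub>t r j))"
  have w: "slice_left (e i) w = 0" "e j (slice_left (D i) w) = 0" "D j (slice_left (D i) w) = \<psi> i j" for i j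
    by (cases i; cases j; simp add: w_def UNIV_bool sl_simps ev_simps)+
  define J where "J = 1 + w"
  have J: "slice_left (e i) J = 1" "e j (slice_left (D i) J) = 0" "D j (slice_left (D i) J) = \<psi> i j" for i j
    by (simp_all add: J_def sl_simps w)
  have "w * w = 0"
    by (rule sl_eqI; rule ev_eqI; simp add: sl_simps ev_simps w)
  then have "J * (1 - w) = 1" "(1 - w) * J = 1" by (simp_all add: J_def algebra_simps)
  then have inv: "invertible_element J" by (rule invertible_elementI)
  note JK = invertible_elementD[OF inv]
  have \<epsilon>r: "\<epsilon> (r i) = 0" for i using e_r[of False i] by (simp add: e_counit)
  have l: "slice_left \<epsilon> J = 1" "slice_right \<epsilon> J = 1"
    by (simp_all add: J_def w_def UNIV_bool algebra_homD[OF algebra_hom_slice_left[OF counit_hom]]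
        algebra_homD[OF algebra_hom_slice_right[OF counit_hom]]
      slice_left_tens slice_right_tens \<epsilon>_lin \<epsilon>r)
  \<comment> \<open>Only coefficients at two derivations could differ. There \<open>w\<close>
    contributes \<psi> times \<open>e (i \<noteq> j) a\<close> from either side, since negating both
    indices does not affect \<open>i \<noteq> j\<close>.\<close>
  have J\<Delta>: "J * \<Delta> a = \<Delta> a * J" for a
    by (rule sl_eqI; rule ev_eqI; simp add: sl_simps ev_simps J conv_e conv_table mult.commute)
  have "J * \<Delta> a * inverse_element J = \<Delta> a" for a
    unfolding J\<Delta> mult.assoc JK mult_1_right ..
  then have comult: "comult (twist J H) = \<Delta>" by (simp add: twist_def)
  \<comment> \<open>Equivalent to triviality of the twisted associator. In degree 2 it is
    \<open>coeff_coboundary\<close>; all other coefficients on both sides are those of 1.\<close>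
  have eq: "(1 \<otimes>\<^sub>t J) * face2 J * \<Phi> = face3 J * face1 J"
  proof (rule sl_eqI; rule sl_eqI; rule ev_eqI)
  qed (simp_all add: coeff_simps \<Phi>_simps J coeff_coboundary)
  interpret tw: twisted_quasi_hopf H J by unfold_locales (use inv l in auto)
  have "associator (twist J H) = 1"
    unfolding tw.T_simps(4) eq
    by (simp only: mult.assoc tw.inv_hom[OF face_hom(1), THEN mult_cancel_left_inverse]
        tw.inv_hom[OF face_hom(3)])
  with that inv l comult show thesis by blast
qed

end

context quasi_hopf_algebra begin

lemma twist_1: "twist 1 H = H"
proof -
  have i: "inverse_element (1 :: 'a \<otimes> 'a) = 1" by (rule inverse_element_unique) simp_all
  have "comult (twist 1 H) = comult H" "counit (twist 1 H) = counit H" "antipode (twist 1 H) = antipode H"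
    by (simp_all add: twist_def i)
  moreover have "associator (twist 1 H) = associator H"
    unfolding twist_def i quasi_hopf.simps face1_def[symmetric] face2_def[symmetric]
        face3_def[symmetric] face_1
    by (simp add: one_tensor_def[symmetric])
  moreover have "alpha (twist 1 H) = alpha H" "beta (twist 1 H) = beta H"
    unfolding twist_def i quasi_hopf.simps act_left_def[symmetric] act_right_def[symmetric]
    by (simp_all add: one_tensor_def act_tens S_simps)
  ultimately show ?thesis by simp
qed

end

section \<open>Identification with the Sweedler algebra\<close>

definition sweedler_char :: "bool \<Rightarrow> sweedler \<Rightarrow> complex"
  where "sweedler_char i q = (if i then coeff_1 q - coeff_g q else coeff_1 q + coeff_g q)"
definition sweedler_der :: "bool \<Rightarrow> sweedler \<Rightarrow> complex"
  where "sweedler_der i q = (if i then coeff_x q + coeff_gx q else coeff_x q - coeff_gx q)"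

text \<open>The constants are the idempotents (1 + g)/2, (1 - g)/2 and their left multiples by
  \<open>x\<close>; the last coordinate changes sign because \<open>x\<close> and \<open>g\<close>
  anticommute.\<close>

global_interpretation sweedler: sweedler_dual_basis sweedler_char sweedler_der
  "\<lambda>i. Sweedler (1 / 2) (if i then - 1 / 2 else 1 / 2) 0 0" "\<lambda>i. Sweedler 0 0 (1 / 2) (if i then 1 /
      2 else - 1 / 2)"
proof
  fix i j a
  show "algebra_hom (sweedler_char i)"
    by (cases i) (simp_all add: algebra_hom_def clinear_iff sweedler_char_def sweedler_simps
        scaleC_complex_def algebra_simps)
  show "skew_derivation (sweedler_char (\<not> i)) (sweedler_char i) (sweedler_der i)"
    by (cases i) (simp_all add: skew_derivation_def clinear_iff sweedler_char_def sweedler_der_def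
        sweedler_simps scaleC_complex_def algebra_simps)
  show "a = (\<Sum>i\<in>UNIV. sweedler_char i a *\<^sub>C Sweedler (1 / 2) (if i then - 1 / 2 else 1 / 2) 0 0) +
      (\<Sum>i\<in>UNIV. sweedler_der i a *\<^sub>C Sweedler 0 0 (1 / 2) (if i then 1 / 2 else - 1 / 2))"
    by (cases a) (simp add: UNIV_bool sweedler_char_def sweedler_der_def sweedler_simps field_simps)
qed (simp_all add: sweedler_char_def sweedler_der_def)

context sweedler_comult begin

text \<open>The element with the same four coefficients, found by inverting
  \<open>sweedler_char\<close> and \<open>sweedler_der\<close>.\<close>

definition to_sweedler :: "'a \<Rightarrow> sweedler"
  where "to_sweedler a = Sweedler ((e False a + e True a) / 2) ((e False a - e True a) / 2)
    ((D False a + D True a) / 2) ((D True a - D False a) / 2)"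

lemma char_to_sweedler: "sweedler_char i (to_sweedler a) = e i a" "sweedler_der i (to_sweedler a) = D i a"
  by (simp_all add: sweedler_char_def sweedler_der_def to_sweedler_def field_simps)

lemma algebra_hom_to_sweedler: "algebra_hom to_sweedler"
  unfolding algebra_hom_def clinear_iff
  by (intro conjI allI; rule sweedler.ev_eqI; simp add: char_to_sweedler ev_simps sweedler.ev_simps)

lemma bij_to_sweedler: "bij to_sweedler"
proof (rule bijI)
  show "inj to_sweedler"
    by (rule injI, rule ev_eqI) (metis char_to_sweedler)+
  have "q = to_sweedler (\<Sum>i\<in>UNIV. sweedler_char i q *\<^sub>C p i + sweedler_der i q *\<^sub>C r i)" for q
    by (rule sweedler.ev_eqI; rename_tac i; case_tac i; simp add: char_to_sweedler UNIV_bool ev_simps)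
  then show "surj to_sweedler" by (rule surjI[OF sym])
qed

text \<open>Both coproducts have the same convolution table, so they correspond. For trivial \<Phi>
  the elements alpha and beta are inverse to each other, and the freedom of \<open>u\<close> in an
  isomorphism absorbs them.\<close>

lemma twist_equivalent_H4:
  assumes \<Phi>1: "\<Phi> = 1"
  shows "twist_equivalent H H4"
proof -
  note h = algebra_hom_to_sweedler
  note hs = algebra_homD[OF h]
  have comult: "comult H4 (to_sweedler a) = tensor_map to_sweedler to_sweedler (\<Delta> a)" for a
  proof (rule sweedler.sl_eqI; rule sweedler.ev_eqI)
    have c: "(\<lambda>a. sweedler_char i (to_sweedler a)) = e i" "(\<lambda>a. sweedler_der i (to_sweedler a)) = D i" for i
      by (simp_all add: char_to_sweedler fun_eq_iff)
    note simps = slice_left_tensor_map[OF sweedler.e_lin hs(1) hs(1)] slice_left_tensor_map[OF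
        sweedler.D_lin hs(1) hs(1)]
      c char_to_sweedler conv_e conv_table H4_def sweedler.sl_simps sweedler.ev_simps
    have v: "sweedler_char i sw_g = sgn_of i" "sweedler_der i sw_g = 0" "sweedler_char i sw_x = 0"
        "sweedler_der i sw_x = 1" for i
      by (simp_all add: sweedler_char_def sweedler_der_def sw_g_def sw_x_def)
    fix i j
    show "sweedler_char j (slice_left (sweedler_char i) (comult H4 (to_sweedler a))) =
        sweedler_char j (slice_left (sweedler_char i) (tensor_map to_sweedler to_sweedler (\<Delta> a)))"
      by (cases i; cases j; simp add: simps v; simp add: to_sweedler_def field_simps)
    show "sweedler_der j (slice_left (sweedler_char i) (comult H4 (to_sweedler a))) =
        sweedler_der j (slice_left (sweedler_char i) (tensor_map to_sweedler to_sweedler (\<Delta> a)))"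
      by (cases i; cases j; simp add: simps v; simp add: to_sweedler_def field_simps)
    show "sweedler_char j (slice_left (sweedler_der i) (comult H4 (to_sweedler a))) =
        sweedler_char j (slice_left (sweedler_der i) (tensor_map to_sweedler to_sweedler (\<Delta> a)))"
      by (cases i; cases j; simp add: simps v; simp add: to_sweedler_def field_simps)
    show "sweedler_der j (slice_left (sweedler_der i) (comult H4 (to_sweedler a))) =
        sweedler_der j (slice_left (sweedler_der i) (tensor_map to_sweedler to_sweedler (\<Delta> a)))"
      by (cases i; cases j; simp add: simps v)
  qed
  have counit: "counit H4 (to_sweedler a) = \<epsilon> a" for a
    by (simp add: H4_def to_sweedler_def e_counit[symmetric] field_simps)
  have ba: "beta H * alpha H = 1"
    using act3_one(1) by (simp add: \<Phi>1 one_tensor_def act3_simps act_tens S_simps)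
  have i1: "inverse_element (1 :: 'a \<otimes> 'a \<otimes> 'a) = 1" by (rule inverse_element_unique) simp_all
  have ab: "alpha H * beta H = 1"
    using act3_one(2) by (simp add: \<Phi>1 i1, simp add: one_tensor_def act3_simps act_tens S_simps)
  \<comment> \<open>The ordinary antipode after absorbing alpha and beta. Being antimultiplicative,
    it is determined by its values at \<open>g\<close> and \<open>x\<close>, which the left antipode
    axiom supplies.\<close>
  define S' where "S' a = beta H * S a * alpha H" for a
  have S'_lin: "clinear S'"
    by (simp add: S'_def[abs_def] clinear_iff S_simps distrib_left distrib_right mult_scaleC_left
        mult_scaleC_right)
  have S'_mult: "S' (a * b) = S' b * S' a" for a b
  proof -
    have "S' b * S' a = beta H * S b * (alpha H * beta H) * S a * alpha H" by (simp only: S'_def mult.assoc)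
    then show ?thesis by (simp add: ab S'_def S_simps mult.assoc)
  qed
  have S'_1: "S' 1 = 1" by (simp add: S'_def S_simps ba)
  have eg: "\<epsilon> g = 1" "\<epsilon> x = 0" using ev_g(1)[of False] ev_x(1)[of False] by (simp_all add: e_counit)
  have ant: "act_left (alpha H) (\<Delta> a) = \<epsilon> a *\<^sub>C alpha H" for a
    by (simp add: act_left_def antipode_left)
  have "S g * alpha H * g = alpha H" using ant[of g] by (simp add: \<Delta>_g act_tens eg scaleC_one)
  from arg_cong[OF this, of "\<lambda>y. beta H * y"] have "S' g * g = 1" by (simp add: S'_def mult.assoc ba)
  from arg_cong[OF this, of "\<lambda>y. y * g"] have S'_g: "S' g = g" by (simp add: mult.assoc gx)
  have "S x * alpha H + S g * alpha H * x = 0" using ant[of x] by (simp add: \<Delta>_x act_simps eg)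
  from arg_cong[OF this, of "\<lambda>y. beta H * y"] have "S' x + S' g * x = 0" by (simp add: S'_def
      mult.assoc distrib_left)
  then have S'_x: "S' x = - (g * x)" by (simp add: S'_g eq_neg_iff_add_eq_0)
  have f4: "antipode H4 (to_sweedler a) = to_sweedler (S' a)" for a
  proof -
    have l: "clinear (\<lambda>a. antipode H4 (to_sweedler a))" "clinear (\<lambda>a. to_sweedler (S' a))"
      by (rule clinear_compose[OF hs(1)], simp add: clinear_iff H4_def sw_g_def sw_x_def
          sweedler_simps algebra_simps,
          rule clinear_compose[OF S'_lin hs(1)])
    have S'p: "S' (p i) = p i" for i
      by (simp add: pr(1) clinear_scale[OF S'_lin] clinear_add[OF S'_lin] S'_1 S'_g)
    have S'r: "S' (r i) = - (p i * (g * x))" for i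
      by (simp add: pr(2) S'_mult S'p S'_x)
    have fp: "antipode H4 (to_sweedler (p i)) = to_sweedler (p i)" for i
      by (cases i) (simp_all add: H4_def to_sweedler_def ev_simps sw_g_def sw_x_def sweedler_simps)
    have fr: "antipode H4 (to_sweedler (r i)) = to_sweedler (- (p i * (g * x)))" for i
      by (cases i) (simp_all add: H4_def to_sweedler_def ev_simps ev_g ev_x sw_g_def sw_x_def
          sweedler_simps)
    show ?thesis
      by (subst functional_expand[OF l(1)], subst functional_expand[OF l(2)]) (simp only: fp fr S'p S'r)
  qed
  have u: "to_sweedler (beta H) * to_sweedler (alpha H) = 1" "to_sweedler (alpha H) * to_sweedler
      (beta H) = 1"
    by (simp_all add: hs(3)[symmetric] ab ba hs(2))
  have inv: "inverse_element (to_sweedler (beta H)) = to_sweedler (alpha H)"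
    by (rule inverse_element_unique[OF u])
  have "quasi_hopf_iso to_sweedler H H4"
    unfolding quasi_hopf_iso_def
  \<comment> \<open>This \<open>u\<close> is forced, since \<open>beta H4\<close> is 1.\<close>
  proof (intro conjI allI exI[of _ "to_sweedler (beta H)"])
    show "associator H4 = tensor_map to_sweedler (tensor_map to_sweedler to_sweedler) \<Phi>"
      by (simp add: \<Phi>1 algebra_homD(2)[OF algebra_hom_tensor_map[OF h algebra_hom_tensor_map[OF h
          h]]] H4_def)
    show "invertible_element (to_sweedler (beta H))" by (rule invertible_elementI[OF u])
    show "antipode H4 (to_sweedler a) = to_sweedler (beta H) * to_sweedler (S a) * inverse_element
        (to_sweedler (beta H))" for a
      by (simp add: f4 S'_def inv hs(3))
    show "alpha H4 = to_sweedler (beta H) * to_sweedler (alpha H)"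
      "beta H4 = to_sweedler (beta H) * inverse_element (to_sweedler (beta H))"
      by (simp_all add: u inv) (simp_all add: H4_def)
  qed (simp_all add: h bij_to_sweedler comult counit)
  moreover have "invertible_element (1 :: 'a \<otimes> 'a)" by (rule invertible_elementI[of _ 1]) simp_all
  moreover have "slice_left \<epsilon> (1 :: 'a \<otimes> 'a) = 1" "slice_right \<epsilon> (1 :: 'a \<otimes> 'a) = 1"
    by (simp_all add: algebra_homD(2)[OF algebra_hom_slice_left[OF counit_hom]] algebra_homD(2)[OF
        algebra_hom_slice_right[OF counit_hom]])
  ultimately show ?thesis
    unfolding twist_equivalent_def using twist_1 by metis
qed

end

theorem corollary3p6:
  fixes H :: "'a::complex_algebra_1 quasi_hopf"
  assumes "quasi_hopf_algebra H"
    and "complex_vector.dim (UNIV :: 'a set) = 4"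
    and "\<not> semisimple_ring TYPE('a)"
  shows "twist_equivalent H H4"
proof -
  interpret H0: quasi_hopf_algebra H by fact
  obtain e D and p r :: "bool \<Rightarrow> 'a" where basis: "sweedler_dual_basis e D p r" "e False = counit H"
    "H0.conv (e True) (e True) = counit H"
    using H0.sweedler_dual_basis_exists[OF assms(2,3)] .
  interpret B: sweedler_dual_basis e D p r by fact
  interpret H0: sweedler_quasi_hopf H e D p r
    by unfold_locales (use basis(2) fun_cong[OF basis(3)] in \<open>simp_all add: H0.conv_def\<close>)
  obtain J where J: "invertible_element J" "slice_left (counit H) J = 1" "slice_right (counit H) J = 1"
    "comult (twist J H) B.g = B.g \<otimes>\<^sub>t B.g"
    using H0.grouplike_twist_exists .
  interpret TJ: twisted_quasi_hopf H J by unfold_locales (use J in auto)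
  let ?H1 = "twist J H"
  interpret H1: sweedler_quasi_hopf ?H1 e D p r using J(1-3) by (rule H0.twist_sweedler)
  obtain K where K: "invertible_element K" "slice_left (counit ?H1) K = 1" "slice_right (counit ?H1) K = 1"
    "comult (twist K ?H1) B.g = B.g \<otimes>\<^sub>t B.g" "comult (twist K ?H1) B.x = B.x \<otimes>\<^sub>t 1 + B.g \<otimes>\<^sub>t B.x"
    using H1.sweedler_comult_twist_exists[OF J(4)] .
  interpret TK: twisted_quasi_hopf ?H1 K by unfold_locales (use K in auto)
  let ?H2 = "twist K ?H1"
  interpret H2: sweedler_quasi_hopf ?H2 e D p r using K(1-3) by (rule H1.twist_sweedler)
  interpret H2: sweedler_comult ?H2 e D p r by unfold_locales (use K in auto)
  obtain L where L: "invertible_element L" "slice_left (counit ?H2) L = 1" "slice_right (counit ?H2) L = 1"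
    "comult (twist L ?H2) = comult ?H2" "associator (twist L ?H2) = 1"
    using H2.trivial_associator_twist_exists .
  interpret TL: twisted_quasi_hopf ?H2 L by unfold_locales (use L in auto)
  let ?H3 = "twist L ?H2"
  interpret H3: sweedler_quasi_hopf ?H3 e D p r using L(1-3) by (rule H2.twist_sweedler)
  \<comment> \<open>The last twist keeps the coproduct, so the normal form at \<open>g\<close> and
    \<open>x\<close> survives it.\<close>
  interpret H3: sweedler_comult ?H3 e D p r by unfold_locales (use K L(4) in auto)
  have "twist_equivalent ?H3 H4" using L(5) by (rule H3.twist_equivalent_H4)
  then show ?thesis
    by (intro TJ.twist_equivalent_twist TK.twist_equivalent_twist TL.twist_equivalent_twist)
qed

end
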